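(* Let $G$ be a group and let $X$ be a non-trivial strongly irreducible $G$-subshift which satisfies the strong topological Markov property. For every finite alphabet $A$: (1) If $G$ is not locally finite, then $\operatorname{Aut}(A^{\mathbb{Z}})$ embeds into $\operatorname{Aut}(X)$. (2) If $G$ is nonamenable, then $\operatorname{Aut}(A^{F_k})$ embeds into $\operatorname{Aut}(X)$ for every $k\geq 1$.
   Context: Let $B$ be a finite set (alphabet) and $G$ a (discrete) group. $B^G=\{x\colon G\to B\}$ carries the prodiscrete topology and the left shift action $(gx)(h)=x(g^{-1}h)$. A $G$-subshift is a closed, shift-invariant subset $X\subset B^G$ for some finite alphabet $B$; it is non-trivial if it is neither empty nor a single point. For finite $F\subset G$, $L_F(X)=\{x|_F : x\in X\}$. $X$ is strongly irreducible if there is a finite $K\subset G$ such that whenever $S,T\subset G$ are finite with $SK\cap T=\varnothing$, for every $p\in L_S(X)$ and $q\in L_T(X)$ there is $x\in X$ with $x|_S=p$ and $x|_T=q$. $X$ has the strong topological Markov property (strong TMP) if there is a finite $M\subset G$ such that for every finite $F\subset G$ and all $x,y\in X$ with $x|_{FM\smallsetminus F}=y|_{FM\smallsetminus F}$, the configuration equal to $x$ on $F$ and to $y$ on $G\smallsetminus F$ belongs to $X$. $\operatorname{Aut}(X)$ is the group of all $G$-equivariant homeomorphisms $X\to X$ under composition. $F_k$ is the free group of rank $k$, and $\operatorname{Aut}(A^{F_k})$, $\operatorname{Aut}(A^{\mathbb{Z}})$ are the automorphism groups of the full shifts over $F_k$, $\mathbb{Z}$. "Embeds" means that there is an injective group homomorphism.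 $G$ is locally finite if all its finitely generated subgroups are finite. $G$ is nonamenable if there are a finite $T\subset G$ and $\delta>0$ with $|FT\smallsetminus F|>\delta|F|$ for every (nonempty) finite $F\subset G$. *)

theory Defs
  imports
    "HOL-Analysis.Function_Topology"
    "HOL-Algebra.Bij"
    "HOL-Algebra.Elementary_Groups"
begin

section \<open>Subshifts\<close>

text \<open>
  A group is a record with carrier, an alphabet is a finite set, and a configuration is a function
  that is extensional on the carrier of the group, i.e. takes the value \<^term>\<open>undefined\<close> off it.
\<close>

definition full_shift :: "('g, 'm) monoid_scheme \<Rightarrow> 'b set \<Rightarrow> ('g \<Rightarrow> 'b) set" where
  "full_shift G B = carrier G \<rightarrow>\<^sub>E B"

definition prodiscrete :: "('g, 'm) monoid_scheme \<Rightarrow> 'b set \<Rightarrow> ('g \<Rightarrow> 'b) topology" where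
  "prodiscrete G B = product_topology (\<lambda>_. discrete_topology B) (carrier G)"

definition shift :: "('g, 'm) monoid_scheme \<Rightarrow> 'g \<Rightarrow> ('g \<Rightarrow> 'b) \<Rightarrow> ('g \<Rightarrow> 'b)" where
  "shift G g x = (\<lambda>h\<in>carrier G. x (inv\<^bsub>G\<^esub> g \<otimes>\<^bsub>G\<^esub> h))"

definition subshift :: "('g, 'm) monoid_scheme \<Rightarrow> 'b set \<Rightarrow> ('g \<Rightarrow> 'b) set \<Rightarrow> bool" where
  "subshift G B X \<longleftrightarrow>
     finite B \<and> X \<subseteq> full_shift G B \<and> closedin (prodiscrete G B) X \<and>
     (\<forall>g\<in>carrier G. \<forall>x\<in>X. shift G g x \<in> X)"

definition nontrivial :: "('g \<Rightarrow> 'b) set \<Rightarrow> bool" where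
  "nontrivial X \<longleftrightarrow> X \<noteq> {} \<and> (\<nexists>x. X = {x})"

definition patterns :: "'g set \<Rightarrow> ('g \<Rightarrow> 'b) set \<Rightarrow> ('g \<Rightarrow> 'b) set" where
  "patterns F X = (\<lambda>x. restrict x F) ` X"

definition strongly_irreducible :: "('g, 'm) monoid_scheme \<Rightarrow> ('g \<Rightarrow> 'b) set \<Rightarrow> bool" where
  "strongly_irreducible G X \<longleftrightarrow>
     (\<exists>K. finite K \<and> K \<subseteq> carrier G \<and>
       (\<forall>S T. finite S \<and> S \<subseteq> carrier G \<and> finite T \<and> T \<subseteq> carrier G \<and> (S <#>\<^bsub>G\<^esub> K) \<inter> T = {} \<longrightarrow>
         (\<forall>p\<in>patterns S X. \<forall>q\<in>patterns T X. \<exists>x\<in>X. restrict x S = p \<and> restrict x T = q)))"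

definition strong_TMP :: "('g, 'm) monoid_scheme \<Rightarrow> ('g \<Rightarrow> 'b) set \<Rightarrow> bool" where
  "strong_TMP G X \<longleftrightarrow>
     (\<exists>M. finite M \<and> M \<subseteq> carrier G \<and>
       (\<forall>F. finite F \<and> F \<subseteq> carrier G \<longrightarrow>
         (\<forall>x\<in>X. \<forall>y\<in>X. restrict x ((F <#>\<^bsub>G\<^esub> M) - F) = restrict y ((F <#>\<^bsub>G\<^esub> M) - F) \<longrightarrow>
           (\<lambda>h. if h \<in> F then x h else y h) \<in> X)))"


section \<open>Automorphism groups\<close>

definition shift_automorphisms ::
    "('g, 'm) monoid_scheme \<Rightarrow> 'b set \<Rightarrow> ('g \<Rightarrow> 'b) set \<Rightarrow> (('g \<Rightarrow> 'b) \<Rightarrow> ('g \<Rightarrow> 'b)) set" where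
  "shift_automorphisms G B X =
     {f \<in> Bij X.
        homeomorphic_map (subtopology (prodiscrete G B) X) (subtopology (prodiscrete G B) X) f \<and>
        (\<forall>g\<in>carrier G. \<forall>x\<in>X. f (shift G g x) = shift G g (f x))}"

definition Aut_shift ::
    "('g, 'm) monoid_scheme \<Rightarrow> 'b set \<Rightarrow> ('g \<Rightarrow> 'b) set \<Rightarrow> (('g \<Rightarrow> 'b) \<Rightarrow> ('g \<Rightarrow> 'b)) monoid" where
  "Aut_shift G B X = BijGroup X \<lparr>carrier := shift_automorphisms G B X\<rparr>"

definition embeds_into :: "('a, 'm) monoid_scheme \<Rightarrow> ('b, 'n) monoid_scheme \<Rightarrow> bool" where
  "embeds_into H K \<longleftrightarrow> mon H K \<noteq> {}"

lemma topspace_prodiscrete: "topspace (prodiscrete G B) = full_shift G B"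
  by (simp add: prodiscrete_def full_shift_def)

lemma group_Aut_shift:
  assumes X: "subshift G B X"
  shows "group (Aut_shift G B X)"
proof -
  let ?T = "subtopology (prodiscrete G B) X"
  have top: "topspace ?T = X"
    using X by (auto simp: topspace_prodiscrete subshift_def)
  have inv: "shift G g x \<in> X" if "g \<in> carrier G" "x \<in> X" for g x
    using X that by (auto simp: subshift_def)
  have "subgroup (shift_automorphisms G B X) (BijGroup X)"
  proof (rule group.subgroupI[OF group_BijGroup])
    show "shift_automorphisms G B X \<subseteq> carrier (BijGroup X)"
      by (auto simp: shift_automorphisms_def BijGroup_def)
    have "(\<lambda>x\<in>X. x) \<in> shift_automorphisms G B X"
      using homeomorphic_map_eq[of ?T ?T id "\<lambda>x\<in>X. x"] top inv
      by (auto simp: shift_automorphisms_def id_Bij homeomorphic_map_id)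
    then show "shift_automorphisms G B X \<noteq> {}" by blast
  next
    fix f assume f: "f \<in> shift_automorphisms G B X"
    then have fB: "f \<in> Bij X" and fh: "homeomorphic_map ?T ?T f"
      and fe: "\<And>g x. g \<in> carrier G \<Longrightarrow> x \<in> X \<Longrightarrow> f (shift G g x) = shift G g (f x)"
      by (auto simp: shift_automorphisms_def)
    have bij: "bij_betw f X X" using fB by (simp add: Bij_def)
    let ?h = "\<lambda>x\<in>X. inv_into X f x"
    obtain g where g: "homeomorphic_maps ?T ?T f g"
      using fh homeomorphic_map_maps by blast
    have gX: "g x \<in> X" "f (g x) = x" if "x \<in> X" for x
      using g that top unfolding homeomorphic_maps_def
      by (auto simp: continuous_map_def Pi_iff)
    have "?h x = g x" if "x \<in> X" for x
      using that gX[OF that] bij by (metis bij_betw_def inv_into_f_f restrict_apply')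
    moreover have "homeomorphic_map ?T ?T g"
      using g homeomorphic_maps_map by blast
    ultimately have "homeomorphic_map ?T ?T ?h"
      using homeomorphic_map_eq[of ?T ?T g ?h] top by auto
    moreover have "?h (shift G a x) = shift G a (?h x)" if a: "a \<in> carrier G" and x: "x \<in> X" for a x
    proof -
      have hx: "?h x \<in> X" "f (?h x) = x"
        using bij x by (auto simp: bij_betw_def inv_into_into f_inv_into_f)
      have "f (shift G a (?h x)) = shift G a x"
        using fe[OF a hx(1)] hx(2) by simp
      then show ?thesis
        using inv[OF a hx(1)] inv[OF a x] bij
        by (metis bij_betw_def inv_into_f_f restrict_apply')
    qed
    moreover have "?h \<in> Bij X" by (rule restrict_inv_into_Bij[OF fB])
    ultimately have "?h \<in> shift_automorphisms G B X"
      unfolding shift_automorphisms_def by blast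
    then show "inv\<^bsub>BijGroup X\<^esub> f \<in> shift_automorphisms G B X"
      using fB by (simp add: inv_BijGroup)
  next
    fix f h assume f: "f \<in> shift_automorphisms G B X" and h: "h \<in> shift_automorphisms G B X"
    then have B: "f \<in> Bij X" "h \<in> Bij X"
      by (auto simp: shift_automorphisms_def)
    have "homeomorphic_map ?T ?T (f \<circ> h)"
      using f h homeomorphic_map_compose by (auto simp: shift_automorphisms_def)
    then have "homeomorphic_map ?T ?T (compose X f h)"
      using homeomorphic_map_eq[of ?T ?T "f \<circ> h" "compose X f h"] top by (auto simp: compose_def)
    moreover have "h x \<in> X" if "x \<in> X" for x
      using B that by (auto simp: Bij_def bij_betw_def)
    ultimately have "compose X f h \<in> shift_automorphisms G B X"
      using f h inv compose_Bij[OF B] by (auto simp: shift_automorphisms_def compose_eq)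
    then show "f \<otimes>\<^bsub>BijGroup X\<^esub> h \<in> shift_automorphisms G B X"
      using B by (simp add: BijGroup_def)
  qed
  then show ?thesis
    unfolding Aut_shift_def by (rule subgroup.subgroup_is_group[OF _ group_BijGroup])
qed


section \<open>Local finiteness and nonamenability\<close>

definition locally_finite_group :: "('g, 'm) monoid_scheme \<Rightarrow> bool" where
  "locally_finite_group G \<longleftrightarrow> (\<forall>S. finite S \<and> S \<subseteq> carrier G \<longrightarrow> finite (generate G S))"

definition nonamenable :: "('g, 'm) monoid_scheme \<Rightarrow> bool" where
  "nonamenable G \<longleftrightarrow>
     (\<exists>T (\<delta>::real). finite T \<and> T \<subseteq> carrier G \<and> \<delta> > 0 \<and>
       (\<forall>F. finite F \<and> F \<noteq> {} \<and> F \<subseteq> carrier G \<longrightarrow>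
         real (card ((F <#>\<^bsub>G\<^esub> T) - F)) > \<delta> * real (card F)))"


section \<open>The free group of rank \<open>k\<close>\<close>

text \<open>
  Elements are reduced words in the letters \<open>(i, b)\<close> with \<open>i < k\<close>; the letter \<open>(i, True)\<close> is the
  \<open>i\<close>-th generator and \<open>(i, False)\<close> its inverse. The product is concatenation followed by free
  cancellation: the letters of the left factor are pushed one by one onto the right factor.
\<close>

type_synonym letter = "nat \<times> bool"

definition letter_inv :: "letter \<Rightarrow> letter" where
  "letter_inv a = (fst a, \<not> snd a)"

definition reduced :: "letter list \<Rightarrow> bool" where
  "reduced w \<longleftrightarrow> successively (\<lambda>a b. b \<noteq> letter_inv a) w"

fun push :: "letter \<Rightarrow> letter list \<Rightarrow> letter list" where
  "push a [] = [a]"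
| "push a (b # w) = (if b = letter_inv a then w else a # b # w)"

definition free_group :: "nat \<Rightarrow> letter list monoid" where
  "free_group k =
     \<lparr>carrier = {w. reduced w \<and> set w \<subseteq> {..<k} \<times> UNIV},
      monoid.mult = (\<lambda>u v. foldr push u v),
      one = []\<rparr>"

lemma letter_inv_letter_inv [simp]: "letter_inv (letter_inv a) = a"
  by (simp add: letter_inv_def)

lemma letter_inv_neq [simp]: "letter_inv a \<noteq> a" "a \<noteq> letter_inv a"
  by (cases a; simp add: letter_inv_def)+

lemma reduced_Nil [simp]: "reduced []"
  by (simp add: reduced_def)

lemma reduced_ConsD: "reduced (a # w) \<Longrightarrow> reduced w"
  by (cases w) (auto simp: reduced_def)

lemma reduced_push: "reduced w \<Longrightarrow> reduced (push a w)"
  using reduced_ConsD[of "hd w" "tl w"] by (cases w) (auto simp: reduced_def)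

lemma push_reduced: "reduced (a # w) \<Longrightarrow> push a w = a # w"
  by (cases w) (auto simp: reduced_def)

lemma push_cancel: "reduced w \<Longrightarrow> push a (push (letter_inv a) w) = w"
proof (cases w)
  case (Cons b v)
  assume "reduced w"
  then show ?thesis
    using Cons push_reduced[of b v] by auto
qed simp

lemma set_push: "set (push a w) \<subseteq> insert a (set w)"
  by (cases w) auto

lemma reduced_foldr_push: "reduced v \<Longrightarrow> reduced (foldr push u v)"
  by (induction u) (auto simp: reduced_push)

lemma set_foldr_push: "set (foldr push u v) \<subseteq> set u \<union> set v"
proof (induction u)
  case (Cons a u)
  then show ?case using set_push[of a "foldr push u v"] by auto
qed simp

lemma foldr_push_push:
  assumes "reduced w"
  shows "foldr push (push a v) w = push a (foldr push v w)"
proof (cases v)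
  case (Cons b v')
  show ?thesis
  proof (cases "b = letter_inv a")
    case True
    then show ?thesis
      using push_cancel[of "foldr push v' w" a] assms Cons by (simp add: reduced_foldr_push)
  qed (use Cons in simp)
qed simp

lemma foldr_push_assoc:
  "reduced w \<Longrightarrow> foldr push (foldr push u v) w = foldr push u (foldr push v w)"
  by (induction u) (auto simp: foldr_push_push)

lemma foldr_push_reduced: "reduced u \<Longrightarrow> foldr push u [] = u"
proof (induction u)
  case (Cons a u)
  then show ?case using reduced_ConsD[of a u] push_reduced[of a u] by simp
qed simp

lemma foldr_push_inverse: "foldr push (rev (map letter_inv u)) u = []"
  by (induction u) auto

lemma group_free_group: "group (free_group k)"
proof (rule groupI)
  fix u assume u: "u \<in> carrier (free_group k)"
  let ?w = "rev (map letter_inv u)"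
  let ?v = "foldr push ?w []"
  have "?v \<in> carrier (free_group k)"
    using u set_foldr_push[of ?w "[]"]
    by (fastforce simp: free_group_def reduced_foldr_push letter_inv_def)
  moreover have "foldr push ?v u = []"
    using u foldr_push_assoc[of u ?w "[]"] foldr_push_inverse by (simp add: free_group_def)
  ultimately show "\<exists>v\<in>carrier (free_group k). v \<otimes>\<^bsub>free_group k\<^esub> u = \<one>\<^bsub>free_group k\<^esub>"
    by (auto simp: free_group_def)
next
  fix u v assume "u \<in> carrier (free_group k)" "v \<in> carrier (free_group k)"
  then show "u \<otimes>\<^bsub>free_group k\<^esub> v \<in> carrier (free_group k)"
    using set_foldr_push[of u v] by (auto simp: free_group_def reduced_foldr_push)
qed (simp_all add: free_group_def foldr_push_assoc)

end

theory Submission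
  imports Defs
begin

text \<open>
  Strong irreducibility and the Markov property give finite patterns, called eggs, that can be placed
  at any sufficiently sparse set of positions, whose state can be changed without leaving \<open>X\<close> and
  without creating or destroying other eggs, and which take \<open>2 ^ n\<close> states although
  the required sparseness is only polynomial in \<open>n\<close>. The state of an egg holds two symbols of
  \<open>A\<close> and, for every letter of the free group, a possible displacement to a neighbouring egg. Links
  confirmed from both ends are partial injections; laying two oppositely running sheets over every egg
  turns them into permutations, that is, into an action of the free group on the eggs of any \<open>x\<close>
  in \<open>X\<close>. An automorphism of the full shift over the free group is then applied along the orbits of this
  action. This is faithful as soon as arbitrarily large balls of the free group embed as sparse sets
  of eggs with displacements from a fixed finite set of size polynomial in the sparseness: along a
  loop-erased path if \<open>G\<close> is not locally finite (rank one), and by Hall's marriage theorem if \<open>G\<close> is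
  nonamenable.
\<close>

section \<open>Gluing and replacement\<close>

text \<open>Gluing leaves a configuration uncontrolled away from the prescribed cells, so stray
  copies of the marker of an egg may stand near a genuine one. Nothing in the hypotheses supplies a
  marker that can be erased. It is found by counting: among \<open>2 ^ n\<close> fillings only
  polynomially many can reappear in the chosen replacements, so some filling never does. Erasing
  must not damage the eggs themselves, hence it says nothing about copies that overlap the base of
  an egg; each such displacement is excluded by a remote pair of cells with different values, added
  to the window. This fails exactly for displacements that act trivially on \<open>X\<close>. They
  form a finite normal subgroup \<open>kern\<close>, positions are known only modulo it, and yolks
  and updates are made invariant under it. The second obstacle is a circularity: states have to name
  displacements, the range of the displacements depends on the sparseness, and the sparseness
  depends on the number \<open>n\<close> of bits of a state. It is broken because sparseness and
  range grow polynomially in \<open>n\<close>, while the states number \<open>2 ^ n\<close>.\<close>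

context group begin

lemma inv_mult_cancel [simp]:
  "x \<in> carrier G \<Longrightarrow> y \<in> carrier G \<Longrightarrow> inv x \<otimes> (x \<otimes> y) = y"
  "x \<in> carrier G \<Longrightarrow> y \<in> carrier G \<Longrightarrow> x \<otimes> (inv x \<otimes> y) = y"
  by (simp_all flip: m_assoc)

end

lemma card_set_mult_le:
  assumes "finite S" "finite T"
  shows "card (S <#>\<^bsub>G\<^esub> T) \<le> card S * card T"
proof -
  have "S <#>\<^bsub>G\<^esub> T = (\<lambda>(a, b). a \<otimes>\<^bsub>G\<^esub> b) ` (S \<times> T)"
    by (auto simp: set_mult_def)
  then show ?thesis
    using card_image_le[of "S \<times> T" "\<lambda>(a, b). a \<otimes>\<^bsub>G\<^esub> b"] assms
    by (simp add: card_cartesian_product)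
qed

lemma finite_set_mult: "finite S \<Longrightarrow> finite T \<Longrightarrow> finite (S <#>\<^bsub>G\<^esub> T)"
  by (auto simp: set_mult_def)

lemma mem_set_mult: "a \<in> S \<Longrightarrow> b \<in> T \<Longrightarrow> a \<otimes>\<^bsub>G\<^esub> b \<in> S <#>\<^bsub>G\<^esub> T"
  by (auto simp: set_mult_def)

definition occurs :: "('g, 'm) monoid_scheme \<Rightarrow> 'g set \<Rightarrow> ('g \<Rightarrow> 'b) \<Rightarrow> 'g \<Rightarrow> ('g \<Rightarrow> 'b) \<Rightarrow> bool" where
  "occurs G P e g x \<longleftrightarrow> (\<forall>t\<in>P. x (g \<otimes>\<^bsub>G\<^esub> t) = e t)"

definition put :: "('g, 'm) monoid_scheme \<Rightarrow> 'g set \<Rightarrow> ('g \<Rightarrow> 'b) \<Rightarrow> 'g \<Rightarrow> ('g \<Rightarrow> 'b) \<Rightarrow> 'g \<Rightarrow> 'b" where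
  "put G F q g x = (\<lambda>h. if h \<in> carrier G \<and> inv\<^bsub>G\<^esub> g \<otimes>\<^bsub>G\<^esub> h \<in> F then q (inv\<^bsub>G\<^esub> g \<otimes>\<^bsub>G\<^esub> h) else x h)"

text \<open>The condition \<open>inv s \<otimes> t \<notin> K\<close> is invariant under left
  translation, and \<open>K\<close> is symmetrized so that the order of \<open>s\<close> and
  \<open>t\<close> does not matter. \<open>two_values\<close> is non-triviality carried to the
  identity by a shift. Both alternatives of the theorem force \<open>G\<close> to be infinite, which
  leaves room for separated points.\<close>

locale si_space = group G for G :: "('g, 'm) monoid_scheme" (structure) +
  fixes B :: "'b set" and X :: "('g \<Rightarrow> 'b) set" and K M :: "'g set"
  assumes sub: "subshift G B X"
    and finite_K: "finite K" and K_carrier: "K \<subseteq> carrier G"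
    and one_K: "\<one> \<in> K" and inv_K: "k \<in> K \<Longrightarrow> inv k \<in> K"
    and irreducible: "\<lbrakk>finite S; S \<subseteq> carrier G; finite T; T \<subseteq> carrier G;
          \<And>s t. s \<in> S \<Longrightarrow> t \<in> T \<Longrightarrow> inv s \<otimes> t \<notin> K; x \<in> X; y \<in> X\<rbrakk>
        \<Longrightarrow> \<exists>z\<in>X. (\<forall>s\<in>S. z s = x s) \<and> (\<forall>t\<in>T. z t = y t)"
    and finite_M: "finite M" and M_carrier: "M \<subseteq> carrier G"
    and markov: "\<lbrakk>finite F; F \<subseteq> carrier G; x \<in> X; y \<in> X;
          \<And>t. t \<in> F <#> M \<Longrightarrow> t \<notin> F \<Longrightarrow> x t = y t\<rbrakk>
        \<Longrightarrow> (\<lambda>h. if h \<in> F then x h else y h) \<in> X"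
    and two_values: "\<exists>a\<in>X. \<exists>b\<in>X. a \<one> \<noteq> b \<one>"
    and infinite_G: "infinite (carrier G)"

lemma si_spaceI:
  fixes G :: "('g, 'm) monoid_scheme" (structure)
  assumes "group G" "subshift G B X" "nontrivial X" "strongly_irreducible G X" "strong_TMP G X"
    "infinite (carrier G)"
  shows "\<exists>K M. si_space G B X K M"
proof -
  interpret group G by fact
  obtain K0 where K0: "finite K0" "K0 \<subseteq> carrier G" and
    glue: "\<forall>S T. finite S \<and> S \<subseteq> carrier G \<and> finite T \<and> T \<subseteq> carrier G \<and> (S <#> K0) \<inter> T = {} \<longrightarrow>
      (\<forall>p\<in>patterns S X. \<forall>q\<in>patterns T X. \<exists>x\<in>X. restrict x S = p \<and> restrict x T = q)"
    using assms(4) unfolding strongly_irreducible_def by (elim exE conjE)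
  obtain M where M: "finite M" "M \<subseteq> carrier G" and
    tmp: "\<forall>F. finite F \<and> F \<subseteq> carrier G \<longrightarrow> (\<forall>x\<in>X. \<forall>y\<in>X.
      restrict x ((F <#> M) - F) = restrict y ((F <#> M) - F) \<longrightarrow> (\<lambda>h. if h \<in> F then x h else y h) \<in> X)"
    using assms(5) unfolding strong_TMP_def by (elim exE conjE)
  define K where "K = {\<one>} \<union> K0 \<union> (\<lambda>k. inv k) ` K0"
  have XP: "X \<subseteq> carrier G \<rightarrow>\<^sub>E B" and sh: "\<And>g x. g \<in> carrier G \<Longrightarrow> x \<in> X \<Longrightarrow> shift G g x \<in> X"
    using assms(2) by (auto simp: subshift_def full_shift_def)
  have "si_space G B X K M"
  proof
    show "subshift G B X" by fact
    show "finite K" "K \<subseteq> carrier G" "\<one> \<in> K" using K0 by (auto simp: K_def)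
    show "inv k \<in> K" if "k \<in> K" for k
      using that K0 by (auto simp: K_def subset_iff)
    show "finite M" "M \<subseteq> carrier G" by fact+
    show "infinite (carrier G)" by fact
  next
    fix S T x y assume st: "finite S" "S \<subseteq> carrier G" "finite T" "T \<subseteq> carrier G"
      "\<And>s t. s \<in> S \<Longrightarrow> t \<in> T \<Longrightarrow> inv s \<otimes> t \<notin> K" "x \<in> X" "y \<in> X"
    have "(S <#> K0) \<inter> T = {}"
    proof (rule ccontr)
      assume "(S <#> K0) \<inter> T \<noteq> {}"
      then obtain s k where sk: "s \<in> S" "k \<in> K0" "s \<otimes> k \<in> T" by (auto simp: set_mult_def)
      then have "inv s \<otimes> (s \<otimes> k) = k" using st(2) K0 by (intro inv_mult_cancel) auto
      then show False using st(5)[OF sk(1,3)] sk(2) by (auto simp: K_def)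
    qed
    moreover have "restrict x S \<in> patterns S X" "restrict y T \<in> patterns T X"
      using st(6,7) by (auto simp: patterns_def)
    ultimately have "\<exists>z\<in>X. restrict z S = restrict x S \<and> restrict z T = restrict y T"
      using st(1-4) by (intro glue[rule_format] conjI)
    then obtain z where z: "z \<in> X" "restrict z S = restrict x S" "restrict z T = restrict y T"
      by (elim bexE conjE)
    have "z s = x s" if "s \<in> S" for s using fun_cong[OF z(2), of s] that by simp
    moreover have "z t = y t" if "t \<in> T" for t using fun_cong[OF z(3), of t] that by simp
    ultimately show "\<exists>z\<in>X. (\<forall>s\<in>S. z s = x s) \<and> (\<forall>t\<in>T. z t = y t)"
      using z(1) by (intro bexI[of _ z] conjI ballI)
  next
    fix F x y assume F: "finite F" "F \<subseteq> carrier G" "x \<in> X" "y \<in> X"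
      "\<And>t. t \<in> F <#> M \<Longrightarrow> t \<notin> F \<Longrightarrow> x t = y t"
    have "restrict x ((F <#> M) - F) = restrict y ((F <#> M) - F)"
      by (rule restrict_ext) (use F(5) in blast)
    then show "(\<lambda>h. if h \<in> F then x h else y h) \<in> X"
      using F(1-4) by (intro tmp[rule_format] conjI)
  next
    obtain a b where ab: "a \<in> X" "b \<in> X" "a \<noteq> b"
      using assms(3) unfolding nontrivial_def by blast
    then obtain h where h: "h \<in> carrier G" "a h \<noteq> b h"
      using XP by (meson PiE_ext subsetD)
    have "shift G (inv h) c \<one> = c h" for c using h(1) by (simp add: shift_def)
    moreover have "shift G (inv h) a \<in> X" "shift G (inv h) b \<in> X" using sh h(1) ab by simp_all
    ultimately show "\<exists>a\<in>X. \<exists>b\<in>X. a \<one> \<noteq> b \<one>" using h(2) by metis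
  qed
  then show ?thesis by blast
qed

context si_space begin

lemma finite_B: "finite B"
  using sub by (simp add: subshift_def)

lemma X_PiE: "x \<in> X \<Longrightarrow> x \<in> carrier G \<rightarrow>\<^sub>E B"
  using sub by (auto simp: subshift_def full_shift_def)

lemma X_range: "x \<in> X \<Longrightarrow> g \<in> carrier G \<Longrightarrow> x g \<in> B"
  using X_PiE by blast

lemma shift_X: "g \<in> carrier G \<Longrightarrow> x \<in> X \<Longrightarrow> shift G g x \<in> X"
  using sub by (simp add: subshift_def)

lemma shift_apply: "h \<in> carrier G \<Longrightarrow> shift G g x h = x (inv g \<otimes> h)"
  by (simp add: shift_def)

lemma shift_mult_apply:
  "g \<in> carrier G \<Longrightarrow> h \<in> carrier G \<Longrightarrow> shift G g x (g \<otimes> h) = x h"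
  by (simp add: shift_def)

text \<open>The complement of \<open>X\<close> is open, so a configuration outside \<open>X\<close>
  is already excluded by its values on finitely many cells.\<close>

lemma X_closed:
  assumes "x \<in> carrier G \<rightarrow>\<^sub>E B"
    and "\<And>L. finite L \<Longrightarrow> L \<subseteq> carrier G \<Longrightarrow> \<exists>y\<in>X. \<forall>t\<in>L. y t = x t"
  shows "x \<in> X"
proof (rule ccontr)
  assume "x \<notin> X"
  have "openin (prodiscrete G B) (full_shift G B - X)"
    using sub by (simp add: subshift_def closedin_def topspace_prodiscrete)
  moreover have "x \<in> full_shift G B - X" using assms(1) \<open>x \<notin> X\<close> by (simp add: full_shift_def)
  ultimately have "\<exists>U. finite {i \<in> carrier G. U i \<noteq> B} \<and> (\<forall>i\<in>carrier G. openin (discrete_topology B) (U i)) \<and>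
      x \<in> Pi\<^sub>E (carrier G) U \<and> Pi\<^sub>E (carrier G) U \<subseteq> full_shift G B - X"
    unfolding prodiscrete_def openin_product_topology_alt topspace_discrete_topology by (rule bspec)
  then obtain U where U: "finite {i \<in> carrier G. U i \<noteq> B}" "x \<in> Pi\<^sub>E (carrier G) U"
      "Pi\<^sub>E (carrier G) U \<subseteq> full_shift G B - X"
    by (elim exE conjE)
  have "\<exists>y\<in>X. \<forall>t\<in>{i \<in> carrier G. U i \<noteq> B}. y t = x t"
    by (rule assms(2)[OF U(1)]) simp
  then obtain y where y: "y \<in> X" "\<forall>t\<in>{i \<in> carrier G. U i \<noteq> B}. y t = x t" by (elim bexE)
  have "y \<in> Pi\<^sub>E (carrier G) U"
  proof (rule PiE_I)
    show "y t \<in> U t" if "t \<in> carrier G" for t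
    proof (cases "U t = B")
      case True
      then show ?thesis using X_PiE[OF y(1)] that by (metis PiE_mem)
    next
      case False
      then have "y t = x t" using y(2) that by blast
      then show ?thesis using PiE_mem[OF U(2) that] by simp
    qed
    show "y t = undefined" if "t \<notin> carrier G" for t
      using X_PiE[OF y(1)] that by (rule PiE_arb)
  qed
  then show False using U(3) y(1) by blast
qed

text \<open>Separation from a union is separation from each member, so the pieces can be glued one
  after the other with the same \<open>K\<close>.\<close>

lemma multi_glue:
  assumes "finite I" "\<forall>i\<in>I. finite (S i) \<and> S i \<subseteq> carrier G \<and> y i \<in> X"
    and "\<forall>i\<in>I. \<forall>j\<in>I. i \<noteq> j \<longrightarrow> (\<forall>s\<in>S i. \<forall>t\<in>S j. inv s \<otimes> t \<notin> K)"
  shows "\<exists>z\<in>X. \<forall>i\<in>I. \<forall>t\<in>S i. z t = y i t"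
  using assms
proof (induction I rule: finite_induct)
  case empty
  then show ?case using two_values by auto
next
  case (insert i I)
  have "\<exists>z\<in>X. \<forall>i\<in>I. \<forall>t\<in>S i. z t = y i t"
    by (rule insert.IH) (use insert.prems in blast)+
  then obtain z where z: "z \<in> X" "\<forall>i\<in>I. \<forall>t\<in>S i. z t = y i t" by (elim bexE)
  have "\<exists>w\<in>X. (\<forall>t\<in>S i. w t = y i t) \<and> (\<forall>t\<in>(\<Union>j\<in>I. S j). w t = z t)"
  proof (rule irreducible)
    show "finite (S i)" "S i \<subseteq> carrier G" "y i \<in> X" using insert.prems(1) by blast+
    show "finite (\<Union>j\<in>I. S j)"
      by (rule finite_UN_I[OF insert.hyps(1)]) (use insert.prems(1) in blast)
    show "(\<Union>j\<in>I. S j) \<subseteq> carrier G"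
      by (rule UN_least) (use insert.prems(1) in blast)
    show "inv s \<otimes> t \<notin> K" if st: "s \<in> S i" "t \<in> (\<Union>j\<in>I. S j)" for s t
    proof -
      obtain j where j: "j \<in> I" "t \<in> S j" using st(2) by (elim UN_E)
      then have "i \<noteq> j" using insert.hyps by auto
      then show ?thesis using insert.prems(2) j st(1) by blast
    qed
    show "z \<in> X" by fact
  qed
  then obtain z' where z': "z' \<in> X" "\<forall>t\<in>S i. z' t = y i t" "\<forall>t\<in>(\<Union>j\<in>I. S j). z' t = z t"
    by (elim bexE conjE)
  have "z' t = y j t" if "j \<in> insert i I" "t \<in> S j" for j t
  proof (cases "j = i")
    case True
    then show ?thesis using z'(2) that by metis
  next
    case False
    then have "j \<in> I" using that by simp
    then show ?thesis using z'(3) z(2) that(2) by (metis UN_I)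
  qed
  then show ?case using z'(1) by (intro bexI[of _ z'] ballI)
qed

lemma put_apply:
  assumes "g \<in> carrier G" "h \<in> carrier G"
  shows "put G F q g x (g \<otimes> h) = (if h \<in> F then q h else x (g \<otimes> h))"
  using assms by (simp add: put_def)

text \<open>This is the Markov property for the translate of \<open>F\<close> by \<open>g\<close>
  and the configuration \<open>shift G g q\<close>.\<close>

lemma put_X:
  assumes F: "finite F" "F \<subseteq> carrier G" and g: "g \<in> carrier G" and q: "q \<in> X" and x: "x \<in> X"
    and "\<And>t. t \<in> F <#> M \<Longrightarrow> t \<notin> F \<Longrightarrow> x (g \<otimes> t) = q t"
  shows "put G F q g x \<in> X"
proof -
  let ?F = "(\<lambda>t. g \<otimes> t) ` F"
  have mem: "h \<in> ?F \<longleftrightarrow> h \<in> carrier G \<and> inv g \<otimes> h \<in> F" for h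
  proof
    assume "h \<in> ?F"
    then show "h \<in> carrier G \<and> inv g \<otimes> h \<in> F" using F(2) g by auto
  next
    assume "h \<in> carrier G \<and> inv g \<otimes> h \<in> F"
    then show "h \<in> ?F" using g by (metis imageI inv_mult_cancel(2))
  qed
  have "(\<lambda>h. if h \<in> ?F then shift G g q h else x h) \<in> X"
  proof (rule markov)
    show "finite ?F" using F by simp
    show "?F \<subseteq> carrier G" using F(2) g by auto
    show "shift G g q \<in> X" using g q by (rule shift_X)
    show "x \<in> X" by fact
    fix t assume t: "t \<in> ?F <#> M" "t \<notin> ?F"
    then obtain f m where fm: "f \<in> F" "m \<in> M" "t = g \<otimes> f \<otimes> m" by (auto simp: set_mult_def)
    have fc: "f \<in> carrier G" "m \<in> carrier G" using fm F(2) M_carrier by auto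
    have teq: "t = g \<otimes> (f \<otimes> m)" using fm(3) fc g by (simp add: m_assoc)
    have "f \<otimes> m \<notin> F" using t(2) teq by auto
    then have "x t = q (f \<otimes> m)"
      using assms(6)[of "f \<otimes> m"] mem_set_mult[OF fm(1,2)] teq by metis
    then show "shift G g q t = x t"
      using teq fc g by (simp add: shift_mult_apply)
  qed
  moreover have "(\<lambda>h. if h \<in> ?F then shift G g q h else x h) = put G F q g x"
    by (rule ext) (auto simp: put_def mem shift_def)
  ultimately show ?thesis by simp
qed

text \<open>Greedy choice: a finite set never exhausts \<open>G\<close>, and the symmetry of
  \<open>P\<close> lets one forbidden set deal with both orders of a pair.\<close>

lemma separated_points:
  fixes n :: nat
  assumes "finite Q" "finite P" "P \<subseteq> carrier G" "\<And>k. k \<in> P \<Longrightarrow> inv k \<in> P"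
  shows "\<exists>s. (\<forall>i<n. s i \<in> carrier G \<and> s i \<notin> Q) \<and>
    (\<forall>i<n. \<forall>j<n. i \<noteq> j \<longrightarrow> inv (s i) \<otimes> s j \<notin> P)"
proof (induction n)
  case 0
  then show ?case by auto
next
  case (Suc n)
  then obtain s where s: "\<And>i. i < n \<Longrightarrow> s i \<in> carrier G \<and> s i \<notin> Q"
    "\<And>i j. i < n \<Longrightarrow> j < n \<Longrightarrow> i \<noteq> j \<Longrightarrow> inv (s i) \<otimes> s j \<notin> P" by blast
  have "finite (Q \<union> (s ` {..<n} <#> P))" using assms by (simp add: finite_set_mult)
  then obtain r where r: "r \<in> carrier G" "r \<notin> Q" "r \<notin> s ` {..<n} <#> P"
    using infinite_G by (metis UnCI infinite_super subsetI)
  have 1: "inv (s i) \<otimes> r \<notin> P" if "i < n" for i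
  proof
    assume "inv (s i) \<otimes> r \<in> P"
    then have "s i \<otimes> (inv (s i) \<otimes> r) \<in> s ` {..<n} <#> P"
      by (intro mem_set_mult) (use that in auto)
    then show False using r s(1)[OF that] by simp
  qed
  have 2: "inv r \<otimes> s i \<notin> P" if "i < n" for i
    using assms(4)[of "inv r \<otimes> s i"] 1[OF that] s(1)[OF that] r(1) by (auto simp: inv_mult_group)
  show ?case
    by (rule exI[of _ "s(n := r)"]) (use s r 1 2 in \<open>auto simp: less_Suc_eq\<close>)
qed

text \<open>The index \<open>u\<close> is the set of bits that are on. The cell \<open>s i\<close>
  carries the value of \<open>a\<close> or of \<open>b\<close> at the identity, and the frame
  \<open>Z\<close> is far enough from it for gluing.\<close>

lemma bit_family:
  fixes n :: nat
  assumes s: "\<And>i. i < n \<Longrightarrow> s i \<in> carrier G"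
    "\<And>i j. i < n \<Longrightarrow> j < n \<Longrightarrow> i \<noteq> j \<Longrightarrow> inv (s i) \<otimes> s j \<notin> K"
    and Z: "finite Z" "Z \<subseteq> carrier G" "\<And>i k. i < n \<Longrightarrow> k \<in> K \<Longrightarrow> s i \<otimes> k \<notin> Z" and z: "z \<in> X"
  shows "\<exists>e. (\<forall>u. e u \<in> X \<and> (\<forall>t\<in>Z. e u t = z t)) \<and>
    (\<forall>u v. \<forall>i<n. (i \<in> u) \<noteq> (i \<in> v) \<longrightarrow> e u (s i) \<noteq> e v (s i))"
proof -
  obtain a b where ab: "a \<in> X" "b \<in> X" "a \<one> \<noteq> b \<one>" using two_values by blast
  have "\<exists>y\<in>X. (\<forall>t\<in>Z. y t = z t) \<and> (\<forall>i<n. y (s i) = (if i \<in> u then a \<one> else b \<one>))" for u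
  proof -
    \<comment> \<open>Indices below \<open>n\<close> stand for the bit cells, the index
      \<open>n\<close> for the frame.\<close>
    let ?S = "\<lambda>i. if i < n then {s i} else Z"
    let ?y = "\<lambda>i. if i < n then shift G (s i) (if i \<in> u then a else b) else z"
    have far: "inv (s i) \<otimes> q \<notin> K \<and> inv q \<otimes> s i \<notin> K" if "i < n" "q \<in> Z" for i q
    proof -
      have q: "q \<in> carrier G" using that(2) Z(2) by blast
      have "inv (s i) \<otimes> q \<notin> K"
        using Z(3)[OF that(1), of "inv (s i) \<otimes> q"] that(2) s(1)[OF that(1)] q by auto
      moreover have "inv (inv q \<otimes> s i) = inv (s i) \<otimes> q"
        using s(1)[OF that(1)] q by (simp add: inv_mult_group)
      ultimately show ?thesis using inv_K by metis
    qed
    have "\<exists>y\<in>X. \<forall>i\<in>{..n}. \<forall>t\<in>?S i. y t = ?y i t"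
    proof (rule multi_glue)
      show "finite {..n}" by simp
      have "?y i \<in> X" for i using s(1) ab z by (simp add: shift_X)
      then show "\<forall>i\<in>{..n}. finite (?S i) \<and> ?S i \<subseteq> carrier G \<and> ?y i \<in> X"
        using Z(1,2) s(1) by simp
      show "\<forall>i\<in>{..n}. \<forall>j\<in>{..n}. i \<noteq> j \<longrightarrow> (\<forall>s\<in>?S i. \<forall>t\<in>?S j. inv s \<otimes> t \<notin> K)"
        using far s(2) by auto
    qed
    then obtain y where y: "y \<in> X" "\<forall>i\<in>{..n}. \<forall>t\<in>?S i. y t = ?y i t" by (elim bexE)
    have "y (s i) = (if i \<in> u then a \<one> else b \<one>)" if "i < n" for i
    proof -
      have "y (s i) = ?y i (s i)" using bspec[OF y(2), of i] that by simp
      then show ?thesis using that s(1)[OF that] by (simp add: shift_def)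
    qed
    moreover have "y t = z t" if "t \<in> Z" for t
      using bspec[OF y(2), of n] that by simp
    ultimately show ?thesis using y(1) by blast
  qed
  then obtain e where e: "\<And>u. e u \<in> X" "\<And>u t. t \<in> Z \<Longrightarrow> e u t = z t"
    "\<And>u i. i < n \<Longrightarrow> e u (s i) = (if i \<in> u then a \<one> else b \<one>)" by metis
  show ?thesis using e ab(3) by (intro exI[of _ e]) auto
qed

end

section \<open>Removing a pattern\<close>

text \<open>For \<open>n + 1 = 2 ^ (2 * k)\<close> the left side is at most
  \<open>2 ^ (a + 2 * k * c)\<close>; this exponent is linear in \<open>k\<close>, against
  \<open>2 ^ (2 * k) - 1\<close> on the right.\<close>

lemma poly_less_exp: "\<exists>n::nat. a * (n + 1) ^ c < 2 ^ n"
proof -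
  define k where "k = a + 2 * c + 1"
  have "k * k = k * (a + 2 * c + 1)" by (simp add: k_def)
  then have "a + 2 * k * c + 1 < (k + 1) * (k + 1)"
    by (simp add: algebra_simps k_def)
  also have "\<dots> \<le> 2 ^ k * 2 ^ k"
    by (intro mult_mono) (auto simp: Suc_le_eq)
  also have "\<dots> = 2 ^ (2 * k)" by (simp add: mult_2 power_add)
  finally have m: "a + 2 * k * c < 2 ^ (2 * k) - (1::nat)" by simp
  have "a * (2 ^ (2 * k)) ^ c \<le> 2 ^ a * 2 ^ (2 * k * c)"
    by (intro mult_mono) (auto simp: power_mult less_imp_le)
  also have "\<dots> = 2 ^ (a + 2 * k * c)" by (simp add: power_add)
  also have "\<dots> < 2 ^ (2 ^ (2 * k) - 1)" using m by simp
  finally show ?thesis by (intro exI[of _ "2 ^ (2 * k) - 1"]) simp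
qed

context si_space begin

text \<open>Among \<open>2 ^ n\<close> fillings of \<open>E\<close> inside a common frame, polynomially many fillings \<open>q t t'\<close> realize every
  pair of values that some filling takes at \<open>t\<close> and \<open>t'\<close>, and these contain only polynomially many
  translates of fillings; \<open>p\<close> is a filling that none of them contains.\<close>

lemma replaceable_pattern:
  "\<exists>E E' p q. finite E' \<and> E \<noteq> {} \<and> E \<subseteq> E' \<and> E' \<subseteq> carrier G \<and> E <#> M \<subseteq> E' \<and>
    (\<forall>a\<in>E. \<forall>b\<in>E. \<forall>c\<in>E. a \<otimes> inv b \<otimes> c \<in> E') \<and> p \<in> X \<and>
    (\<forall>t\<in>E. \<forall>t'\<in>E. q t t' \<in> X \<and> (\<forall>h\<in>E' - E. q t t' h = p h) \<and>
      q t t' t = p t \<and> q t t' t' = p t' \<and> (\<forall>a\<in>E. \<forall>b\<in>E. \<not> occurs G E p (a \<otimes> inv b) (q t t')))"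
proof -
  \<comment> \<open>The bound counts the arguments of the map \<open>f\<close> below: four points of
    \<open>E\<close>, which has at most \<open>n * card K\<close> elements, and two letters of
    \<open>B\<close>.\<close>
  obtain n :: nat where n: "(card K ^ 4 * card B ^ 2 + 1) * (n + 1) ^ 4 < 2 ^ n"
    using poly_less_exp by blast
  then have n0: "0 < n" by (cases n) auto
  obtain s where s: "\<And>i. i < n \<Longrightarrow> s i \<in> carrier G"
    "\<And>i j. i < n \<Longrightarrow> j < n \<Longrightarrow> i \<noteq> j \<Longrightarrow> inv (s i) \<otimes> s j \<notin> K"
  proof -
    have "\<exists>s. (\<forall>i<n. s i \<in> carrier G \<and> s i \<notin> {}) \<and>
        (\<forall>i<n. \<forall>j<n. i \<noteq> j \<longrightarrow> inv (s i) \<otimes> s j \<notin> K)"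
      by (rule separated_points[OF finite.emptyI finite_K K_carrier]) (rule inv_K)
    then show ?thesis using that by blast
  qed
  \<comment> \<open>All cells within \<open>K\<close> of a bit are left free, so that the bits can
    be set independently of the frame \<open>E' - E\<close>.\<close>
  define E where "E = s ` {..<n} <#> K"
  have "s ` {..<n} \<subseteq> carrier G" using s(1) by auto
  then have E: "finite E" "E \<subseteq> carrier G"
    unfolding E_def using finite_K K_carrier by (auto simp: finite_set_mult intro: set_mult_closed[THEN subsetD])
  have sE: "s i \<in> E" if "i < n" for i
  proof -
    have "s i \<otimes> \<one> \<in> E" unfolding E_def using that one_K by (intro mem_set_mult) auto
    then show ?thesis using s(1)[OF that] by simp
  qed
  have E0: "E \<noteq> {}" using sE[OF n0] by blast
  have "card E \<le> card (s ` {..<n}) * card K"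
    unfolding E_def by (rule card_set_mult_le) (simp_all add: finite_K)
  also have "\<dots> \<le> n * card K"
    using card_image_le[of "{..<n}" s] by (intro mult_mono) auto
  finally have cardE: "card E \<le> n * card K" .
  \<comment> \<open>\<open>E <#> M\<close> is the layer needed to exchange fillings by the Markov
    property; the last part contains every translate of \<open>E\<close> that meets
    \<open>E\<close>.\<close>
  define E' where "E' = E \<union> (E <#> M) \<union> (E <#> (\<lambda>a. inv a) ` E <#> E)"
  have E': "finite E'" "E \<subseteq> E'" "E' \<subseteq> carrier G" "E <#> M \<subseteq> E'"
  proof -
    show "finite E'" using E finite_M by (simp add: E'_def finite_set_mult)
    have "(\<lambda>a. inv a) ` E \<subseteq> carrier G" using E(2) by auto
    then show "E' \<subseteq> carrier G" using E M_carrier unfolding E'_def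
      by (intro Un_least set_mult_closed)
  qed (auto simp: E'_def)
  have EEE: "a \<otimes> inv b \<otimes> c \<in> E'" if "a \<in> E" "b \<in> E" "c \<in> E" for a b c
    unfolding E'_def using that by (intro UnI2 mem_set_mult imageI)
  obtain z where z: "z \<in> X" using two_values by blast
  have "\<exists>e. (\<forall>u. e u \<in> X \<and> (\<forall>t\<in>E' - E. e u t = z t)) \<and>
    (\<forall>u v. \<forall>i<n. (i \<in> u) \<noteq> (i \<in> v) \<longrightarrow> e u (s i) \<noteq> e v (s i))"
  proof (rule bit_family)
    show "s i \<otimes> k \<notin> E' - E" if "i < n" "k \<in> K" for i k
      using that unfolding E_def by (auto intro: mem_set_mult)
  qed (use s E' z in auto)
  then obtain e where e: "\<And>u. e u \<in> X" and eZ: "\<And>u t. t \<in> E' - E \<Longrightarrow> e u t = z t"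
    and es: "\<And>u v i. i < n \<Longrightarrow> (i \<in> u) \<noteq> (i \<in> v) \<Longrightarrow> e u (s i) \<noteq> e v (s i)"
    by (elim exE conjE) (metis (no_types))
  have unique: "u = v" if "u \<subseteq> {..<n}" "v \<subseteq> {..<n}" "occurs G E (e u) r q" "occurs G E (e v) r q" for u v r q
  proof (rule Set.set_eqI)
    fix i
    show "i \<in> u \<longleftrightarrow> i \<in> v"
    proof (cases "i < n")
      case True
      then have "e u (s i) = e v (s i)"
        using that(3,4) sE[OF True] by (metis occurs_def)
      then show ?thesis using es[OF True] by metis
    next
      case False
      then show ?thesis using that by auto
    qed
  qed
  \<comment> \<open>The representative depends only on two cells and two values, so there are at
    most \<open>card E ^ 2 * card B ^ 2\<close> of them, although there are \<open>2 ^ n\<close>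
    fillings.\<close>
  define rep where "rep t t' b b' = e (SOME u. e u t = b \<and> e u t' = b')" for t t' b b'
  have rep: "rep t t' (e u t) (e u t') t = e u t \<and> rep t t' (e u t) (e u t') t' = e u t'" for t t' u
    unfolding rep_def by (rule someI[of "\<lambda>v. e v t = e u t \<and> e v t' = e u t'"]) simp
  define bad where "bad = {u \<in> Pow {..<n}. \<exists>t\<in>E. \<exists>t'\<in>E. \<exists>a\<in>E. \<exists>b\<in>E.
    occurs G E (e u) (a \<otimes> inv b) (rep t t' (e u t) (e u t'))}"
  define f where "f = (\<lambda>(t, t', b, b', a, c). SOME u. u \<in> Pow {..<n} \<and>
    occurs G E (e u) (a \<otimes> inv c) (rep t t' b b'))"
  have fin: "finite (E \<times> E \<times> B \<times> B \<times> E \<times> E)" using E finite_B by simp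
  \<comment> \<open>A position inside a given representative determines the filling that occurs
    there, by \<open>unique\<close>.\<close>
  have "bad \<subseteq> f ` (E \<times> E \<times> B \<times> B \<times> E \<times> E)"
  proof
    fix u assume "u \<in> bad"
    then obtain t t' a c where u: "u \<subseteq> {..<n}" "t \<in> E" "t' \<in> E" "a \<in> E" "c \<in> E"
      "occurs G E (e u) (a \<otimes> inv c) (rep t t' (e u t) (e u t'))"
      by (auto simp: bad_def)
    have "f (t, t', e u t, e u t', a, c) = u"
      unfolding f_def prod.case
    proof (rule some_equality)
      show "u \<in> Pow {..<n} \<and> occurs G E (e u) (a \<otimes> inv c) (rep t t' (e u t) (e u t'))"
        using u by simp
      show "v = u" if "v \<in> Pow {..<n} \<and> occurs G E (e v) (a \<otimes> inv c) (rep t t' (e u t) (e u t'))" for v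
        using that by (intro unique[OF _ u(1) _ u(6)]) simp_all
    qed
    moreover have "(t, t', e u t, e u t', a, c) \<in> E \<times> E \<times> B \<times> B \<times> E \<times> E"
      using u E(2) X_range[OF e] by auto
    ultimately show "u \<in> f ` (E \<times> E \<times> B \<times> B \<times> E \<times> E)" by (metis imageI)
  qed
  then have "card bad \<le> card (E \<times> E \<times> B \<times> B \<times> E \<times> E)"
    using fin by (meson card_image_le card_mono finite_imageI order_trans)
  also have "\<dots> = card E ^ 4 * card B ^ 2"
    by (simp add: card_cartesian_product power2_eq_square power4_eq_xxxx)
  also have "\<dots> \<le> ((n + 1) * card K) ^ 4 * card B ^ 2"
    using cardE by (intro mult_right_mono power_mono) auto
  also have "\<dots> = card K ^ 4 * card B ^ 2 * (n + 1) ^ 4"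
    by (simp only: power_mult_distrib mult_ac)
  also have "\<dots> \<le> (card K ^ 4 * card B ^ 2 + 1) * (n + 1) ^ 4" by (rule mult_right_mono) simp_all
  also have "\<dots> < 2 ^ n" by (rule n)
  finally have "card bad < card (Pow {..<n})" by (simp add: card_Pow)
  moreover have "finite bad" by (rule finite_subset[of _ "Pow {..<n}"]) (auto simp: bad_def)
  ultimately obtain u where u: "u \<in> Pow {..<n}" "u \<notin> bad"
    by (metis card_mono linorder_not_le subsetI)
  define p q where "p = e u" and "q = (\<lambda>t t'. rep t t' (p t) (p t'))"
  have q1: "q t t' \<in> X" for t t' unfolding q_def rep_def by (rule e)
  have q2: "q t t' h = p h" if "h \<in> E' - E" for t t' h
    unfolding q_def rep_def p_def by (rule eZ[OF that, THEN trans]) (rule eZ[OF that, symmetric])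
  have q3: "q t t' t = p t" "q t t' t' = p t'" for t t'
    unfolding q_def p_def by (rule rep[THEN conjunct1], rule rep[THEN conjunct2])
  have q4: "\<not> occurs G E p (a \<otimes> inv b) (q t t')"
    if "t \<in> E" "t' \<in> E" "a \<in> E" "b \<in> E" for a b t t'
    using u that unfolding bad_def q_def p_def by blast
  have q5: "p \<in> X" unfolding p_def by (rule e)
  have "finite E' \<and> E \<noteq> {} \<and> E \<subseteq> E' \<and> E' \<subseteq> carrier G \<and> E <#> M \<subseteq> E' \<and>
    (\<forall>a\<in>E. \<forall>b\<in>E. \<forall>c\<in>E. a \<otimes> inv b \<otimes> c \<in> E') \<and> p \<in> X \<and>
    (\<forall>t\<in>E. \<forall>t'\<in>E. q t t' \<in> X \<and> (\<forall>h\<in>E' - E. q t t' h = p h) \<and>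
      q t t' t = p t \<and> q t t' t' = p t' \<and> (\<forall>a\<in>E. \<forall>b\<in>E. \<not> occurs G E p (a \<otimes> inv b) (q t t')))"
    by (intro conjI ballI E' E0 EEE q1 q2 q3 q4 q5; assumption)
  then show ?thesis by (intro exI[of _ E] exI[of _ E'] exI[of _ p] exI[of _ q])
qed

text \<open>Overwriting an occurrence of \<open>p\<close> by \<open>q t t'\<close> keeps the cells of \<open>T\<close> and creates no new occurrence.\<close>

lemma removable_pattern:
  "\<exists>E E' p. finite E' \<and> E \<noteq> {} \<and> E \<subseteq> E' \<and> E' \<subseteq> carrier G \<and> p \<in> X \<and>
    (\<forall>x\<in>X. \<forall>R T. finite R \<and> R \<subseteq> carrier G \<and> T \<subseteq> carrier G \<and>
        (\<forall>g\<in>R. \<exists>t\<in>E. \<exists>t'\<in>E. \<forall>s\<in>E. g \<otimes> s \<in> T \<longrightarrow> s = t \<or> s = t') \<longrightarrow>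
      (\<exists>x'\<in>X. (\<forall>h\<in>T. x' h = x h) \<and> (\<forall>g\<in>R. \<not> occurs G E' p g x')))"
proof -
  obtain E E' p q where E: "finite E'" "E \<subseteq> E'" "E' \<subseteq> carrier G" "E <#> M \<subseteq> E'" and E0: "E \<noteq> {}"
    and EEE: "\<forall>a\<in>E. \<forall>b\<in>E. \<forall>c\<in>E. a \<otimes> inv b \<otimes> c \<in> E'" and p: "p \<in> X"
    and q: "\<forall>t\<in>E. \<forall>t'\<in>E. q t t' \<in> X \<and> (\<forall>h\<in>E' - E. q t t' h = p h) \<and>
      q t t' t = p t \<and> q t t' t' = p t' \<and> (\<forall>a\<in>E. \<forall>b\<in>E. \<not> occurs G E p (a \<otimes> inv b) (q t t'))"
    using replaceable_pattern by (elim exE conjE)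
  have EG: "t \<in> carrier G" if "t \<in> E'" for t using that E(3) by blast
  have "\<exists>x'\<in>X. (\<forall>h\<in>T. x' h = x h) \<and> (\<forall>g\<in>R. \<not> occurs G E' p g x')"
    if x: "x \<in> X" and R: "finite R" "R \<subseteq> carrier G" and T: "T \<subseteq> carrier G"
      "\<forall>g\<in>R. \<exists>t\<in>E. \<exists>t'\<in>E. \<forall>s\<in>E. g \<otimes> s \<in> T \<longrightarrow> s = t \<or> s = t'" for x R T
    using x
  \<comment> \<open>The measure counts occurrences on the small window \<open>E\<close>, while only
    occurrences on all of \<open>E'\<close> are overwritten, because the Markov property needs the
    frame.\<close>
  proof (induction "card {g \<in> R. occurs G E p g x}" arbitrary: x rule: less_induct)
    case less
    show ?case
    proof (cases "\<forall>g\<in>R. \<not> occurs G E' p g x")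
      case True
      then show ?thesis using less.prems by (intro bexI[of _ x]) simp_all
    next
      case False
      then obtain g where g: "g \<in> R" "occurs G E' p g x" by blast
      have gc: "g \<in> carrier G" using g R by blast
      obtain t t' where t: "t \<in> E" "t' \<in> E" "\<forall>s\<in>E. g \<otimes> s \<in> T \<longrightarrow> s = t \<or> s = t'"
        using T(2) g(1) by blast
      define r where "r = q t t'"
      have r: "r \<in> X" "\<forall>h\<in>E' - E. r h = p h" "r t = p t" "r t' = p t'"
        "\<forall>a\<in>E. \<forall>b\<in>E. \<not> occurs G E p (a \<otimes> inv b) r"
        using bspec[OF bspec[OF q t(1)] t(2)] unfolding r_def by - (elim conjE, assumption)+
      define y where "y = put G E r g x"
      have xg: "x (g \<otimes> s) = p s" if "s \<in> E'" for s using g(2) that by (simp add: occurs_def)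
      have yX: "y \<in> X" unfolding y_def
      proof (rule put_X)
        show "finite E" "E \<subseteq> carrier G" using E finite_subset by blast+
        show "x (g \<otimes> s) = r s" if "s \<in> E <#> M" "s \<notin> E" for s
        proof -
          have "s \<in> E' - E" using that E(4) by blast
          then show ?thesis using xg r(2) by simp
        qed
      qed (use gc r(1) less.prems in auto)
      have yg: "y (g \<otimes> s) = r s" if s: "s \<in> E'" for s
      proof (cases "s \<in> E")
        case True
        then show ?thesis by (simp add: y_def put_apply gc EG[OF s])
      next
        case False
        then show ?thesis using xg[OF s] r(2) s by (simp add: y_def put_apply gc EG)
      qed
      have yT: "y h = x h" if h: "h \<in> T" for h
      proof -
        have hc: "h \<in> carrier G" using h T(1) by blast
        have hg: "g \<otimes> (inv g \<otimes> h) = h" using gc hc by simp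
        show ?thesis
        proof (cases "inv g \<otimes> h \<in> E")
          case True
          then have "inv g \<otimes> h = t \<or> inv g \<otimes> h = t'" using t(3) h hg by metis
          then have "r (inv g \<otimes> h) = p (inv g \<otimes> h)" using r(3,4) by metis
          then show ?thesis using yg[of "inv g \<otimes> h"] xg[of "inv g \<otimes> h"] True E(2) hg by auto
        next
          case False
          then show ?thesis by (simp add: y_def put_def)
        qed
      qed
      have step: "occurs G E p h x \<and> h \<noteq> g" if h: "h \<in> R" "occurs G E p h y" for h
      proof -
        have hc: "h \<in> carrier G" using h R by blast
        \<comment> \<open>If the window at \<open>h\<close> met the one at \<open>g\<close>, it
          would lie inside \<open>g E'\<close>, where \<open>y\<close> is a copy of
          \<open>r\<close>; but \<open>p\<close> does not occur in \<open>r\<close> at such a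
          place.\<close>
        have no: False if ab: "a \<in> E" "b \<in> E" "h \<otimes> a = g \<otimes> b" for a b
        proof -
          have c: "a \<in> carrier G" "b \<in> carrier G" using ab E EG by blast+
          have "occurs G E p (b \<otimes> inv a) r"
            unfolding occurs_def
          proof
            fix c assume cE: "c \<in> E"
            then have cc: "c \<in> carrier G" using E EG by blast
            have "h = g \<otimes> b \<otimes> inv a" using ab(3) c gc hc by (metis inv_closed inv_solve_right m_closed)
            then have "h \<otimes> c = g \<otimes> (b \<otimes> inv a \<otimes> c)" using c gc cc by (simp add: m_assoc)
            then show "r (b \<otimes> inv a \<otimes> c) = p c"
              using yg[OF EEE[rule_format, OF ab(2,1) cE]] bspec[OF h(2)[unfolded occurs_def] cE] by metis
          qed
          then show False using r(5) ab by blast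
        qed
        have "y (h \<otimes> s) = x (h \<otimes> s)" if "s \<in> E" for s
        proof -
          have sc: "s \<in> carrier G" using that E EG by blast
          have "inv g \<otimes> (h \<otimes> s) \<notin> E"
            using no[OF that, of "inv g \<otimes> (h \<otimes> s)"] sc hc gc by auto
          then show ?thesis by (simp add: y_def put_def)
        qed
        then have "occurs G E p h x" using h(2) by (simp add: occurs_def)
        moreover have "h \<noteq> g" using no[OF t(1) t(1)] by blast
        ultimately show ?thesis by blast
      qed
      have "g \<in> {g \<in> R. occurs G E p g x}" using g E(2) by (auto simp: occurs_def)
      then have "{h \<in> R. occurs G E p h y} \<subset> {g \<in> R. occurs G E p g x}" using step by blast
      then have "card {h \<in> R. occurs G E p h y} < card {g \<in> R. occurs G E p g x}"
        using R(1) by (intro psubset_card_mono) auto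
      from less.hyps[OF this yX]
      obtain x' where "x' \<in> X" "\<forall>h\<in>T. x' h = y h" "\<forall>g\<in>R. \<not> occurs G E' p g x'"
        by (elim bexE conjE)
      then show ?thesis using yT by (intro bexI[of _ x']) simp_all
    qed
  qed
  then show ?thesis using E E0 p
    by (intro exI[of _ E] exI[of _ E'] exI[of _ p] conjI ballI allI impI) (simp_all)
qed

end

section \<open>The pointwise stabilizer\<close>

definition iv :: "('g, 'm) monoid_scheme \<Rightarrow> 'g set \<Rightarrow> 'g set" where
  "iv G S = (\<lambda>a. inv\<^bsub>G\<^esub> a) ` S"

lemma finite_iv: "finite S \<Longrightarrow> finite (iv G S)"
  by (simp add: iv_def)

lemma card_iv_le: "finite S \<Longrightarrow> card (iv G S) \<le> card S"
  by (simp add: iv_def card_image_le)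

lemma inv_mem_iv: "a \<in> S \<Longrightarrow> inv\<^bsub>G\<^esub> a \<in> iv G S"
  by (simp add: iv_def)

lemma (in group) iv_closed: "S \<subseteq> carrier G \<Longrightarrow> iv G S \<subseteq> carrier G"
  by (auto simp: iv_def)

context si_space begin

text \<open>The kernel of the shift action on \<open>X\<close>. It is normal by
  \<open>kern_conj\<close> and finite by \<open>finite_kern\<close>.\<close>

definition kern :: "'g set" where
  "kern = {d \<in> carrier G. \<forall>x\<in>X. \<forall>h\<in>carrier G. x (d \<otimes> h) = x h}"

lemma kern_carrier: "d \<in> kern \<Longrightarrow> d \<in> carrier G"
  by (simp add: kern_def)

lemma kern_fix: "d \<in> kern \<Longrightarrow> x \<in> X \<Longrightarrow> h \<in> carrier G \<Longrightarrow> x (d \<otimes> h) = x h"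
  by (simp add: kern_def)

lemma one_kern: "\<one> \<in> kern"
  by (simp add: kern_def)

lemma kern_mult:
  assumes "c \<in> kern" "d \<in> kern"
  shows "c \<otimes> d \<in> kern"
proof -
  have "x (c \<otimes> d \<otimes> h) = x h" if "x \<in> X" "h \<in> carrier G" for x h
  proof -
    have "x (c \<otimes> d \<otimes> h) = x (c \<otimes> (d \<otimes> h))" using assms that by (simp add: m_assoc kern_carrier)
    also have "\<dots> = x (d \<otimes> h)" using assms that by (intro kern_fix) (auto simp: kern_carrier)
    also have "\<dots> = x h" using assms that by (intro kern_fix)
    finally show ?thesis .
  qed
  then show ?thesis using assms unfolding kern_def by blast
qed

lemma kern_inv:
  assumes "d \<in> kern"
  shows "inv d \<in> kern"
proof -
  have "x (inv d \<otimes> h) = x h" if "x \<in> X" "h \<in> carrier G" for x h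
  proof -
    have "x (d \<otimes> (inv d \<otimes> h)) = x (inv d \<otimes> h)"
      using assms that by (intro kern_fix) (auto simp: kern_carrier)
    then show ?thesis using assms that by (simp add: kern_carrier)
  qed
  then show ?thesis using assms unfolding kern_def by blast
qed

lemma kern_conj:
  assumes "d \<in> kern" "g \<in> carrier G"
  shows "inv g \<otimes> d \<otimes> g \<in> kern"
proof -
  have d: "d \<in> carrier G" using assms by (simp add: kern_carrier)
  have "x (inv g \<otimes> d \<otimes> g \<otimes> h) = x h" if x: "x \<in> X" and h: "h \<in> carrier G" for x h
  proof -
    have gh: "g \<otimes> h \<in> carrier G" using assms h by simp
    have "x (inv g \<otimes> d \<otimes> g \<otimes> h) = shift G g x (d \<otimes> (g \<otimes> h))"
      using assms d h by (simp add: shift_apply m_assoc)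
    also have "\<dots> = shift G g x (g \<otimes> h)"
      by (rule kern_fix[OF assms(1) shift_X[OF assms(2) x] gh])
    also have "\<dots> = x h" using assms h by (simp add: shift_apply)
    finally show ?thesis .
  qed
  then show ?thesis using assms d unfolding kern_def by blast
qed

lemma kern_conj': "d \<in> kern \<Longrightarrow> g \<in> carrier G \<Longrightarrow> g \<otimes> d \<otimes> inv g \<in> kern"
  using kern_conj[of d "inv g"] by simp

lemma two_values_apart:
  assumes "s \<in> carrier G" "t \<in> carrier G" "inv s \<otimes> t \<notin> K"
  shows "\<exists>x\<in>X. x s \<noteq> x t"
proof -
  obtain a b where ab: "a \<in> X" "b \<in> X" "a \<one> \<noteq> b \<one>" using two_values by (elim bexE)
  have "\<exists>z\<in>X. (\<forall>r\<in>{s}. z r = shift G s a r) \<and> (\<forall>r\<in>{t}. z r = shift G t b r)"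
    by (rule irreducible) (use assms ab in \<open>auto intro: shift_X\<close>)
  then obtain z where "z \<in> X" "z s = shift G s a s" "z t = shift G t b t" by auto
  then show ?thesis using ab(3) assms by (intro bexI[of _ z]) (auto simp: shift_apply)
qed

text \<open>Two cells that are \<open>K\<close>-apart can be given different values, so an element
  outside \<open>K\<close> acts non-trivially.\<close>

lemma kern_subset_K: "kern \<subseteq> K"
proof
  fix d assume d: "d \<in> kern"
  have "x d = x \<one>" if "x \<in> X" for x
    using kern_fix[OF d that one_closed] d by (simp add: kern_carrier)
  then show "d \<in> K" using two_values_apart[of \<one> d] kern_carrier[OF d] by (metis inv_one l_one one_closed)
qed

lemma finite_kern: "finite kern"
  using kern_subset_K finite_K by (rule finite_subset)

text \<open>Moving is invariant under left translation by the centralizer of \<open>d\<close>; if only finitely many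
  points were moved then the conjugates of \<open>d\<close> would lie in the finite set \<open>K\<close> up to finitely many
  exceptions, and the centralizer would be infinite.\<close>

lemma infinite_moved:
  assumes d: "d \<in> carrier G" "d \<notin> kern"
  shows "infinite {t \<in> carrier G. \<exists>x\<in>X. x t \<noteq> x (inv d \<otimes> t)}" (is "infinite ?S")
proof
  assume fin: "finite ?S"
  obtain x h where xh: "x \<in> X" "h \<in> carrier G" "x (d \<otimes> h) \<noteq> x h"
    using d by (auto simp: kern_def)
  define t0 where "t0 = d \<otimes> h"
  have t0: "t0 \<in> carrier G" "x t0 \<noteq> x (inv d \<otimes> t0)" using xh d by (auto simp: t0_def)
  let ?f = "\<lambda>t. inv t \<otimes> (inv d \<otimes> t)"
  have "?f ` (carrier G - ?S) \<subseteq> K"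
    using two_values_apart d by (auto simp: subset_iff)
  then have "finite (?f ` (carrier G - ?S))" using finite_K by (rule finite_subset)
  moreover have "infinite (carrier G - ?S)" using infinite_G fin by (rule Diff_infinite_finite[rotated])
  ultimately obtain t1 where t1: "t1 \<in> carrier G - ?S"
    "infinite {t \<in> carrier G - ?S. ?f t = ?f t1}"
    using pigeonhole_infinite[of "carrier G - ?S" ?f] by blast
  \<comment> \<open>For \<open>t\<close> in the infinite class of \<open>t1\<close>, the element
    \<open>t \<otimes> inv t1\<close> centralizes \<open>d\<close>, so it carries the moved cell
    \<open>t0\<close> to another moved cell \<open>?m t\<close>.\<close>
  let ?m = "\<lambda>t. t \<otimes> (inv t1 \<otimes> t0)"
  have t1c: "t1 \<in> carrier G" using t1 by blast
  have "?m t \<in> ?S" if t: "t \<in> carrier G" "?f t = ?f t1" for t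
  proof -
    define u where "u = t \<otimes> inv t1"
    have u: "u \<in> carrier G" using t t1c by (simp add: u_def)
    have "inv u \<otimes> (inv d \<otimes> u) = t1 \<otimes> (?f t \<otimes> inv t1)"
      using t(1) t1c d by (simp add: u_def inv_mult_group m_assoc)
    also have "\<dots> = t1 \<otimes> (?f t1 \<otimes> inv t1)" by (simp only: t(2))
    also have "\<dots> = inv d" using t1c d by (simp add: m_assoc)
    finally have "inv u \<otimes> (inv d \<otimes> (u \<otimes> t0)) = inv d \<otimes> t0"
      using u d t0 by (metis inv_closed m_assoc m_closed)
    then have "shift G u x (u \<otimes> t0) \<noteq> shift G u x (inv d \<otimes> (u \<otimes> t0))"
      using u t0 d by (simp add: shift_apply)
    moreover have "?m t = u \<otimes> t0" using t t1c t0 by (simp add: u_def m_assoc)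
    moreover have "shift G u x \<in> X" using u xh by (simp add: shift_X)
    ultimately show ?thesis using u t0 by auto
  qed
  then have "?m ` {t \<in> carrier G - ?S. ?f t = ?f t1} \<subseteq> ?S" by auto
  moreover have "inj_on ?m {t \<in> carrier G - ?S. ?f t = ?f t1}"
    by (rule inj_onI) (use t1c t0 in auto)
  ultimately have "infinite ?S" using t1(2) by (metis (no_types, lifting) finite_imageD infinite_super)
  then show False using fin by contradiction
qed

section \<open>Eggs\<close>

definition pre :: "'s set \<Rightarrow> ('s \<Rightarrow> 'g \<Rightarrow> 'b) \<Rightarrow> 'g set \<Rightarrow> ('g \<Rightarrow> 'b) \<Rightarrow> 'g set" where
  "pre St e Win x = {g \<in> carrier G. \<exists>s\<in>St. occurs G Win (e s) g x}"

text \<open>No other occurrence of an egg is near a good one, whatever state is written into it. Points that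
  differ by an element of \<^term>\<open>kern\<close> carry the same egg, as \<^term>\<open>kern\<close> acts trivially on \<open>X\<close>.\<close>

definition nbhd :: "'g set \<Rightarrow> 'g set \<Rightarrow> 'g set" where
  "nbhd F Win = F <#> iv G Win <#> (Win <#> iv G F)"

definition good :: "'s set \<Rightarrow> ('s \<Rightarrow> 'g \<Rightarrow> 'b) \<Rightarrow> 'g set \<Rightarrow> 'g set \<Rightarrow> ('g \<Rightarrow> 'b) \<Rightarrow> 'g set" where
  "good St e F Win x = {g \<in> pre St e Win x. \<forall>s\<in>St. \<forall>h\<in>pre St e Win (put G F (e s) g x).
     inv g \<otimes> h \<in> nbhd F Win \<longrightarrow> inv g \<otimes> h \<in> kern}"

end

text \<open>An egg is an occurrence of one of the patterns \<open>e s\<close> on \<open>Win\<close>; its state \<open>s\<close> is visible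
  only on the yolk \<open>F\<close> and may be changed freely.\<close>

locale eggs = si_space G B X K M
  for G :: "('g, 'm) monoid_scheme" (structure) and B :: "'b set" and X K M +
  fixes St :: "'s set" and e :: "'s \<Rightarrow> 'g \<Rightarrow> 'b" and F Win D :: "'g set"
  assumes finite_Win: "finite Win" and F_Win: "F \<subseteq> Win" and Win_carrier: "Win \<subseteq> carrier G"
    and kern_F: "d \<in> kern \<Longrightarrow> t \<in> F \<Longrightarrow> d \<otimes> t \<in> F"
    and e_X: "s \<in> St \<Longrightarrow> e s \<in> X"
    and e_off: "\<lbrakk>s \<in> St; s' \<in> St; t \<in> Win; t \<notin> F\<rbrakk> \<Longrightarrow> e s t = e s' t"
    and e_neq: "\<lbrakk>s \<in> St; s' \<in> St; s \<noteq> s'\<rbrakk> \<Longrightarrow> \<exists>t\<in>F. e s t \<noteq> e s' t"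
    and e_put: "\<lbrakk>x \<in> X; g \<in> carrier G; s \<in> St; s' \<in> St; occurs G Win (e s) g x\<rbrakk>
        \<Longrightarrow> put G F (e s') g x \<in> X"
    and place_eggs: "\<lbrakk>finite V; V \<subseteq> carrier G; \<forall>v\<in>V. \<forall>w\<in>V. v \<noteq> w \<longrightarrow> inv v \<otimes> w \<notin> D; \<forall>v\<in>V. \<sigma> v \<in> St\<rbrakk>
        \<Longrightarrow> \<exists>x\<in>X. \<forall>v\<in>V. occurs G Win (e (\<sigma> v)) v x \<and> v \<in> good St e F Win x"

context si_space begin

text \<open>Greedy choice in the infinite sets \<open>Y d\<close>. No separation is asked inside a
  pair: its two cells will be filled from one and the same configuration.\<close>

lemma separated_pairs:
  assumes J: "finite J" "J \<subseteq> carrier G" and Q: "finite Q" "Q \<subseteq> carrier G"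
    and L: "finite L" "L \<subseteq> carrier G" "\<And>k. k \<in> L \<Longrightarrow> inv k \<in> L"
    and Y: "\<And>d. d \<in> J \<Longrightarrow> infinite (Y d) \<and> Y d \<subseteq> carrier G"
  shows "\<exists>\<tau>. \<forall>d\<in>J. \<tau> d \<in> Y d \<and> (\<forall>a\<in>{\<tau> d, inv d \<otimes> \<tau> d}. (\<forall>b\<in>Q. inv b \<otimes> a \<notin> L) \<and>
    (\<forall>d'\<in>J. d' \<noteq> d \<longrightarrow> (\<forall>b\<in>{\<tau> d', inv d' \<otimes> \<tau> d'}. inv b \<otimes> a \<notin> L)))"
  using J Y
proof (induction J rule: finite_induct)
  case empty
  then show ?case by auto
next
  case (insert d J)
  have dc: "d \<in> carrier G" and Jc: "J \<subseteq> carrier G" using insert.prems by auto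
  obtain \<tau> where \<tau>: "\<forall>d\<in>J. \<tau> d \<in> Y d \<and> (\<forall>a\<in>{\<tau> d, inv d \<otimes> \<tau> d}. (\<forall>b\<in>Q. inv b \<otimes> a \<notin> L) \<and>
    (\<forall>d'\<in>J. d' \<noteq> d \<longrightarrow> (\<forall>b\<in>{\<tau> d', inv d' \<otimes> \<tau> d'}. inv b \<otimes> a \<notin> L)))"
    using insert.IH Jc insert.prems(2) by blast
  have \<tau>c: "\<tau> c \<in> carrier G" if "c \<in> J" for c using \<tau> insert.prems(2)[of c] that by blast
  define Q' where "Q' = Q \<union> \<tau> ` J \<union> (\<lambda>c. inv c \<otimes> \<tau> c) ` J"
  have Q': "finite Q'" "Q' \<subseteq> carrier G" using Q insert.hyps(1) \<tau>c Jc by (auto simp: Q'_def)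
  have "finite ((Q' <#> L) \<union> ({d} <#> (Q' <#> L)))"
    using Q'(1) L(1) by (intro finite_UnI finite_set_mult) simp_all
  moreover have Yd: "infinite (Y d)" "Y d \<subseteq> carrier G" using insert.prems(2)[of d] by auto
  \<comment> \<open>The two excluded sets keep \<open>r\<close> and
    \<open>inv d \<otimes> r\<close>, respectively, out of \<open>Q' <#> L\<close>.\<close>
  ultimately have "Y d - ((Q' <#> L) \<union> ({d} <#> (Q' <#> L))) \<noteq> {}"
    by (metis Diff_infinite_finite finite.emptyI)
  then obtain r where r: "r \<in> Y d" "r \<notin> Q' <#> L" "r \<notin> {d} <#> (Q' <#> L)" by blast
  have rc: "r \<in> carrier G" using r(1) Yd(2) by blast
  have far: "inv b \<otimes> a \<notin> L \<and> inv a \<otimes> b \<notin> L" if b: "b \<in> Q'" and a: "a \<in> {r, inv d \<otimes> r}" for a b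
  proof -
    have ac: "a \<in> carrier G" using a rc dc by auto
    have bc: "b \<in> carrier G" using b Q' by blast
    have 1: "inv b \<otimes> a \<notin> L"
    proof
      assume "inv b \<otimes> a \<in> L"
      from mem_set_mult[OF b this, of G] have aQ: "a \<in> Q' <#> L" using bc ac by simp
      then have "a \<noteq> r" using r by blast
      then have ar: "a = inv d \<otimes> r" using a by blast
      have "d \<otimes> a \<in> {d} <#> (Q' <#> L)" using aQ by (intro mem_set_mult) simp_all
      then show False using r(3) ar rc dc by simp
    qed
    have "inv (inv a \<otimes> b) = inv b \<otimes> a" using ac bc by (simp add: inv_mult_group)
    then show ?thesis using 1 L(3) by metis
  qed
  have dJ: "d \<notin> J" by fact
  have far1: "inv b \<otimes> a \<notin> L" if "a \<in> {r, inv d \<otimes> r}" "b \<in> Q" for a b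
    by (rule far[THEN conjunct1, OF _ that(1)]) (use that in \<open>simp add: Q'_def\<close>)
  have far2: "inv b \<otimes> a \<notin> L \<and> inv a \<otimes> b \<notin> L"
    if "a \<in> {r, inv d \<otimes> r}" "d' \<in> J" "b \<in> {\<tau> d', inv d' \<otimes> \<tau> d'}" for a b d'
    by (rule far[OF _ that(1)]) (use that in \<open>auto simp: Q'_def\<close>)
  show ?case
  proof (rule exI[of _ "\<tau>(d := r)"], rule ballI)
    fix c assume c: "c \<in> insert d J"
    show "(\<tau>(d := r)) c \<in> Y c \<and> (\<forall>a\<in>{(\<tau>(d := r)) c, inv c \<otimes> (\<tau>(d := r)) c}. (\<forall>b\<in>Q. inv b \<otimes> a \<notin> L) \<and>
      (\<forall>d'\<in>insert d J. d' \<noteq> c \<longrightarrow> (\<forall>b\<in>{(\<tau>(d := r)) d', inv d' \<otimes> (\<tau>(d := r)) d'}. inv b \<otimes> a \<notin> L)))"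
    proof (cases "c = d")
      case True
      have "\<forall>d'\<in>insert d J. d' \<noteq> d \<longrightarrow> (\<forall>b\<in>{(\<tau>(d := r)) d', inv d' \<otimes> (\<tau>(d := r)) d'}. inv b \<otimes> a \<notin> L)"
        if "a \<in> {r, inv d \<otimes> r}" for a
      proof (intro ballI impI)
        fix d' b assume "d' \<in> insert d J" "d' \<noteq> d" "b \<in> {(\<tau>(d := r)) d', inv d' \<otimes> (\<tau>(d := r)) d'}"
        then show "inv b \<otimes> a \<notin> L" using far2[OF that, of d' b] by simp
      qed
      then show ?thesis unfolding True using r(1) far1 by simp
    next
      case False
      then have cJ: "c \<in> J" using c by simp
      have "\<forall>d'\<in>insert d J. d' \<noteq> c \<longrightarrow> (\<forall>b\<in>{(\<tau>(d := r)) d', inv d' \<otimes> (\<tau>(d := r)) d'}. inv b \<otimes> a \<notin> L)"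
        if a: "a \<in> {\<tau> c, inv c \<otimes> \<tau> c}" for a
      proof (intro ballI impI)
        fix d' b assume d': "d' \<in> insert d J" "d' \<noteq> c" and b: "b \<in> {(\<tau>(d := r)) d', inv d' \<otimes> (\<tau>(d := r)) d'}"
        show "inv b \<otimes> a \<notin> L"
        proof (cases "d' = d")
          case True
          then have "b \<in> {r, inv d \<otimes> r}" using b by simp
          then show ?thesis using far2[OF _ cJ a] by blast
        next
          case False
          then have "d' \<in> J" "b \<in> {\<tau> d', inv d' \<otimes> \<tau> d'}" using d' b by simp_all
          then show ?thesis using \<tau> cJ a d'(2) by blast
        qed
      qed
      then show ?thesis using \<tau> cJ False by auto
    qed
  qed
qed

end

lemma card_set_mult_bound:
  assumes "finite S" "finite T" "card S \<le> a" "card T \<le> b"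
  shows "card (S <#>\<^bsub>G\<^esub> T) \<le> a * b"
  using card_set_mult_le[OF assms(1,2), of G] mult_le_mono[OF assms(3,4)] by (rule order_trans)

lemma card_iv_bound: "finite S \<Longrightarrow> card S \<le> a \<Longrightarrow> card (iv G S) \<le> a"
  using card_iv_le order_trans by blast

context si_space begin

text \<open>The pattern \<open>p\<close> on \<open>E'\<close> marks an egg and can be removed everywhere else; the pairs
  \<open>\<tau> d\<close>, \<open>inv d \<otimes> \<tau> d\<close> carry different values, which excludes an egg displaced by \<open>d\<close>. The separation \<open>D\<close> is
  fixed before the set \<open>St\<close>, since the states will contain displacements whose range depends on \<open>D\<close>.\<close>

lemma eggs_exist:
  "\<exists>c m. \<forall>n::nat. \<exists>F Win D. finite D \<and> D \<subseteq> carrier G \<and> card D \<le> c * (n + 1) ^ m \<and>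
    (\<forall>St::'s set. finite St \<longrightarrow> card St \<le> 2 ^ n \<longrightarrow> (\<exists>e. eggs G B X K M St e F Win D))"
proof -
  obtain E E' p where E: "finite E'" "E \<noteq> {}" "E \<subseteq> E'" "E' \<subseteq> carrier G" and p: "p \<in> X" and
    remove: "\<forall>x\<in>X. \<forall>R T. finite R \<and> R \<subseteq> carrier G \<and> T \<subseteq> carrier G \<and>
        (\<forall>g\<in>R. \<exists>t\<in>E. \<exists>t'\<in>E. \<forall>s\<in>E. g \<otimes> s \<in> T \<longrightarrow> s = t \<or> s = t') \<longrightarrow>
      (\<exists>x'\<in>X. (\<forall>h\<in>T. x' h = x h) \<and> (\<forall>g\<in>R. \<not> occurs G E' p g x'))"
    using removable_pattern by (elim exE conjE)
  have Ec: "E \<subseteq> carrier G" and finE: "finite E" using E finite_subset by blast+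
  \<comment> \<open>Cells that are \<open>L\<close>-apart can be glued independently, and no
    translate of \<open>E\<close> contains both of them.\<close>
  define L where "L = K \<union> (iv G E <#> E)"
  have L: "finite L" "L \<subseteq> carrier G" "\<one> \<in> L" "K \<subseteq> L"
  proof -
    have "iv G E <#> E \<subseteq> carrier G" using iv_closed[OF Ec] Ec by (rule set_mult_closed)
    then show "L \<subseteq> carrier G" using K_carrier by (simp add: L_def)
    show "finite L" unfolding L_def by (intro finite_UnI finite_set_mult finite_iv finite_K finE)
  qed (simp_all add: L_def one_K)
  have EL: "inv a \<otimes> b \<in> L" if "a \<in> E" "b \<in> E" for a b
    unfolding L_def using that by (intro UnI2 mem_set_mult inv_mem_iv)
  have L_inv: "inv k \<in> L" if "k \<in> L" for k
    using that unfolding L_def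
  proof
    assume "k \<in> iv G E <#> E"
    then obtain a b where ab: "a \<in> E" "b \<in> E" "k = inv a \<otimes> b" by (auto simp: set_mult_def iv_def)
    then have "inv k = inv b \<otimes> a" using Ec by (simp add: inv_mult_group subset_iff)
    then show "inv k \<in> K \<union> (iv G E <#> E)" using EL[OF ab(2,1)] by (simp add: L_def)
  qed (simp add: inv_K)
  \<comment> \<open>With \<open>m = n + 1\<close>, the constants \<open>CF\<close>,
    \<open>C0\<close>, \<open>CD\<close>, \<open>CW\<close> bound \<open>F\<close>,
    \<open>Win0\<close>, \<open>\<Delta>\<close>, \<open>Win\<close> by multiples of
    \<open>m\<close>. The exponent 5 below comes from the product of \<open>nbhd F Win\<close>,
    which has four such factors, with \<open>iv G \<Delta>\<close>.\<close>
  define CF where "CF = card kern * card K"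
  define C0 where "C0 = card E' + CF + CF * card M"
  define CD where "CD = C0 * card E'"
  define CW where "CW = C0 + 2 * CD"
  define c where "c = CW * card L * CW + CF * CW * CW * CF * CD"
  have "\<exists>F Win D. finite D \<and> D \<subseteq> carrier G \<and> card D \<le> c * (n + 1) ^ 5 \<and>
    (\<forall>St::'s set. finite St \<longrightarrow> card St \<le> 2 ^ n \<longrightarrow> (\<exists>e. eggs G B X K M St e F Win D))" for n :: nat
  proof -
    have finQ: "finite (kern <#> (E' <#> K))"
      using finite_kern E(1) finite_K by (intro finite_set_mult)
    \<comment> \<open>Avoiding this set makes the yolk disjoint from the marker window
      \<open>E'\<close> (\<open>FE'\<close>), so the marker looks the same in every state.\<close>
    have "\<exists>s. (\<forall>i<n. s i \<in> carrier G \<and> s i \<notin> kern <#> (E' <#> K)) \<and>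
        (\<forall>i<n. \<forall>j<n. i \<noteq> j \<longrightarrow> inv (s i) \<otimes> s j \<notin> K)"
      by (rule separated_points[OF finQ finite_K K_carrier]) (rule inv_K)
    then obtain s where s: "\<And>i. i < n \<Longrightarrow> s i \<in> carrier G"
        "\<And>i. i < n \<Longrightarrow> s i \<notin> kern <#> (E' <#> K)"
        "\<And>i j. i < n \<Longrightarrow> j < n \<Longrightarrow> i \<noteq> j \<Longrightarrow> inv (s i) \<otimes> s j \<notin> K" by blast
    \<comment> \<open>Saturation under \<open>kern\<close> makes \<open>g\<close> and
      \<open>g \<otimes> d\<close> with \<open>d \<in> kern\<close> have the same yolk
      cells.\<close>
    define F where "F = kern <#> (s ` {..<n} <#> K)"
    have kern_sub: "kern \<subseteq> carrier G" using kern_carrier by blast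
    have F: "finite F" "F \<subseteq> carrier G"
    proof -
      show "finite F" unfolding F_def using finite_kern finite_K by (intro finite_set_mult) simp_all
      have "s ` {..<n} \<subseteq> carrier G" using s(1) by auto
      then show "F \<subseteq> carrier G" unfolding F_def using kern_sub K_carrier by (intro set_mult_closed)
    qed
    have kern_F: "d \<otimes> t \<in> F" if dt: "d \<in> kern" "t \<in> F" for d t
    proof -
      obtain d' r where dr: "d' \<in> kern" "r \<in> s ` {..<n} <#> K" "t = d' \<otimes> r"
        using dt(2) unfolding F_def set_mult_def by blast
      have "s ` {..<n} \<subseteq> carrier G" using s(1) by auto
      then have rc: "r \<in> carrier G" using dr(2) K_carrier by (meson set_mult_closed subsetD)
      have "d \<otimes> t = d \<otimes> d' \<otimes> r" using dr that rc by (simp add: m_assoc kern_carrier)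
      then show ?thesis
        unfolding F_def using mem_set_mult[OF kern_mult[OF that(1) dr(1)] dr(2), of G] by simp
    qed
    have sKF: "s i \<otimes> k \<in> F" if "i < n" "k \<in> K" for i k
    proof -
      have "\<one> \<otimes> (s i \<otimes> k) \<in> F"
        unfolding F_def using that by (intro mem_set_mult one_kern) auto
      then show ?thesis using s(1)[OF that(1)] that(2) K_carrier by (simp add: subset_iff)
    qed
    have sF: "s i \<in> F" if "i < n" for i
      using sKF[OF that one_K] s(1)[OF that] by simp
    have FE': "t \<notin> F" if tE: "t \<in> E'" for t
    proof
      assume "t \<in> F"
      then obtain d i k where t: "d \<in> kern" "i < n" "k \<in> K" "t = d \<otimes> (s i \<otimes> k)"
        unfolding F_def set_mult_def by blast
      have cc: "d \<in> carrier G" "s i \<in> carrier G" "k \<in> carrier G"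
        using t s(1) K_carrier by (auto simp: kern_carrier)
      have "inv d \<otimes> (t \<otimes> inv k) \<in> kern <#> (E' <#> K)"
        using tE t by (intro mem_set_mult kern_inv inv_K)
      moreover have "inv d \<otimes> (t \<otimes> inv k) = s i" using cc t(4) by (simp add: m_assoc)
      ultimately show False using s(2)[OF t(2)] by simp
    qed
    define Win0 where "Win0 = E' \<union> F \<union> (F <#> M)"
    have W0: "finite Win0" "Win0 \<subseteq> carrier G"
      using E F finite_M M_carrier set_mult_closed[OF F(2) M_carrier]
      by (auto simp: Win0_def finite_set_mult)
    \<comment> \<open>These are the displacements for which a displaced marker window meets
      \<open>Win0\<close>. The marker is not erased there; for those outside \<open>kern\<close>,
      collected in \<open>J\<close>, a pair of cells does the work.\<close>
    define \<Delta> where "\<Delta> = Win0 <#> iv G E'"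
    have \<Delta>: "finite \<Delta>" "\<Delta> \<subseteq> carrier G"
      unfolding \<Delta>_def using W0 E iv_closed[OF E(4)] by (simp_all add: finite_set_mult finite_iv set_mult_closed)
    define J where "J = \<Delta> - kern"
    have J: "finite J" "J \<subseteq> carrier G" using \<Delta> by (auto simp: J_def)
    define Y where "Y d = {t \<in> carrier G. \<exists>x\<in>X. x t \<noteq> x (inv d \<otimes> t)}" for d
    have "\<exists>\<tau>. \<forall>d\<in>J. \<tau> d \<in> Y d \<and> (\<forall>a\<in>{\<tau> d, inv d \<otimes> \<tau> d}. (\<forall>b\<in>Win0. inv b \<otimes> a \<notin> L) \<and>
      (\<forall>d'\<in>J. d' \<noteq> d \<longrightarrow> (\<forall>b\<in>{\<tau> d', inv d' \<otimes> \<tau> d'}. inv b \<otimes> a \<notin> L)))"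
    proof (rule separated_pairs[OF J W0 L(1,2)])
      show "infinite (Y d) \<and> Y d \<subseteq> carrier G" if "d \<in> J" for d
        using infinite_moved[of d] that J(2) by (auto simp: Y_def J_def)
    qed (rule L_inv)
    then obtain \<tau> where \<tau>': "\<forall>d\<in>J. \<tau> d \<in> Y d \<and> (\<forall>a\<in>{\<tau> d, inv d \<otimes> \<tau> d}. (\<forall>b\<in>Win0. inv b \<otimes> a \<notin> L) \<and>
      (\<forall>d'\<in>J. d' \<noteq> d \<longrightarrow> (\<forall>b\<in>{\<tau> d', inv d' \<otimes> \<tau> d'}. inv b \<otimes> a \<notin> L)))"
      by (elim exE)
    have \<tau>: "\<tau> d \<in> Y d" if "d \<in> J" for d using \<tau>' that by blast
    have far0: "inv b \<otimes> a \<notin> L" if "d \<in> J" "a \<in> {\<tau> d, inv d \<otimes> \<tau> d}" "b \<in> Win0" for d a b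
      using \<tau>' that by blast
    have far1: "inv b \<otimes> a \<notin> L" if "d \<in> J" "a \<in> {\<tau> d, inv d \<otimes> \<tau> d}" "d' \<in> J" "d' \<noteq> d"
        "b \<in> {\<tau> d', inv d' \<otimes> \<tau> d'}" for d a d' b
      using \<tau>' that by blast
    have \<tau>c: "\<tau> d \<in> carrier G" if "d \<in> J" for d using \<tau>[OF that] by (simp add: Y_def)
    define P where "P d = {\<tau> d, inv d \<otimes> \<tau> d}" for d
    have P: "finite (P d)" "P d \<subseteq> carrier G" if "d \<in> J" for d
      using that \<tau>c J(2) by (auto simp: P_def)
    have PW0: "a \<notin> Win0" if "d \<in> J" "a \<in> P d" for d a
    proof
      assume "a \<in> Win0"
      then have "inv a \<otimes> a \<notin> L" using far0[OF that(1)] that(2) by (auto simp: P_def)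
      then show False using L(3) P(2)[OF that(1)] that(2) by auto
    qed
    define y where "y d = (SOME x. x \<in> X \<and> x (\<tau> d) \<noteq> x (inv d \<otimes> \<tau> d))" for d
    have y: "y d \<in> X \<and> y d (\<tau> d) \<noteq> y d (inv d \<otimes> \<tau> d)" if "d \<in> J" for d
    proof -
      have "\<exists>x. x \<in> X \<and> x (\<tau> d) \<noteq> x (inv d \<otimes> \<tau> d)"
        using \<tau>[OF that] by (simp add: Y_def Bex_def)
      then show ?thesis unfolding y_def by (rule someI_ex)
    qed
    have oneJ: "\<one> \<notin> J" using one_kern by (simp add: J_def)
    \<comment> \<open>Since \<open>\<one>\<close> lies in \<open>kern\<close> and hence not in
      \<open>J\<close>, it is free to serve as the index of the marker.\<close>
    let ?S = "\<lambda>i. if i = \<one> then E' else P i"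
    let ?y = "\<lambda>i. if i = \<one> then p else y i"
    have farE: "inv b \<otimes> a \<notin> K \<and> inv a \<otimes> b \<notin> K" if "d \<in> J" "a \<in> P d" "b \<in> E'" for d a b
    proof -
      have "inv b \<otimes> a \<notin> L" using far0[OF that(1)] that(2,3) by (auto simp: P_def Win0_def)
      moreover have "inv (inv a \<otimes> b) = inv b \<otimes> a"
        using P(2)[OF that(1)] that(2,3) E(4) by (simp add: inv_mult_group subset_iff)
      ultimately show ?thesis using L_inv L(4) by (metis subsetD)
    qed
    have "\<exists>z\<in>X. \<forall>i\<in>insert \<one> J. \<forall>t\<in>?S i. z t = ?y i t"
    proof (rule multi_glue)
      show "finite (insert \<one> J)" using J by simp
      show "\<forall>i\<in>insert \<one> J. finite (?S i) \<and> ?S i \<subseteq> carrier G \<and> ?y i \<in> X"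
        using E p P y by auto
      show "\<forall>i\<in>insert \<one> J. \<forall>j\<in>insert \<one> J. i \<noteq> j \<longrightarrow> (\<forall>s\<in>?S i. \<forall>t\<in>?S j. inv s \<otimes> t \<notin> K)"
      proof (intro ballI impI)
        fix i j a b assume ij: "i \<in> insert \<one> J" "j \<in> insert \<one> J" "i \<noteq> j" "a \<in> ?S i" "b \<in> ?S j"
        show "inv a \<otimes> b \<notin> K"
        proof (cases "i = \<one> \<or> j = \<one>")
          case True
          then show ?thesis using ij farE by (auto split: if_splits)
        next
          case False
          then have "i \<in> J" "j \<in> J" "a \<in> P i" "b \<in> P j" using ij by auto
          then have "inv a \<otimes> b \<notin> L" using far1[of j b i a] ij(3) by (auto simp: P_def)
          then show ?thesis using L(4) by blast
        qed
      qed
    qed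
    then obtain z where z: "z \<in> X" and z': "\<forall>i\<in>insert \<one> J. \<forall>t\<in>?S i. z t = ?y i t" by (elim bexE)
    have zE': "z t = p t" if "t \<in> E'" for t using z' that by auto
    have z\<tau>: "z (\<tau> d) \<noteq> z (inv d \<otimes> \<tau> d)" if "d \<in> J" for d
    proof -
      have "d \<noteq> \<one>" using that oneJ by blast
      then have "\<forall>t\<in>P d. z t = y d t" using bspec[OF z', of d] that by simp
      then show ?thesis using y[OF that] by (simp add: P_def)
    qed
    define Win where "Win = Win0 \<union> (\<Union>d\<in>J. P d)"
    have W: "finite Win" "Win \<subseteq> carrier G" "F \<subseteq> Win" "E' \<subseteq> Win" "F <#> M \<subseteq> Win"
      using W0 J P by (auto simp: Win_def Win0_def)
    have nb: "finite (nbhd F Win)" "nbhd F Win \<subseteq> carrier G"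
      unfolding nbhd_def using F W iv_closed[OF F(2)] iv_closed[OF W(2)]
      by (simp_all add: finite_set_mult finite_iv set_mult_closed)
    \<comment> \<open>The first part makes the windows of different eggs \<open>L\<close>-apart; the
      second prevents a position near one egg from lying within \<open>\<Delta>\<close> of
      another.\<close>
    define D where "D = (Win <#> L <#> iv G Win) \<union> (nbhd F Win <#> iv G \<Delta>)"
    have D: "finite D" "D \<subseteq> carrier G"
      unfolding D_def using W L nb \<Delta> iv_closed[OF \<Delta>(2)] iv_closed[OF W(2)]
      by (simp_all add: finite_set_mult finite_iv set_mult_closed)
    have "card D \<le> c * (n + 1) ^ 5"
    proof -
      define m where "m = n + 1"
      have fin: "finite (s ` {..<n})" "card (s ` {..<n}) \<le> m"
        using card_image_le[of "{..<n}" s] by (simp_all add: m_def)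
      have "card F \<le> card kern * (m * card K)"
        unfolding F_def by (intro card_set_mult_bound finite_set_mult fin finite_kern finite_K order_refl)
      then have cF: "card F \<le> CF * m" by (simp add: CF_def mult_ac)
      have "card (F <#> M) \<le> CF * m * card M"
        by (intro card_set_mult_bound F finite_M cF order_refl)
      then have "card E' + card F + card (F <#> M) \<le> card E' * m + CF * m + CF * m * card M"
        using cF by (intro add_mono) (simp_all add: m_def)
      moreover have "card Win0 \<le> card E' + card F + card (F <#> M)"
        unfolding Win0_def using card_Un_le[of "E' \<union> F" "F <#> M"] card_Un_le[of E' F] by simp
      ultimately have cW0: "card Win0 \<le> C0 * m" by (simp add: C0_def algebra_simps)
      have "card \<Delta> \<le> C0 * m * card E'"
        unfolding \<Delta>_def by (intro card_set_mult_bound card_iv_bound finite_iv W0 E cW0 order_refl)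
      then have cD: "card \<Delta> \<le> CD * m" by (simp add: CD_def mult_ac)
      have "card (P d) \<le> 2" for d
        unfolding P_def by (metis card_2_iff card.insert_remove card_insert_le_m1 finite.emptyI finite.insertI
            insert_absorb2 is_singletonI is_singleton_altdef one_le_numeral order_refl)
      then have "card (\<Union>d\<in>J. P d) \<le> card J * 2"
        by (intro order_trans[OF card_UN_le[OF J(1)]] order_trans[OF sum_bounded_above[of J _ 2]]) simp_all
      also have "\<dots> \<le> CD * m * 2"
        using card_mono[OF \<Delta>(1), of J] cD by (intro mult_right_mono) (auto simp: J_def)
      finally have "card Win \<le> C0 * m + CD * m * 2"
        unfolding Win_def using card_Un_le[of Win0 "\<Union>d\<in>J. P d"] cW0 by simp
      then have cW: "card Win \<le> CW * m" by (simp add: CW_def algebra_simps)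
      have cnb: "card (nbhd F Win) \<le> CF * m * (CW * m) * (CW * m * (CF * m))"
        unfolding nbhd_def
        by (intro card_set_mult_bound card_iv_bound finite_set_mult finite_iv F W cF cW)
      have "card D \<le> card (Win <#> L <#> iv G Win) + card (nbhd F Win <#> iv G \<Delta>)"
        unfolding D_def by (rule card_Un_le)
      also have "\<dots> \<le> CW * m * card L * (CW * m) + CF * m * (CW * m) * (CW * m * (CF * m)) * (CD * m)"
        by (intro add_mono card_set_mult_bound card_iv_bound finite_set_mult finite_iv F W L nb \<Delta> cF cW cD cnb order_refl)
      also have "\<dots> = CW * card L * CW * m ^ 2 + CF * CW * CW * CF * CD * m ^ 5"
        by (simp add: power2_eq_square power_def mult_ac numeral_eq_Suc)
      also have "\<dots> \<le> CW * card L * CW * m ^ 5 + CF * CW * CW * CF * CD * m ^ 5"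
        by (intro add_right_mono mult_left_mono power_increasing) (simp_all add: m_def)
      also have "\<dots> = c * m ^ 5" by (simp add: c_def algebra_simps)
      finally show ?thesis by (simp add: m_def)
    qed
    moreover have "\<exists>e. eggs G B X K M St e F Win D" if St: "finite St" "card St \<le> 2 ^ n" for St :: "'s set"
    proof -
      have "\<exists>e. (\<forall>u. e u \<in> X \<and> (\<forall>t\<in>Win - F. e u t = z t)) \<and>
        (\<forall>u v. \<forall>i<n. (i \<in> u) \<noteq> (i \<in> v) \<longrightarrow> e u (s i) \<noteq> e v (s i))"
      proof (rule bit_family)
        show "s i \<otimes> k \<notin> Win - F" if "i < n" "k \<in> K" for i k using sKF[OF that] by blast
      qed (use s W z in auto)
      then obtain f where f: "\<forall>u. f u \<in> X \<and> (\<forall>t\<in>Win - F. f u t = z t)"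
        "\<forall>u v. \<forall>i<n. (i \<in> u) \<noteq> (i \<in> v) \<longrightarrow> f u (s i) \<noteq> f v (s i)" by (elim exE conjE)
      have "\<exists>enc. enc ` St \<subseteq> Pow {..<n} \<and> inj_on enc St"
        by (rule card_le_inj) (use St in \<open>simp_all add: card_Pow\<close>)
      then obtain enc where enc: "enc ` St \<subseteq> Pow {..<n}" "inj_on enc St" by blast
      define e where "e r = f (enc r)" for r
      have eX: "e r \<in> X" for r unfolding e_def using f(1) by (rule allE) (erule conjunct1)
      have ez: "e r t = z t" if "t \<in> Win" "t \<notin> F" for r t
        unfolding e_def using f(1) that by blast
      have "eggs G B X K M St e F Win D"
      proof unfold_locales
        show "finite Win" "F \<subseteq> Win" "Win \<subseteq> carrier G" by (fact W)+
        show "d \<otimes> t \<in> F" if "d \<in> kern" "t \<in> F" for d t using that by (rule kern_F)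
        show "e r \<in> X" for r by (rule eX)
        show "e r t = e r' t" if "t \<in> Win" "t \<notin> F" for r r' t
          using ez[OF that, of r] ez[OF that, of r'] by (rule trans_sym)
        show "\<exists>t\<in>F. e r t \<noteq> e r' t" if r: "r \<in> St" "r' \<in> St" "r \<noteq> r'" for r r'
        proof -
          have "enc r \<noteq> enc r'" using enc(2) r by (auto dest: inj_onD)
          moreover have "enc r \<subseteq> {..<n}" "enc r' \<subseteq> {..<n}" using enc(1) r by auto
          ultimately obtain i where "i < n" "(i \<in> enc r) \<noteq> (i \<in> enc r')" by blast
          then show ?thesis using f(2) sF unfolding e_def by blast
        qed
        show "put G F (e r') g x \<in> X"
          if x: "x \<in> X" and g: "g \<in> carrier G" and occ: "occurs G Win (e r) g x" for x g r r'
        proof (rule put_X[OF F g eX x])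
          fix t assume t: "t \<in> F <#> M" "t \<notin> F"
          then have tW: "t \<in> Win" using W(5) by blast
          have "x (g \<otimes> t) = e r t" using occ tW unfolding occurs_def by blast
          then show "x (g \<otimes> t) = e r' t" using ez[OF tW t(2)] by metis
        qed
      next
        fix V \<sigma>
        assume V: "finite V" "V \<subseteq> carrier G" "\<forall>v\<in>V. \<forall>w\<in>V. v \<noteq> w \<longrightarrow> inv v \<otimes> w \<notin> D"
          and \<sigma>: "\<forall>v\<in>V. \<sigma> v \<in> St"
        show "\<exists>x\<in>X. \<forall>v\<in>V. occurs G Win (e (\<sigma> v)) v x \<and> v \<in> good St e F Win x"
        proof -
          have Vc: "v \<in> carrier G" if "v \<in> V" for v using that V(2) by blast
          have Wc: "a \<in> carrier G" if "a \<in> Win" for a using that W(2) by blast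
          have sepL: "v = w" if vw: "v \<in> V" "w \<in> V" "a \<in> Win" "b \<in> Win" "inv (v \<otimes> a) \<otimes> (w \<otimes> b) \<in> L" for v w a b
          proof (rule ccontr)
            assume "v \<noteq> w"
            then have "inv v \<otimes> w \<notin> D" using V(3) vw by blast
            moreover have "a \<otimes> (inv (v \<otimes> a) \<otimes> (w \<otimes> b)) \<otimes> inv b \<in> Win <#> L <#> iv G Win"
              using vw by (intro mem_set_mult inv_mem_iv)
            moreover have "a \<otimes> (inv (v \<otimes> a) \<otimes> (w \<otimes> b)) \<otimes> inv b = inv v \<otimes> w"
              using vw Vc Wc by (simp add: inv_mult_group m_assoc)
            ultimately show False by (simp add: D_def)
          qed
          have "\<exists>x\<in>X. \<forall>v\<in>V. \<forall>t\<in>(\<lambda>a. v \<otimes> a) ` Win. x t = shift G v (e (\<sigma> v)) t"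
          proof (rule multi_glue)
            show "\<forall>v\<in>V. finite ((\<lambda>a. v \<otimes> a) ` Win) \<and> (\<lambda>a. v \<otimes> a) ` Win \<subseteq> carrier G \<and> shift G v (e (\<sigma> v)) \<in> X"
              using W(1) Vc Wc shift_X[OF Vc eX] by auto
            show "\<forall>v\<in>V. \<forall>w\<in>V. v \<noteq> w \<longrightarrow> (\<forall>s\<in>(\<lambda>a. v \<otimes> a) ` Win. \<forall>t\<in>(\<lambda>a. w \<otimes> a) ` Win. inv s \<otimes> t \<notin> K)"
              using sepL L(4) by blast
          qed fact
          then obtain x0 where x0: "x0 \<in> X" "\<forall>v\<in>V. \<forall>t\<in>(\<lambda>a. v \<otimes> a) ` Win. x0 t = shift G v (e (\<sigma> v)) t"
            by (elim bexE)
          have x0v: "x0 (v \<otimes> t) = e (\<sigma> v) t" if "v \<in> V" "t \<in> Win" for v t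
          proof -
            have "x0 (v \<otimes> t) = shift G v (e (\<sigma> v)) (v \<otimes> t)" using x0(2) that by blast
            then show ?thesis using that Vc Wc by (simp add: shift_mult_apply)
          qed
          \<comment> \<open>These are the positions near an egg at which the marker is erased, while
            the union \<open>T\<close> of the egg windows is kept.\<close>
          define R where "R = {h \<in> V <#> nbhd F Win. \<forall>v\<in>V. inv v \<otimes> h \<notin> \<Delta>}"
          define T where "T = V <#> Win"
          have R: "finite R" "R \<subseteq> carrier G"
            using finite_set_mult[OF V(1) nb(1), of G] set_mult_closed[OF V(2) nb(2)] by (auto simp: R_def)
          have Tc: "T \<subseteq> carrier G" unfolding T_def using V(2) W(2) by (rule set_mult_closed)
          \<comment> \<open>Outside \<open>\<Delta>\<close> a translate of \<open>E\<close> misses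
            every base window \<open>Win0\<close>, and by \<open>L\<close>-separation it meets at
            most one pair \<open>P d\<close> of one egg. This is why
            \<open>removable_pattern\<close> has to spare two cells.\<close>
          have two: "\<exists>t\<in>E. \<exists>t'\<in>E. \<forall>s\<in>E. h \<otimes> s \<in> T \<longrightarrow> s = t \<or> s = t'" if h: "h \<in> R" for h
          proof (cases "\<exists>s\<in>E. h \<otimes> s \<in> T")
            case False
            then show ?thesis using E(2) by blast
          next
            case True
            have hc: "h \<in> carrier G" using h R by blast
            have white: "\<exists>v\<in>V. \<exists>d\<in>J. \<exists>a\<in>P d. h \<otimes> s = v \<otimes> a" if s: "s \<in> E" "h \<otimes> s \<in> T" for s
            proof -
              obtain v a where va: "v \<in> V" "a \<in> Win" "h \<otimes> s = v \<otimes> a"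
                using s(2) unfolding T_def set_mult_def by blast
              have "a \<notin> Win0"
              proof
                assume "a \<in> Win0"
                then have "a \<otimes> inv s \<in> \<Delta>"
                  unfolding \<Delta>_def using s(1) E(3) by (intro mem_set_mult inv_mem_iv) auto
                moreover have "h = v \<otimes> a \<otimes> inv s"
                  using va s(1) Ec hc Vc Wc by (metis inv_closed inv_solve_right m_closed subsetD)
                then have "inv v \<otimes> h = a \<otimes> inv s" using va s(1) Ec Vc Wc by (simp add: m_assoc subset_iff)
                moreover have "inv v \<otimes> h \<notin> \<Delta>" using h va(1) by (simp add: R_def)
                ultimately show False by simp
              qed
              then show ?thesis using va by (auto simp: Win_def)
            qed
            from True obtain s0 where s0: "s0 \<in> E" "h \<otimes> s0 \<in> T" by blast
            obtain v d a where va: "v \<in> V" "d \<in> J" "a \<in> P d" "h \<otimes> s0 = v \<otimes> a" using white[OF s0] by blast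
            have dc: "d \<in> carrier G" "\<tau> d \<in> carrier G" using va J \<tau>c by auto
            define r where "r = inv h \<otimes> (v \<otimes> \<tau> d)"
            define r' where "r' = inv h \<otimes> (v \<otimes> (inv d \<otimes> \<tau> d))"
            have "s = r \<or> s = r'" if s: "s \<in> E" "h \<otimes> s \<in> T" for s
            proof -
              have sc: "s \<in> carrier G" "s0 \<in> carrier G" using s s0 Ec by auto
              obtain w d' b where wb: "w \<in> V" "d' \<in> J" "b \<in> P d'" "h \<otimes> s = w \<otimes> b" using white[OF s] by blast
              have "inv (h \<otimes> s0) \<otimes> (h \<otimes> s) = inv s0 \<otimes> s"
                using sc hc by (simp add: inv_mult_group m_assoc)
              then have inL: "inv (v \<otimes> a) \<otimes> (w \<otimes> b) \<in> L" using EL[OF s0(1) s(1)] va(4) wb(4) by simp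
              have ab: "a \<in> Win" "b \<in> Win" using va wb by (auto simp: Win_def)
              have "v = w" using sepL[OF va(1) wb(1) ab inL] .
              then have "inv a \<otimes> b \<in> L"
                using inL va(1) ab Vc Wc by (simp add: inv_mult_group m_assoc)
              then have "d' = d" using far1[of d' b d a] va wb by (auto simp: P_def)
              then have "b = \<tau> d \<or> b = inv d \<otimes> \<tau> d" using wb(3) by (simp add: P_def)
              moreover have "s = inv h \<otimes> (w \<otimes> b)" using wb(4)[symmetric] hc sc by simp
              ultimately show ?thesis using \<open>v = w\<close> by (auto simp: r_def r'_def)
            qed
            then show ?thesis using s0(1) by metis
          qed
          have "\<exists>x\<in>X. (\<forall>h\<in>T. x h = x0 h) \<and> (\<forall>g\<in>R. \<not> occurs G E' p g x)"
            using R Tc two by (intro remove[rule_format, OF x0(1)] conjI ballI)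
          then obtain x where x: "x \<in> X" "\<forall>h\<in>T. x h = x0 h" "\<forall>g\<in>R. \<not> occurs G E' p g x"
            by (elim bexE conjE)
          have xv: "x (v \<otimes> t) = e (\<sigma> v) t" if "v \<in> V" "t \<in> Win" for v t
            using bspec[OF x(2), of "v \<otimes> t"] mem_set_mult[OF that, of G] x0v[OF that] by (simp add: T_def)
          have "occurs G Win (e (\<sigma> v)) v x \<and> v \<in> good St e F Win x" if v: "v \<in> V" for v
          proof
            show occ: "occurs G Win (e (\<sigma> v)) v x" using xv[OF v] by (simp add: occurs_def)
            have vc: "v \<in> carrier G" using v Vc by blast
            have "inv v \<otimes> h \<in> kern"
              if r: "r \<in> St" and h: "h \<in> pre St e Win (put G F (e r) v x)" "inv v \<otimes> h \<in> nbhd F Win" for r h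
            proof -
              define x1 where "x1 = put G F (e r) v x"
              obtain r' where r': "occurs G Win (e r') h x1" and hc: "h \<in> carrier G"
                using h(1) by (auto simp: pre_def x1_def)
              have x1z: "x1 (h \<otimes> t) = z t" if "t \<in> Win" "t \<notin> F" for t
                using r' that(1) ez[OF that, of r'] unfolding occurs_def by (metis (no_types))
              have x1v: "x1 (v \<otimes> t) = z t" if "t \<in> Win" "t \<notin> F" for t
                using xv[OF v that(1)] ez[OF that] that vc Wc by (simp add: x1_def put_apply)
              have "v \<otimes> (inv v \<otimes> h) \<in> V <#> nbhd F Win" by (intro mem_set_mult v h(2))
              then have hV: "h \<in> V <#> nbhd F Win" using vc hc by simp
              \<comment> \<open>Otherwise the marker has been erased at \<open>h\<close>, in a cell
                that the yolk of \<open>v\<close> does not reach, so writing a state at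
                \<open>v\<close> cannot restore it.\<close>
              have "\<exists>w\<in>V. inv w \<otimes> h \<in> \<Delta>"
              proof (rule ccontr)
                assume no: "\<not> ?thesis"
                then have "h \<in> R" using hV by (simp add: R_def)
                then have "\<not> occurs G E' p h x" using x(3) by blast
                then obtain t where t: "t \<in> E'" "x (h \<otimes> t) \<noteq> p t" unfolding occurs_def by blast
                have tc: "t \<in> carrier G" using t E by blast
                have "inv v \<otimes> (h \<otimes> t) \<notin> F"
                proof
                  assume "inv v \<otimes> (h \<otimes> t) \<in> F"
                  then have "inv v \<otimes> (h \<otimes> t) \<otimes> inv t \<in> \<Delta>"
                    unfolding \<Delta>_def by (intro mem_set_mult inv_mem_iv t) (simp add: Win0_def)
                  then show False using no v vc hc tc by (auto simp: m_assoc)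
                qed
                then have "x1 (h \<otimes> t) = x (h \<otimes> t)" by (simp add: x1_def put_def)
                moreover have "x1 (h \<otimes> t) = z t" using x1z t(1) W(4) FE' by blast
                ultimately show False using t(2) zE'[OF t(1)] by simp
              qed
              then obtain w where w: "w \<in> V" "inv w \<otimes> h \<in> \<Delta>" by (elim bexE)
              have "w = v"
              proof (rule ccontr)
                assume "w \<noteq> v"
                then have "inv v \<otimes> w \<notin> D" using V(3)[rule_format, OF v w(1)] by metis
                moreover have "inv v \<otimes> h \<otimes> inv (inv w \<otimes> h) \<in> nbhd F Win <#> iv G \<Delta>"
                  by (intro mem_set_mult inv_mem_iv h(2) w(2))
                moreover have "inv v \<otimes> h \<otimes> inv (inv w \<otimes> h) = inv v \<otimes> w"
                  using vc hc Vc[OF w(1)] by (simp add: inv_mult_group m_assoc)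
                ultimately show False by (simp add: D_def)
              qed
              show ?thesis
              proof (rule ccontr)
                define d where "d = inv v \<otimes> h"
                assume "inv v \<otimes> h \<notin> kern"
                then have d: "d \<in> J" using w \<open>w = v\<close> by (simp add: J_def d_def)
                have dc: "d \<in> carrier G" "\<tau> d \<in> carrier G" using d J \<tau>c by auto
                have PW: "a \<in> Win \<and> a \<notin> F" if "a \<in> P d" for a
                  using PW0[OF d that] that d by (auto simp: Win_def Win0_def)
                \<comment> \<open>One cell is \<open>\<tau> d\<close> seen from \<open>v\<close> and
                  \<open>inv d \<otimes> \<tau> d\<close> seen from \<open>h\<close>; the common
                  pattern \<open>z\<close> prescribes different values for it.\<close>
                have "h \<otimes> (inv d \<otimes> \<tau> d) = v \<otimes> \<tau> d"
                  using vc hc dc by (simp add: d_def inv_mult_group m_assoc)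
                then have "z (\<tau> d) = z (inv d \<otimes> \<tau> d)"
                  using x1v[of "\<tau> d"] x1z[of "inv d \<otimes> \<tau> d"] PW by (simp add: P_def)
                then show False using z\<tau>[OF d] by simp
              qed
            qed
            then show "v \<in> good St e F Win x"
              using occ vc \<sigma> v unfolding good_def pre_def by blast
          qed
          then show ?thesis using x(1) by blast
        qed
      qed
      then show ?thesis by blast
    qed
    ultimately show ?thesis using D by blast
  qed
  then show ?thesis by blast
qed

end

section \<open>Changing the states of eggs\<close>

context eggs begin

abbreviation "Pre \<equiv> pre St e Win"
abbreviation "Good \<equiv> good St e F Win"
abbreviation "NB \<equiv> nbhd F Win"

lemma finite_F: "finite F" and F_carrier: "F \<subseteq> carrier G"
  using finite_subset[OF F_Win finite_Win] F_Win Win_carrier by auto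

lemma Win_mem: "t \<in> Win \<Longrightarrow> t \<in> carrier G"
  using Win_carrier by blast

lemma F_mem: "t \<in> F \<Longrightarrow> t \<in> carrier G"
  using F_carrier by blast

lemma kern_F_iff:
  assumes "d \<in> kern" "t \<in> carrier G"
  shows "d \<otimes> t \<in> F \<longleftrightarrow> t \<in> F"
proof
  assume "d \<otimes> t \<in> F"
  then have "inv d \<otimes> (d \<otimes> t) \<in> F" by (rule kern_F[OF kern_inv[OF assms(1)]])
  then show "t \<in> F" unfolding inv_mult_cancel(1)[OF kern_carrier[OF assms(1)] assms(2)] .
qed (use assms kern_F in blast)

text \<open>\<open>F <#> iv G Win\<close> consists of the displacements from an egg to the windows
  that its yolk can meet.\<close>

lemma FWin_NB: "F <#> iv G Win \<subseteq> NB"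
proof
  fix k assume "k \<in> F <#> iv G Win"
  then obtain a b where ab: "a \<in> F" "b \<in> Win" "k = a \<otimes> inv b" by (auto simp: set_mult_def iv_def)
  have "a \<otimes> inv b \<otimes> (a \<otimes> inv a) \<in> NB"
    unfolding nbhd_def using ab F_Win by (intro mem_set_mult inv_mem_iv) auto
  then show "k \<in> NB" using ab F_mem Win_mem by simp
qed

text \<open>If the yolks at \<open>g\<close> and at \<open>h\<close> both meet the window at
  \<open>k\<close>, then \<open>h\<close> is near \<open>g\<close>. The shape of \<open>nbhd\<close>
  is made for this.\<close>

lemma FWin_inv_FWin_NB:
  assumes "g \<in> carrier G" "h \<in> carrier G" "k \<in> carrier G"
    and "inv g \<otimes> k \<in> F <#> iv G Win" "inv h \<otimes> k \<in> F <#> iv G Win"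
  shows "inv g \<otimes> h \<in> NB"
proof -
  obtain a b where ab: "a \<in> F" "b \<in> Win" "inv g \<otimes> k = a \<otimes> inv b"
    using assms(4) by (auto simp: set_mult_def iv_def)
  obtain c d where cd: "c \<in> F" "d \<in> Win" "inv h \<otimes> k = c \<otimes> inv d"
    using assms(5) by (auto simp: set_mult_def iv_def)
  have "inv g \<otimes> h = inv g \<otimes> k \<otimes> inv (inv h \<otimes> k)"
    using assms(1-3) by (simp add: inv_mult_group m_assoc)
  also have "\<dots> = a \<otimes> inv b \<otimes> (d \<otimes> inv c)"
    unfolding ab(3) cd(3) using ab cd F_mem Win_mem by (simp add: inv_mult_group m_assoc)
  also have "\<dots> \<in> NB"
    unfolding nbhd_def using ab cd by (intro mem_set_mult inv_mem_iv)
  finally show ?thesis .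
qed

lemma overlap_NB:
  assumes "g \<in> carrier G" "g' \<in> carrier G" "h \<in> carrier G" "inv g \<otimes> h \<in> F" "inv g' \<otimes> h \<in> F"
  shows "inv g \<otimes> g' \<in> NB"
proof -
  have "inv g \<otimes> h \<otimes> inv (inv g' \<otimes> h) \<in> F <#> iv G Win"
    using assms F_Win by (intro mem_set_mult inv_mem_iv) auto
  moreover have "inv g \<otimes> h \<otimes> inv (inv g' \<otimes> h) = inv g \<otimes> g'"
    using assms by (simp add: inv_mult_group m_assoc)
  ultimately show ?thesis using FWin_NB by auto
qed

text \<open>Right multiplication by \<open>d\<close> at \<open>g\<close> is left multiplication by a
  conjugate of \<open>d\<close>, and \<open>kern\<close> is normal.\<close>

lemma occurs_kern:
  assumes "x \<in> X" "d \<in> kern" "g \<in> carrier G" "occurs G Win q g x"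
  shows "occurs G Win q (g \<otimes> d) x"
  unfolding occurs_def
proof
  fix t assume t: "t \<in> Win"
  have c: "d \<in> carrier G" "t \<in> carrier G" using assms t Win_mem by (auto simp: kern_carrier)
  have "x (g \<otimes> d \<otimes> t) = x (g \<otimes> d \<otimes> inv g \<otimes> (g \<otimes> t))"
    using c assms(3) by (simp add: m_assoc)
  also have "\<dots> = x (g \<otimes> t)"
    using c assms by (intro kern_fix kern_conj') simp_all
  also have "\<dots> = q t" using assms(4) t by (simp add: occurs_def)
  finally show "x (g \<otimes> d \<otimes> t) = q t" .
qed

lemma occurs_put_far:
  assumes "g \<in> carrier G" "h \<in> carrier G" "inv g \<otimes> h \<notin> F <#> iv G Win"
  shows "occurs G Win p h (put G F q g x) \<longleftrightarrow> occurs G Win p h x"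
proof -
  have "put G F q g x (h \<otimes> t) = x (h \<otimes> t)" if t: "t \<in> Win" for t
  proof -
    have tc: "t \<in> carrier G" using t Win_mem by blast
    have "inv g \<otimes> (h \<otimes> t) \<notin> F"
    proof
      assume "inv g \<otimes> (h \<otimes> t) \<in> F"
      then have "inv g \<otimes> (h \<otimes> t) \<otimes> inv t \<in> F <#> iv G Win" using t by (intro mem_set_mult inv_mem_iv)
      then show False using assms tc by (simp add: m_assoc)
    qed
    then show ?thesis by (simp add: put_def)
  qed
  then show ?thesis by (simp add: occurs_def)
qed

lemma pre_put_far:
  assumes "g \<in> carrier G" "h \<in> carrier G" "inv g \<otimes> h \<notin> F <#> iv G Win"
  shows "h \<in> Pre (put G F q g x) \<longleftrightarrow> h \<in> Pre x"
  using occurs_put_far[OF assms, of _ q x] by (simp add: pre_def)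

lemma put_put: "put G F q g (put G F q' g x) = put G F q g x"
  by (rule ext) (simp add: put_def)

lemma put_same:
  assumes "g \<in> carrier G" "occurs G Win q g x"
  shows "put G F q g x = x"
proof
  fix h
  show "put G F q g x h = x h"
  proof (cases "h \<in> carrier G \<and> inv g \<otimes> h \<in> F")
    case True
    then have "x (g \<otimes> (inv g \<otimes> h)) = q (inv g \<otimes> h)" using assms(2) F_Win by (auto simp: occurs_def)
    then show ?thesis using True assms(1) by (simp add: put_def)
  qed (auto simp: put_def)
qed

lemma put_commute:
  assumes "g \<in> carrier G" "h \<in> carrier G" "inv g \<otimes> h \<notin> NB"
  shows "put G F q g (put G F r h x) = put G F r h (put G F q g x)"
  using overlap_NB[OF assms(1,2)] assms(3) by (intro ext) (auto simp: put_def)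

lemma put_kern:
  assumes "g \<in> carrier G" "d \<in> kern" "q \<in> X"
  shows "put G F q (g \<otimes> d) x = put G F q g x"
proof
  fix h
  have "q (inv d \<otimes> y) = q y \<and> (inv d \<otimes> y \<in> F \<longleftrightarrow> y \<in> F)" if "y \<in> carrier G" for y
    using kern_fix[OF kern_inv[OF assms(2)] assms(3) that] kern_F_iff[OF kern_inv[OF assms(2)] that] by simp
  note 1 = this[of "inv g \<otimes> h"]
  have 2: "inv (g \<otimes> d) \<otimes> h = inv d \<otimes> (inv g \<otimes> h)" if "h \<in> carrier G"
    using that assms by (simp add: inv_mult_group m_assoc kern_carrier)
  show "put G F q (g \<otimes> d) x h = put G F q g x h"
    using 1 2 assms(1) by (auto simp: put_def)
qed

lemma occurs_put:
  assumes "g \<in> carrier G" "s \<in> St" "s' \<in> St" "occurs G Win (e s) g x"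
  shows "occurs G Win (e s') g (put G F (e s') g x)"
  unfolding occurs_def
proof
  fix t assume t: "t \<in> Win"
  then have "x (g \<otimes> t) = e s t" using assms(4) by (simp add: occurs_def)
  then show "put G F (e s') g x (g \<otimes> t) = e s' t"
    using e_off[OF assms(2,3) t] t assms(1) Win_mem by (simp add: put_apply)
qed

lemma preD:
  assumes "g \<in> Pre x"
  shows "g \<in> carrier G" "\<exists>s\<in>St. occurs G Win (e s) g x"
  using assms by (auto simp: pre_def)

lemma good_pre: "g \<in> Good x \<Longrightarrow> g \<in> Pre x"
  by (simp add: good_def)

lemma good_carrier: "g \<in> Good x \<Longrightarrow> g \<in> carrier G"
  using good_pre preD(1) by blast

lemma good_put:
  assumes "g \<in> Good x" "s \<in> St" "h \<in> Pre (put G F (e s) g x)" "inv g \<otimes> h \<in> NB"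
  shows "inv g \<otimes> h \<in> kern"
  using assms by (simp add: good_def)

lemma good_near:
  assumes "g \<in> Good x" "h \<in> Pre x" "inv g \<otimes> h \<in> NB"
  shows "inv g \<otimes> h \<in> kern"
proof -
  obtain s where s: "s \<in> St" "occurs G Win (e s) g x" using preD[OF good_pre[OF assms(1)]] by blast
  have "put G F (e s) g x = x" using s preD[OF good_pre[OF assms(1)]] by (intro put_same)
  then show ?thesis using good_put[OF assms(1) s(1) _ assms(3)] assms(2) by simp
qed

lemma pre_kern:
  assumes "x \<in> X" "g \<in> Pre x" "h \<in> carrier G" "inv g \<otimes> h \<in> kern"
  shows "h \<in> Pre x"
proof -
  obtain s where s: "s \<in> St" "occurs G Win (e s) g x" and g: "g \<in> carrier G" using preD[OF assms(2)] by blast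
  have "occurs G Win (e s) (g \<otimes> (inv g \<otimes> h)) x" by (rule occurs_kern[OF assms(1,4) g s(2)])
  then have "occurs G Win (e s) h x" using g assms(3) by simp
  then show ?thesis using s(1) assms(3) unfolding pre_def by blast
qed

text \<open>Windows that miss the yolk of \<open>g\<close> do not change. At the remaining positions
  goodness admits only translates of \<open>g\<close> by \<open>kern\<close>, and these carry an egg
  both before and after the change.\<close>

lemma pre_put:
  assumes x: "x \<in> X" and g: "g \<in> Good x" and s: "s \<in> St"
  shows "put G F (e s) g x \<in> X" "Pre (put G F (e s) g x) = Pre x"
proof -
  obtain s0 where s0: "s0 \<in> St" "occurs G Win (e s0) g x" and gc: "g \<in> carrier G"
    using preD[OF good_pre[OF g]] by blast
  show x1: "put G F (e s) g x \<in> X" by (rule e_put[OF x gc s0(1) s s0(2)])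
  have g1: "g \<in> Pre (put G F (e s) g x)"
    using occurs_put[OF gc s0(1) s s0(2)] s gc unfolding pre_def by blast
  show "Pre (put G F (e s) g x) = Pre x"
  proof (rule Set.set_eqI)
    fix h
    show "h \<in> Pre (put G F (e s) g x) \<longleftrightarrow> h \<in> Pre x"
    proof (cases "h \<in> carrier G \<and> inv g \<otimes> h \<in> F <#> iv G Win")
      case True
      then have nb: "inv g \<otimes> h \<in> NB" using FWin_NB by blast
      show ?thesis
      proof
        assume "h \<in> Pre (put G F (e s) g x)"
        from good_put[OF g s this nb] show "h \<in> Pre x"
          using pre_kern[OF x good_pre[OF g]] True by blast
      next
        assume "h \<in> Pre x"
        from good_near[OF g this nb] show "h \<in> Pre (put G F (e s) g x)"
          using pre_kern[OF x1 g1] True by blast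
      qed
    next
      case False
      then show ?thesis using pre_put_far[OF gc, of h] preD(1) by blast
    qed
  qed
qed

text \<open>An egg at \<open>k\<close> that spoils \<open>h\<close> after both changes would appear
  after neither single change, so the yolks at \<open>g\<close> and \<open>h\<close> both meet its
  window. Then \<open>g\<close> and \<open>h\<close> are near, hence equal modulo
  \<open>kern\<close>, and in that case the second change simply overrides the first.\<close>

lemma good_put_mono:
  assumes x: "x \<in> X" and g: "g \<in> Good x" and s: "s \<in> St" and h: "h \<in> Good x"
  shows "h \<in> Good (put G F (e s) g x)"
proof -
  define x1 where "x1 = put G F (e s) g x"
  have gc: "g \<in> carrier G" and hc: "h \<in> carrier G" using g h by (simp_all add: good_carrier)
  have p1: "Pre x1 = Pre x" unfolding x1_def by (rule pre_put(2)[OF x g s])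
  have "inv h \<otimes> k \<in> kern"
    if s': "s' \<in> St" and k: "k \<in> Pre (put G F (e s') h x1)" and nb: "inv h \<otimes> k \<in> NB" for s' k
  proof (rule ccontr)
    assume nk: "inv h \<otimes> k \<notin> kern"
    have kc: "k \<in> carrier G" using preD(1)[OF k] .
    show False
    proof (cases "inv g \<otimes> h \<in> kern")
      case True
      have "put G F (e s') h z = put G F (e s') g z" for z
        using put_kern[OF gc True e_X[OF s']] gc hc by simp
      then have "put G F (e s') h x1 = put G F (e s') h x" by (simp add: x1_def put_put)
      then show False using good_put[OF h s' _ nb] k nk by simp
    next
      case False
      then have gh: "inv g \<otimes> h \<notin> NB" using good_near[OF g good_pre[OF h]] by blast
      have kx: "k \<notin> Pre x" using good_near[OF h _ nb] nk by blast
      have eq: "put G F (e s') h x1 = put G F (e s) g (put G F (e s') h x)"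
        unfolding x1_def by (rule put_commute[OF gc hc gh, symmetric])
      have "k \<notin> Pre (put G F (e s') h x)" using pre_put(2)[OF x h s'] kx by simp
      then have 1: "inv g \<otimes> k \<in> F <#> iv G Win"
        using pre_put_far[OF gc kc] k eq by metis
      have 2: "inv h \<otimes> k \<in> F <#> iv G Win"
        using pre_put_far[OF hc kc] k kx p1 by metis
      show False using FWin_inv_FWin_NB[OF gc hc kc 1 2] gh by contradiction
    qed
  qed
  then show ?thesis using good_pre[OF h] p1 unfolding x1_def good_def by blast
qed

lemma good_put_eq:
  assumes x: "x \<in> X" and g: "g \<in> Good x" and s: "s \<in> St"
  shows "Good (put G F (e s) g x) = Good x"
proof
  obtain s0 where s0: "s0 \<in> St" "occurs G Win (e s0) g x" and gc: "g \<in> carrier G"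
    using preD[OF good_pre[OF g]] by blast
  show "Good x \<subseteq> Good (put G F (e s) g x)" using good_put_mono[OF x g s] by blast
  \<comment> \<open>Writing the old state back returns \<open>x\<close>, so monotonicity also gives
    the reverse inclusion.\<close>
  have "put G F (e s0) g (put G F (e s) g x) = x"
    using put_same[OF gc s0(2)] by (simp add: put_put)
  then show "Good (put G F (e s) g x) \<subseteq> Good x"
    using good_put_mono[OF pre_put(1)[OF x g s] good_put_mono[OF x g s g] s0(1)] by auto
qed

section \<open>Simultaneous updates of the states\<close>

definition state :: "('g \<Rightarrow> 'b) \<Rightarrow> 'g \<Rightarrow> 's" where
  "state x g = (THE s. s \<in> St \<and> occurs G Win (e s) g x)"

lemma state_eqI:
  assumes "s \<in> St" "occurs G Win (e s) g x"
  shows "state x g = s"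
  unfolding state_def
proof (rule the_equality)
  fix s' assume s': "s' \<in> St \<and> occurs G Win (e s') g x"
  show "s' = s"
  proof (rule ccontr)
    assume "s' \<noteq> s"
    then obtain t where t: "t \<in> F" "e s' t \<noteq> e s t" using e_neq s' assms(1) by blast
    then have "t \<in> Win" using F_Win by blast
    then have "x (g \<otimes> t) = e s' t" "x (g \<otimes> t) = e s t" using s' assms(2) by (simp_all add: occurs_def)
    then show False using t(2) by simp
  qed
qed (use assms in simp)

lemma state_pre:
  assumes "g \<in> Pre x"
  shows "state x g \<in> St" "occurs G Win (e (state x g)) g x"
  using preD(2)[OF assms] state_eqI by auto

text \<open>Several elements of \<open>Q\<close> can cover the same cell, namely translates by
  \<open>kern\<close>. For admissible \<open>\<sigma>\<close> and \<open>Q\<close> inside the good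
  set, the choice made by \<open>SOME\<close> does not affect the value
  (\<open>upd_on_hit\<close>).\<close>

definition upd_on :: "'g set \<Rightarrow> ('g \<Rightarrow> 's) \<Rightarrow> ('g \<Rightarrow> 'b) \<Rightarrow> 'g \<Rightarrow> 'b" where
  "upd_on Q \<sigma> x h = (if h \<in> carrier G \<and> (\<exists>g\<in>Q. inv g \<otimes> h \<in> F)
     then let g = (SOME g. g \<in> Q \<and> inv g \<otimes> h \<in> F) in e (\<sigma> g) (inv g \<otimes> h) else x h)"

definition upd :: "('g \<Rightarrow> 's) \<Rightarrow> ('g \<Rightarrow> 'b) \<Rightarrow> 'g \<Rightarrow> 'b" where
  "upd \<sigma> x = upd_on (Good x) \<sigma> x"

text \<open>The elements \<open>g\<close> and \<open>g \<otimes> d\<close> with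
  \<open>d \<in> kern\<close> denote the same egg, so they must receive the same state.\<close>

definition admissible :: "('g \<Rightarrow> 'b) \<Rightarrow> ('g \<Rightarrow> 's) \<Rightarrow> bool" where
  "admissible x \<sigma> \<longleftrightarrow> (\<forall>g\<in>Good x. \<sigma> g \<in> St \<and> (\<forall>d\<in>kern. \<sigma> (g \<otimes> d) = \<sigma> g))"

lemma upd_on_miss: "\<not> (\<exists>g\<in>Q. inv g \<otimes> h \<in> F) \<Longrightarrow> upd_on Q \<sigma> x h = x h"
  by (simp add: upd_on_def)

text \<open>Good positions with overlapping yolks differ by an element of \<open>kern\<close>, under
  which both \<open>\<sigma>\<close> and the patterns \<open>e s\<close> are invariant.\<close>

lemma upd_on_hit:
  assumes adm: "admissible x \<sigma>" and Q: "Q \<subseteq> Good x" and g: "g \<in> Q" and h: "h \<in> carrier G"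
    and hit: "inv g \<otimes> h \<in> F"
  shows "upd_on Q \<sigma> x h = e (\<sigma> g) (inv g \<otimes> h)"
proof -
  define g' where "g' = (SOME g. g \<in> Q \<and> inv g \<otimes> h \<in> F)"
  have g': "g' \<in> Q" "inv g' \<otimes> h \<in> F"
    using someI[of "\<lambda>g. g \<in> Q \<and> inv g \<otimes> h \<in> F" g] g hit by (auto simp: g'_def)
  have gG: "g \<in> Good x" "g' \<in> Good x" using g g' Q by auto
  have gc: "g \<in> carrier G" "g' \<in> carrier G" using gG by (auto simp: good_carrier)
  define d where "d = inv g \<otimes> g'"
  have d: "d \<in> kern"
    unfolding d_def using overlap_NB[OF gc h hit g'(2)] by (rule good_near[OF gG(1) good_pre[OF gG(2)]])
  have g'd: "g' = g \<otimes> d" using gc by (simp add: d_def)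
  have \<sigma>: "\<sigma> g' = \<sigma> g" "\<sigma> g \<in> St" using adm gG(1) d by (auto simp: admissible_def g'd)
  have "inv g' \<otimes> h = inv d \<otimes> (inv g \<otimes> h)"
    using gc d h by (simp add: g'd inv_mult_group m_assoc kern_carrier)
  then have "e (\<sigma> g') (inv g' \<otimes> h) = e (\<sigma> g) (inv g \<otimes> h)"
    using kern_fix[OF kern_inv[OF d] e_X[OF \<sigma>(2)], of "inv g \<otimes> h"] \<sigma>(1) gc h by simp
  then show ?thesis using g hit h unfolding upd_on_def g'_def[symmetric] by auto
qed

lemma upd_hit:
  assumes "admissible x \<sigma>" "g \<in> Good x" "h \<in> carrier G" "inv g \<otimes> h \<in> F"
  shows "upd \<sigma> x h = e (\<sigma> g) (inv g \<otimes> h)"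
  unfolding upd_def by (rule upd_on_hit[OF assms(1) order_refl assms(2-4)])

lemma upd_miss: "\<not> (\<exists>g\<in>Good x. inv g \<otimes> h \<in> F) \<Longrightarrow> upd \<sigma> x h = x h"
  unfolding upd_def by (rule upd_on_miss)

lemma upd_off_carrier: "h \<notin> carrier G \<Longrightarrow> upd \<sigma> x h = x h"
  by (simp add: upd_def upd_on_def)

lemma upd_on_insert:
  assumes adm: "admissible x \<sigma>" and Q: "insert g Q \<subseteq> Good x"
  shows "upd_on (insert g Q) \<sigma> x = put G F (e (\<sigma> g)) g (upd_on Q \<sigma> x)"
proof
  fix h
  show "upd_on (insert g Q) \<sigma> x h = put G F (e (\<sigma> g)) g (upd_on Q \<sigma> x) h"
  proof (cases "h \<in> carrier G")
    case False
    then show ?thesis by (simp add: put_def upd_on_def)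
  next
    case hc: True
    show ?thesis
    proof (cases "inv g \<otimes> h \<in> F")
      case True
      then show ?thesis using upd_on_hit[OF adm Q insertI1 hc] hc by (simp add: put_def)
    next
      case miss: False
      show ?thesis
      proof (cases "\<exists>g'\<in>Q. inv g' \<otimes> h \<in> F")
        case True
        then obtain g' where g': "g' \<in> Q" "inv g' \<otimes> h \<in> F" by blast
        have "upd_on (insert g Q) \<sigma> x h = e (\<sigma> g') (inv g' \<otimes> h)"
          by (rule upd_on_hit[OF adm Q insertI2[OF g'(1)] hc g'(2)])
        moreover have "upd_on Q \<sigma> x h = e (\<sigma> g') (inv g' \<otimes> h)"
          by (rule upd_on_hit[OF adm _ g'(1) hc g'(2)]) (use Q in simp)
        ultimately show ?thesis using miss by (simp add: put_def)
      next
        case False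
        then show ?thesis using miss by (simp add: put_def upd_on_miss)
      qed
    qed
  qed
qed

lemma upd_on_finite:
  assumes x: "x \<in> X" and adm: "admissible x \<sigma>" and Q: "finite Q" "Q \<subseteq> Good x"
  shows "upd_on Q \<sigma> x \<in> X \<and> Pre (upd_on Q \<sigma> x) = Pre x \<and> Good (upd_on Q \<sigma> x) = Good x"
  using Q
proof (induction Q rule: finite_induct)
  case empty
  have "upd_on {} \<sigma> x = x" by (rule ext) (simp add: upd_on_def)
  then show ?case using x by simp
next
  case (insert g Q)
  define y where "y = upd_on Q \<sigma> x"
  have y: "y \<in> X" "Pre y = Pre x" "Good y = Good x" using insert by (simp_all add: y_def)
  have g: "g \<in> Good y" and s: "\<sigma> g \<in> St" using insert.prems adm y(3) by (auto simp: admissible_def)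
  have "upd_on (insert g Q) \<sigma> x = put G F (e (\<sigma> g)) g y"
    unfolding y_def by (rule upd_on_insert[OF adm insert.prems])
  then show ?case using pre_put[OF y(1) g s] good_put_eq[OF y(1) g s] y by simp
qed

text \<open>Together with closedness of \<open>X\<close> this transfers facts about finitely many
  successive changes to the update of all good eggs at once.\<close>

lemma upd_approx:
  assumes adm: "admissible x \<sigma>" and L: "finite L" "L \<subseteq> carrier G"
  shows "\<exists>Q. finite Q \<and> Q \<subseteq> Good x \<and> (\<forall>h\<in>L. upd \<sigma> x h = upd_on Q \<sigma> x h)"
proof -
  define f where "f h = (SOME g. g \<in> Good x \<and> inv g \<otimes> h \<in> F)" for h
  define Q where "Q = f ` {h \<in> L. \<exists>g\<in>Good x. inv g \<otimes> h \<in> F}"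
  have f: "f h \<in> Good x \<and> inv (f h) \<otimes> h \<in> F" if "\<exists>g\<in>Good x. inv g \<otimes> h \<in> F" for h
    unfolding f_def by (rule someI_ex) (use that in blast)
  have Q: "finite Q" "Q \<subseteq> Good x" using L(1) f by (auto simp: Q_def)
  have "upd \<sigma> x h = upd_on Q \<sigma> x h" if h: "h \<in> L" for h
  proof (cases "\<exists>g\<in>Good x. inv g \<otimes> h \<in> F")
    case True
    have hc: "h \<in> carrier G" using h L by blast
    have "f h \<in> Q" using h True by (simp add: Q_def)
    then show ?thesis
      using upd_hit[OF adm _ hc] upd_on_hit[OF adm Q(2) _ hc] f[OF True] by metis
  next
    case False
    then have "\<not> (\<exists>g\<in>Q. inv g \<otimes> h \<in> F)" using Q(2) by blast
    then show ?thesis using upd_miss[OF False] by (simp add: upd_on_miss)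
  qed
  then show ?thesis using Q by blast
qed

text \<open>The cells that decide whether \<open>g\<close> is good and in which state it is: its own
  window and the windows at all positions near it.\<close>

definition visible :: "'g \<Rightarrow> 'g set" where
  "visible g = {g} <#> (insert \<one> NB <#> Win)"

lemma NB_carrier: "NB \<subseteq> carrier G" and finite_NB: "finite NB"
  unfolding nbhd_def using F_carrier Win_carrier finite_F finite_Win
  by - (intro set_mult_closed iv_closed finite_set_mult finite_iv; assumption)+

lemma visible:
  assumes "g \<in> carrier G"
  shows "finite (visible g) \<and> visible g \<subseteq> carrier G"
proof
  show "finite (visible g)"
    unfolding visible_def using finite_NB finite_Win by (intro finite_set_mult finite.insertI finite.emptyI)
  have "insert \<one> NB \<subseteq> carrier G" using NB_carrier by simp
  then have "insert \<one> NB <#> Win \<subseteq> carrier G" using Win_carrier by (rule set_mult_closed)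
  then show "visible g \<subseteq> carrier G"
    unfolding visible_def by (intro set_mult_closed[of "{g}"]) (simp_all add: assms)
qed

lemma visible_Win: "g \<in> carrier G \<Longrightarrow> t \<in> Win \<Longrightarrow> g \<otimes> t \<in> visible g"
proof -
  assume g: "g \<in> carrier G" and t: "t \<in> Win"
  have "g \<otimes> (\<one> \<otimes> t) \<in> visible g" unfolding visible_def using t by (intro mem_set_mult) auto
  then show ?thesis using g t Win_mem by simp
qed

lemma pre_local:
  assumes "\<And>t. t \<in> Win \<Longrightarrow> x (g \<otimes> t) = y (g \<otimes> t)"
  shows "occurs G Win q g x \<longleftrightarrow> occurs G Win q g y" "g \<in> Pre x \<longleftrightarrow> g \<in> Pre y"
  using assms by (simp_all add: occurs_def pre_def)

lemma visible_occurs: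
  assumes "g \<in> carrier G" "\<forall>h\<in>visible g. x h = y h"
  shows "occurs G Win q g x \<longleftrightarrow> occurs G Win q g y" "g \<in> Pre x \<longleftrightarrow> g \<in> Pre y"
  using pre_local[of x g y] visible_Win[OF assms(1)] assms(2) by blast+

lemma visible_state:
  assumes "g \<in> carrier G" "\<forall>h\<in>visible g. x h = y h"
  shows "state x g = state y g"
  unfolding state_def using visible_occurs(1)[OF assms] by simp

lemma good_local_imp:
  assumes g: "g \<in> carrier G" and eq: "\<forall>h\<in>visible g. x h = y h" and gx: "g \<in> Good x"
  shows "g \<in> Good y"
proof -
  have "inv g \<otimes> h \<in> kern"
    if s: "s \<in> St" and h: "h \<in> Pre (put G F (e s) g y)" "inv g \<otimes> h \<in> NB" for s h
  proof -
    have hc: "h \<in> carrier G" using preD(1)[OF h(1)] .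
    have "put G F (e s) g x (h \<otimes> t) = put G F (e s) g y (h \<otimes> t)" if t: "t \<in> Win" for t
    proof -
      have "g \<otimes> (inv g \<otimes> h \<otimes> t) \<in> visible g"
        unfolding visible_def using t h(2) by (intro mem_set_mult) auto
      then have "h \<otimes> t \<in> visible g" using g hc t Win_mem by (simp add: m_assoc)
      then show ?thesis using eq by (simp add: put_def)
    qed
    then have "h \<in> Pre (put G F (e s) g x)" using h(1) pre_local(2)[of "put G F (e s) g x" h] by blast
    then show ?thesis using good_put[OF gx s _ h(2)] by blast
  qed
  then show ?thesis using good_pre[OF gx] visible_occurs(2)[OF g eq] unfolding good_def by blast
qed

lemma good_local:
  assumes "g \<in> carrier G" "\<forall>h\<in>visible g. x h = y h"
  shows "g \<in> Good x \<longleftrightarrow> g \<in> Good y"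
  using good_local_imp[OF assms(1), of x y] good_local_imp[OF assms(1), of y x] assms(2) by metis

lemma upd_X:
  assumes x: "x \<in> X" and adm: "admissible x \<sigma>"
  shows "upd \<sigma> x \<in> X"
proof (rule X_closed)
  have approx: "\<exists>y\<in>X. \<forall>h\<in>L. y h = upd \<sigma> x h" if L: "finite L" "L \<subseteq> carrier G" for L
  proof -
    obtain Q where Q: "finite Q" "Q \<subseteq> Good x" "\<forall>h\<in>L. upd \<sigma> x h = upd_on Q \<sigma> x h"
      using upd_approx[OF adm L] by (elim exE conjE)
    then show ?thesis using upd_on_finite[OF x adm Q(1,2)] by (intro bexI[of _ "upd_on Q \<sigma> x"]) auto
  qed
  then show "\<exists>y\<in>X. \<forall>h\<in>L. y h = upd \<sigma> x h" if "finite L" "L \<subseteq> carrier G" for L using that by blast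
  show "upd \<sigma> x \<in> carrier G \<rightarrow>\<^sub>E B"
  proof (rule PiE_I)
    fix h assume h: "h \<in> carrier G"
    then obtain y where y: "y \<in> X" "y h = upd \<sigma> x h" using approx[of "{h}"] by auto
    then show "upd \<sigma> x h \<in> B" using X_range[OF y(1) h] by simp
  next
    fix h assume "h \<notin> carrier G"
    then show "upd \<sigma> x h = undefined" using X_PiE[OF x] by (metis PiE_arb upd_off_carrier)
  qed
qed

lemma good_upd:
  assumes x: "x \<in> X" and adm: "admissible x \<sigma>"
  shows "Good (upd \<sigma> x) = Good x"
proof (rule Set.set_eqI)
  fix g
  show "g \<in> Good (upd \<sigma> x) \<longleftrightarrow> g \<in> Good x"
  proof (cases "g \<in> carrier G")
    case True
    then have v: "finite (visible g)" "visible g \<subseteq> carrier G" using visible by blast+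
    obtain Q where Q: "finite Q" "Q \<subseteq> Good x" "\<forall>h\<in>visible g. upd \<sigma> x h = upd_on Q \<sigma> x h"
      using upd_approx[OF adm v] by (elim exE conjE)
    show ?thesis using good_local[OF True Q(3)] upd_on_finite[OF x adm Q(1,2)] by simp
  next
    case False
    then show ?thesis using good_carrier by blast
  qed
qed

lemma occurs_upd:
  assumes x: "x \<in> X" and adm: "admissible x \<sigma>" and g: "g \<in> Good x"
  shows "occurs G Win (e (\<sigma> g)) g (upd \<sigma> x)"
  unfolding occurs_def
proof
  fix t assume t: "t \<in> Win"
  have c: "g \<in> carrier G" "t \<in> carrier G" using g t Win_mem by (auto simp: good_carrier)
  have \<sigma>: "\<sigma> g \<in> St" using adm g by (simp add: admissible_def)
  show "upd \<sigma> x (g \<otimes> t) = e (\<sigma> g) t"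
  proof (cases "t \<in> F")
    case True
    then show ?thesis using upd_hit[OF adm g, of "g \<otimes> t"] c by simp
  next
    case False
    \<comment> \<open>A good egg whose yolk reaches into this window equals \<open>g\<close> modulo
      \<open>kern\<close>, so by invariance of \<open>F\<close> it reaches only the yolk of
      \<open>g\<close>.\<close>
    have "\<not> (\<exists>g'\<in>Good x. inv g' \<otimes> (g \<otimes> t) \<in> F)"
    proof
      assume "\<exists>g'\<in>Good x. inv g' \<otimes> (g \<otimes> t) \<in> F"
      then obtain g' where g': "g' \<in> Good x" "inv g' \<otimes> (g \<otimes> t) \<in> F" by blast
      have g'c: "g' \<in> carrier G" using g' by (simp add: good_carrier)
      have "inv g' \<otimes> (g \<otimes> t) \<otimes> inv t \<in> F <#> iv G Win" using g' t by (intro mem_set_mult inv_mem_iv)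
      then have "inv g' \<otimes> g \<in> NB" using FWin_NB c g'c by (auto simp: m_assoc)
      then have d: "inv g' \<otimes> g \<in> kern" by (rule good_near[OF g'(1) good_pre[OF g]])
      have "inv g' \<otimes> g \<otimes> t \<in> F" using g'(2) c g'c by (simp add: m_assoc)
      then show False using kern_F_iff[OF d c(2)] False by simp
    qed
    then have "upd \<sigma> x (g \<otimes> t) = x (g \<otimes> t)" by (rule upd_miss)
    also have "\<dots> = e (state x g) t"
      using state_pre(2)[OF good_pre[OF g]] t by (simp add: occurs_def)
    also have "\<dots> = e (\<sigma> g) t"
      using state_pre(1)[OF good_pre[OF g]] \<sigma> t False by (rule e_off)
    finally show ?thesis .
  qed
qed

lemma state_upd:
  assumes "x \<in> X" "admissible x \<sigma>" "g \<in> Good x"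
  shows "state (upd \<sigma> x) g = \<sigma> g"
  using occurs_upd[OF assms] assms by (intro state_eqI) (auto simp: admissible_def)

lemma upd_cong:
  assumes "admissible x \<sigma>" "admissible x \<tau>" "\<And>g. g \<in> Good x \<Longrightarrow> \<sigma> g = \<tau> g"
  shows "upd \<sigma> x = upd \<tau> x"
proof
  fix h
  show "upd \<sigma> x h = upd \<tau> x h"
  proof (cases "h \<in> carrier G \<and> (\<exists>g\<in>Good x. inv g \<otimes> h \<in> F)")
    case True
    then obtain g where g: "g \<in> Good x" "inv g \<otimes> h \<in> F" and h: "h \<in> carrier G" by blast
    show ?thesis using upd_hit[OF assms(1) g(1) h g(2)] upd_hit[OF assms(2) g(1) h g(2)] assms(3)[OF g(1)] by simp
  next
    case False
    then show ?thesis using upd_miss upd_off_carrier by metis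
  qed
qed

text \<open>The first update leaves the good set unchanged, so the second one rewrites exactly the
  same yolks.\<close>

lemma upd_upd:
  assumes x: "x \<in> X" and adm: "admissible x \<sigma>" "admissible x \<tau>"
  shows "upd \<tau> (upd \<sigma> x) = upd \<tau> x"
proof
  fix h
  have G: "Good (upd \<sigma> x) = Good x" by (rule good_upd[OF x adm(1)])
  have adm': "admissible (upd \<sigma> x) \<tau>" using adm(2) by (simp add: admissible_def G)
  show "upd \<tau> (upd \<sigma> x) h = upd \<tau> x h"
  proof (cases "h \<in> carrier G \<and> (\<exists>g\<in>Good x. inv g \<otimes> h \<in> F)")
    case True
    then obtain g where g: "g \<in> Good x" "inv g \<otimes> h \<in> F" and h: "h \<in> carrier G" by blast
    then show ?thesis using upd_hit[OF adm' _ h g(2)] upd_hit[OF adm(2) g(1) h g(2)] by (simp add: G)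
  next
    case False
    then show ?thesis using upd_miss[of "upd \<sigma> x" h] upd_miss[of x h] upd_off_carrier[of h] unfolding G by metis
  qed
qed

lemma good_kern:
  assumes x: "x \<in> X" and g: "g \<in> Good x" and d: "d \<in> kern"
  shows "g \<otimes> d \<in> Good x" "state x (g \<otimes> d) = state x g"
proof -
  have gc: "g \<in> carrier G" and dc: "d \<in> carrier G" using g d by (simp_all add: good_carrier kern_carrier)
  have occ: "occurs G Win (e (state x g)) (g \<otimes> d) x"
    by (rule occurs_kern[OF x d gc state_pre(2)[OF good_pre[OF g]]])
  then show "state x (g \<otimes> d) = state x g" by (rule state_eqI[OF state_pre(1)[OF good_pre[OF g]]])
  have "inv (g \<otimes> d) \<otimes> h \<in> kern"
    if s: "s \<in> St" and h: "h \<in> Pre (put G F (e s) (g \<otimes> d) x)" "inv (g \<otimes> d) \<otimes> h \<in> NB" for s h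
  proof -
    have hc: "h \<in> carrier G" using preD(1)[OF h(1)] .
    have hp: "h \<in> Pre (put G F (e s) g x)" using h(1) put_kern[OF gc d e_X[OF s]] by simp
    then have hx: "h \<in> Pre x" using pre_put(2)[OF x g s] by simp
    have eq: "inv (g \<otimes> d) \<otimes> h = inv d \<otimes> (inv g \<otimes> h)" using gc dc hc by (simp add: inv_mult_group m_assoc)
    \<comment> \<open>The product is regrouped so that its leftmost factor is taken from
      \<open>F\<close>, which absorbs multiplication by \<open>d\<close> from the left.\<close>
    obtain a b where ab: "a \<in> F" "b \<in> iv G Win <#> (Win <#> iv G F)" "inv (g \<otimes> d) \<otimes> h = a \<otimes> b"
    proof -
      have "F <#> iv G Win <#> (Win <#> iv G F) = F <#> (iv G Win <#> (Win <#> iv G F))"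
        using F_carrier Win_carrier by (intro set_mult_assoc iv_closed set_mult_closed)
      then show ?thesis using h(2) that unfolding nbhd_def set_mult_def[of G F "_ <#> _"] by auto
    qed
    have sub: "iv G Win <#> (Win <#> iv G F) \<subseteq> carrier G"
      using F_carrier Win_carrier by (intro set_mult_closed iv_closed)
    have bc: "b \<in> carrier G" using ab(2) sub by blast
    have "inv g \<otimes> h = d \<otimes> a \<otimes> b" using eq ab(3) ab(1) F_mem gc dc hc bc by (metis inv_closed inv_mult_cancel(2) m_assoc m_closed)
    moreover have "d \<otimes> a \<otimes> b \<in> F <#> (iv G Win <#> (Win <#> iv G F))"
      using ab kern_F[OF d] by (intro mem_set_mult)
    moreover have "F <#> (iv G Win <#> (Win <#> iv G F)) = NB" unfolding nbhd_def
      using F_carrier Win_carrier by (intro set_mult_assoc[symmetric] iv_closed set_mult_closed)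
    ultimately have "inv g \<otimes> h \<in> NB" by simp
    then have "inv g \<otimes> h \<in> kern" by (rule good_near[OF g hx])
    then show ?thesis using eq kern_mult[OF kern_inv[OF d]] by simp
  qed
  moreover have "g \<otimes> d \<in> Pre x" using occ state_pre(1)[OF good_pre[OF g]] gc dc unfolding pre_def by blast
  ultimately show "g \<otimes> d \<in> Good x" unfolding good_def by blast
qed

lemma admissible_state: "x \<in> X \<Longrightarrow> admissible x (state x)"
  by (simp add: admissible_def state_pre good_pre good_kern)

lemma upd_state:
  assumes x: "x \<in> X"
  shows "upd (state x) x = x"
proof
  fix h
  show "upd (state x) x h = x h"
  proof (cases "h \<in> carrier G \<and> (\<exists>g\<in>Good x. inv g \<otimes> h \<in> F)")
    case True
    then obtain g where g: "g \<in> Good x" "inv g \<otimes> h \<in> F" and h: "h \<in> carrier G" by blast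
    have "inv g \<otimes> h \<in> Win" using g F_Win by blast
    then have "x (g \<otimes> (inv g \<otimes> h)) = e (state x g) (inv g \<otimes> h)"
      using state_pre(2)[OF good_pre[OF g(1)]] by (simp add: occurs_def)
    then show ?thesis
      using upd_hit[OF admissible_state[OF x] g(1) h g(2)] good_carrier[OF g(1)] h by simp
  next
    case False
    then show ?thesis using upd_miss upd_off_carrier by metis
  qed
qed

section \<open>Equivariance of updates\<close>

lemma occurs_shift:
  assumes "a \<in> carrier G" "g \<in> carrier G"
  shows "occurs G Win q (a \<otimes> g) (shift G a x) \<longleftrightarrow> occurs G Win q g x"
proof -
  have "shift G a x (a \<otimes> g \<otimes> t) = x (g \<otimes> t)" if "t \<in> Win" for t
    using assms that Win_mem by (simp add: shift_def m_assoc)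
  then show ?thesis by (simp add: occurs_def)
qed

lemma put_shift:
  assumes "a \<in> carrier G" "g \<in> carrier G"
  shows "put G F q (a \<otimes> g) (shift G a x) = shift G a (put G F q g x)"
proof
  fix h
  have "inv (a \<otimes> g) \<otimes> h = inv g \<otimes> (inv a \<otimes> h)" if "h \<in> carrier G"
    using that assms by (simp add: inv_mult_group m_assoc)
  then show "put G F q (a \<otimes> g) (shift G a x) h = shift G a (put G F q g x) h"
    using assms(1) by (auto simp: put_def shift_def)
qed

lemma pre_shift:
  assumes "a \<in> carrier G" "g \<in> carrier G"
  shows "a \<otimes> g \<in> Pre (shift G a x) \<longleftrightarrow> g \<in> Pre x"
  using occurs_shift[OF assms, of _ x] assms by (simp add: pre_def)

lemma good_shift:
  assumes a: "a \<in> carrier G" and g: "g \<in> carrier G"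
  shows "a \<otimes> g \<in> Good (shift G a x) \<longleftrightarrow> g \<in> Good x"
proof -
  have 1: "(\<forall>h\<in>Pre (put G F q (a \<otimes> g) (shift G a x)). inv (a \<otimes> g) \<otimes> h \<in> NB \<longrightarrow> inv (a \<otimes> g) \<otimes> h \<in> kern) \<longleftrightarrow>
      (\<forall>h\<in>Pre (put G F q g x). inv g \<otimes> h \<in> NB \<longrightarrow> inv g \<otimes> h \<in> kern)" (is "?l \<longleftrightarrow> ?r") for q
  proof -
    have mem: "h \<in> Pre (shift G a (put G F q g x)) \<longleftrightarrow> h \<in> carrier G \<and> inv a \<otimes> h \<in> Pre (put G F q g x)" for h
      using pre_shift[OF a, of "inv a \<otimes> h" "put G F q g x"] a preD(1)[of h] by auto
    have eq: "inv (a \<otimes> g) \<otimes> h = inv g \<otimes> (inv a \<otimes> h)" if "h \<in> carrier G" for h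
      using that a g by (simp add: inv_mult_group m_assoc)
    show ?thesis
    proof
      assume l: ?l
      show ?r
      proof (intro ballI impI)
        fix h assume h: "h \<in> Pre (put G F q g x)" "inv g \<otimes> h \<in> NB"
        then have hc: "h \<in> carrier G" using preD by blast
        then have "a \<otimes> h \<in> Pre (put G F q (a \<otimes> g) (shift G a x))"
          using mem[of "a \<otimes> h"] h a put_shift[OF a g, of q x] by simp
        then show "inv g \<otimes> h \<in> kern" using l eq[of "a \<otimes> h"] a hc h(2) by auto
      qed
    next
      assume r: ?r
      show ?l
      proof (intro ballI impI)
        fix h assume h: "h \<in> Pre (put G F q (a \<otimes> g) (shift G a x))" "inv (a \<otimes> g) \<otimes> h \<in> NB"
        then show "inv (a \<otimes> g) \<otimes> h \<in> kern" using r mem[of h] eq[of h] put_shift[OF a g, of q x] preD(1)[OF h(1)] by simp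
      qed
    qed
  qed
  show ?thesis unfolding good_def mem_Collect_eq pre_shift[OF a g] 1 ..
qed

lemma state_shift:
  assumes "a \<in> carrier G" "g \<in> carrier G"
  shows "state (shift G a x) (a \<otimes> g) = state x g"
  unfolding state_def occurs_shift[OF assms] ..

lemma upd_shift:
  assumes a: "a \<in> carrier G" and adm: "admissible x \<sigma>"
    and \<sigma>': "\<And>g. g \<in> Good x \<Longrightarrow> \<sigma>' (a \<otimes> g) = \<sigma> g" and adm': "admissible (shift G a x) \<sigma>'"
  shows "upd \<sigma>' (shift G a x) = shift G a (upd \<sigma> x)"
proof
  fix h
  show "upd \<sigma>' (shift G a x) h = shift G a (upd \<sigma> x) h"
  proof (cases "h \<in> carrier G")
    case False
    then show ?thesis by (simp add: upd_off_carrier shift_def)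
  next
    case hc: True
    have eq: "inv (a \<otimes> g) \<otimes> h = inv g \<otimes> (inv a \<otimes> h)" if "g \<in> carrier G" for g
      using that a hc by (simp add: inv_mult_group m_assoc)
    show ?thesis
    proof (cases "\<exists>g\<in>Good x. inv g \<otimes> (inv a \<otimes> h) \<in> F")
      case True
      then obtain g where g: "g \<in> Good x" "inv g \<otimes> (inv a \<otimes> h) \<in> F" by blast
      have gc: "g \<in> carrier G" using g by (simp add: good_carrier)
      have "upd \<sigma>' (shift G a x) h = e (\<sigma>' (a \<otimes> g)) (inv (a \<otimes> g) \<otimes> h)"
        by (rule upd_hit[OF adm' _ hc]) (use good_shift[OF a gc] g eq[OF gc] in simp_all)
      moreover have "upd \<sigma> x (inv a \<otimes> h) = e (\<sigma> g) (inv g \<otimes> (inv a \<otimes> h))"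
        by (rule upd_hit[OF adm g(1) _ g(2)]) (use a hc in simp)
      ultimately show ?thesis using eq[OF gc] \<sigma>'[OF g(1)] hc by (simp add: shift_def)
    next
      case False
      have "\<not> (\<exists>g\<in>Good (shift G a x). inv g \<otimes> h \<in> F)"
      proof
        assume "\<exists>g\<in>Good (shift G a x). inv g \<otimes> h \<in> F"
        then obtain g where g: "g \<in> Good (shift G a x)" "inv g \<otimes> h \<in> F" by blast
        have gc: "g \<in> carrier G" using g by (simp add: good_carrier)
        have "inv a \<otimes> g \<in> Good x" using good_shift[OF a, of "inv a \<otimes> g" x] a gc g by simp
        moreover have "inv (inv a \<otimes> g) \<otimes> (inv a \<otimes> h) = inv g \<otimes> h"
          using a gc hc by (simp add: inv_mult_group m_assoc)
        ultimately show False using False g(2) by metis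
      qed
      then show ?thesis using upd_miss[OF False] hc by (simp add: upd_miss shift_def)
    qed
  qed
qed

end

section \<open>Conveyor belts\<close>

definition letters :: "nat \<Rightarrow> letter set" where
  "letters k = {..<k} \<times> UNIV"

definition egg_states :: "'a set \<Rightarrow> nat \<Rightarrow> 'g set \<Rightarrow> ((bool \<Rightarrow> 'a) \<times> (letter \<Rightarrow> 'g option)) set" where
  "egg_states A k W = (UNIV \<rightarrow>\<^sub>E A) \<times> (letters k \<rightarrow>\<^sub>E insert None (Some ` W))"

definition word_ball :: "nat \<Rightarrow> nat \<Rightarrow> letter list set" where
  "word_ball k n = {w \<in> carrier (free_group k). length w \<le> n}"

text \<open>A drawing in \<open>G\<close> of a ball of the Cayley tree. Edges prepend letters,
  because words will act from the left. It is used with \<open>\<one>\<close> in the separation set,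
  which makes \<open>u\<close> injective.\<close>

definition tree_embedding ::
    "('g, 'm) monoid_scheme \<Rightarrow> nat \<Rightarrow> 'g set \<Rightarrow> 'g set \<Rightarrow> nat \<Rightarrow> (letter list \<Rightarrow> 'g) \<Rightarrow> bool" where
  "tree_embedding G k D W n u \<longleftrightarrow> (\<forall>w\<in>word_ball k n. u w \<in> carrier G) \<and>
    (\<forall>v\<in>word_ball k n. \<forall>w\<in>word_ball k n. v \<noteq> w \<longrightarrow> inv\<^bsub>G\<^esub> (u v) \<otimes>\<^bsub>G\<^esub> u w \<notin> D) \<and>
    (\<forall>w\<in>word_ball k n. \<forall>l\<in>letters k. push l w \<in> word_ball k n \<longrightarrow> inv\<^bsub>G\<^esub> (u w) \<otimes>\<^bsub>G\<^esub> u (push l w) \<in> W)"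

lemma letter_inv_letters [simp]: "letter_inv l \<in> letters k \<longleftrightarrow> l \<in> letters k"
  by (cases l) (auto simp: letters_def letter_inv_def)

lemma carrier_free_group: "w \<in> carrier (free_group k) \<longleftrightarrow> reduced w \<and> set w \<subseteq> letters k"
  by (simp add: free_group_def letters_def)

lemma mult_free_group: "u \<otimes>\<^bsub>free_group k\<^esub> v = foldr push u v"
  by (simp add: free_group_def)

lemma one_free_group: "\<one>\<^bsub>free_group k\<^esub> = []"
  by (simp add: free_group_def)

text \<open>The group \<open>H\<close> is a copy of the free group, so that the integers and
  \<open>free_group k\<close> are treated together.\<close>

locale machine = eggs G B X K M St e F Win D
  for G :: "('g, 'm) monoid_scheme" (structure) and B :: "'b set" and X K M
    and St :: "((bool \<Rightarrow> 'a) \<times> (letter \<Rightarrow> 'g option)) set" and e F Win D +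
  fixes A :: "'a set" and k :: nat and W :: "'g set" and H :: "('h, 'n) monoid_scheme"
    and \<theta> :: "'h \<Rightarrow> letter list"
  assumes W_carrier: "W \<subseteq> carrier G"
    and St_eq: "St = egg_states A k W"
    and group_H: "group H"
    and iso_\<theta>: "\<theta> \<in> iso H (free_group k)"
    and embedding: "\<And>n. \<exists>u. tree_embedding G k (insert \<one> D) W n u"
begin

sublocale H: group H by (rule group_H)

lemma St_memD: "s \<in> St \<Longrightarrow> s \<in> egg_states A k W"
  using St_eq by simp

definition sites :: "('g \<Rightarrow> 'b) \<Rightarrow> ('g \<times> bool) set" where
  "sites x = Good x \<times> UNIV"

definition data :: "('g \<Rightarrow> 'b) \<Rightarrow> 'g \<times> bool \<Rightarrow> 'a" where
  "data x t = fst (state x (fst t)) (snd t)"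

definition nbr :: "('g \<Rightarrow> 'b) \<Rightarrow> letter \<Rightarrow> 'g \<Rightarrow> 'g option" where
  "nbr x l g = (case snd (state x g) l of None \<Rightarrow> None
     | Some w \<Rightarrow> if g \<otimes> w \<in> Good x \<and> snd (state x (g \<otimes> w)) (letter_inv l) = Some (inv w) then Some (g \<otimes> w) else None)"

text \<open>Each egg carries two sheets of the belt; the sheet \<open>False\<close> runs backwards, and a broken link
  is repaired by turning over to the other sheet of the same egg.\<close>

definition move :: "('g \<Rightarrow> 'b) \<Rightarrow> letter \<Rightarrow> 'g \<times> bool \<Rightarrow> 'g \<times> bool" where
  "move x l t = (case nbr x (if snd t then l else letter_inv l) (fst t) of
     Some h \<Rightarrow> (h, snd t) | None \<Rightarrow> (fst t, \<not> snd t))"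

definition act :: "('g \<Rightarrow> 'b) \<Rightarrow> letter list \<Rightarrow> 'g \<times> bool \<Rightarrow> 'g \<times> bool" where
  "act x w t = foldr (move x) w t"

lemma act_simps [simp]: "act x [] t = t" "act x (a # w) t = move x a (act x w t)"
  by (simp_all add: act_def)

lemma ptr_mem:
  assumes "g \<in> Good x" "l \<in> letters k" "snd (state x g) l = Some w"
  shows "w \<in> W" "w \<in> carrier G"
proof -
  have "state x g \<in> egg_states A k W" by (rule St_memD[OF state_pre(1)[OF good_pre[OF assms(1)]]])
  then have "snd (state x g) l \<in> insert None (Some ` W)"
    using assms(2) by (auto simp: egg_states_def)
  then show "w \<in> W" using assms(3) by auto
  then show "w \<in> carrier G" using W_carrier by blast
qed

lemma nbr_Some:
  assumes "g \<in> Good x" "l \<in> letters k" "nbr x l g = Some h"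
  shows "h \<in> Good x" "nbr x (letter_inv l) h = Some g"
proof -
  obtain w where w: "snd (state x g) l = Some w" "g \<otimes> w \<in> Good x" "h = g \<otimes> w"
    "snd (state x (g \<otimes> w)) (letter_inv l) = Some (inv w)"
    using assms(3) by (auto simp: nbr_def split: option.splits if_splits)
  then show "h \<in> Good x" by simp
  have wc: "w \<in> carrier G" and gc: "g \<in> carrier G"
    using ptr_mem[OF assms(1,2) w(1)] assms(1) by (auto simp: good_carrier)
  then have "g \<otimes> w \<otimes> inv w = g" by (simp add: m_assoc)
  then show "nbr x (letter_inv l) h = Some g"
    using w wc assms(1) by (simp add: nbr_def)
qed

lemma move_sites:
  assumes t: "t \<in> sites x" and l: "l \<in> letters k"
  shows "move x l t \<in> sites x"
proof (cases "nbr x (if snd t then l else letter_inv l) (fst t)")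
  case None
  then show ?thesis using t by (simp add: move_def sites_def mem_Times_iff)
next
  case (Some h)
  have "h \<in> Good x"
    by (rule nbr_Some(1)[OF _ _ Some]) (use t l in \<open>auto simp: sites_def\<close>)
  then show ?thesis using Some by (simp add: move_def sites_def)
qed

text \<open>Where the link is missing, the move ends on the other sheet; there
  \<open>letter_inv l\<close> consults the same missing link and turns back.\<close>

lemma move_cancel:
  assumes t: "t \<in> sites x" and l: "l \<in> letters k"
  shows "move x (letter_inv l) (move x l t) = t"
proof -
  obtain g b where gb: "t = (g, b)" by (cases t)
  define m where "m = (if b then l else letter_inv l)"
  have g: "g \<in> Good x" and m: "m \<in> letters k" using t l by (auto simp: gb sites_def m_def)
  have m': "(if b then letter_inv l else letter_inv (letter_inv l)) = letter_inv m"
    "(if \<not> b then letter_inv l else letter_inv (letter_inv l)) = m"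
    by (simp_all add: m_def)
  show ?thesis
  proof (cases "nbr x m g")
    case None
    then have "move x l t = (g, \<not> b)" by (simp add: move_def gb m_def)
    then show ?thesis using None m'(2) unfolding move_def gb by simp
  next
    case (Some h)
    then have "move x l t = (h, b)" by (simp add: move_def gb m_def)
    then show ?thesis using nbr_Some(2)[OF g m Some] m'(1) unfolding move_def gb by simp
  qed
qed

lemma act_sites: "t \<in> sites x \<Longrightarrow> set w \<subseteq> letters k \<Longrightarrow> act x w t \<in> sites x"
  by (induction w) (auto intro: move_sites)

lemma act_push:
  assumes t: "t \<in> sites x" and w: "set (a # w) \<subseteq> letters k"
  shows "act x (push a w) t = move x a (act x w t)"
proof (cases "\<exists>v. w = letter_inv a # v")
  case True
  then obtain v where v: "w = letter_inv a # v" by blast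
  have "act x v t \<in> sites x" using t w by (intro act_sites) (auto simp: v)
  then have "move x (letter_inv (letter_inv a)) (move x (letter_inv a) (act x v t)) = act x v t"
    using w by (intro move_cancel) auto
  then show ?thesis by (simp add: v)
next
  case False
  then show ?thesis by (cases w) auto
qed

text \<open>A cancelled pair of letters acts trivially by \<open>act_push\<close>, so free
  cancellation is compatible with composition of moves.\<close>

lemma act_mult:
  assumes t: "t \<in> sites x" and "set u \<subseteq> letters k" "set v \<subseteq> letters k"
  shows "act x (foldr push u v) t = act x u (act x v t)"
  using assms(2)
proof (induction u)
  case (Cons a u)
  have "set (foldr push u v) \<subseteq> letters k" using set_foldr_push[of u v] Cons.prems assms(3) by auto
  then show ?case using Cons act_push[OF t, of a "foldr push u v"] by simp
qed simp

section \<open>Configurations over \<open>H\<close> read along orbits\<close>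

lemma \<theta>_carrier: "h \<in> carrier H \<Longrightarrow> \<theta> h \<in> carrier (free_group k)"
  using iso_\<theta> by (auto simp: iso_def bij_betw_def)

lemma \<theta>_letters: "h \<in> carrier H \<Longrightarrow> set (\<theta> h) \<subseteq> letters k"
  using \<theta>_carrier carrier_free_group by blast

lemma \<theta>_mult: "g \<in> carrier H \<Longrightarrow> h \<in> carrier H \<Longrightarrow> \<theta> (g \<otimes>\<^bsub>H\<^esub> h) = foldr push (\<theta> g) (\<theta> h)"
  using iso_\<theta> by (simp add: iso_def hom_def mult_free_group)

lemma \<theta>_one: "\<theta> \<one>\<^bsub>H\<^esub> = []"
  using hom_one[OF _ group_H group_free_group, of \<theta> k] iso_\<theta> by (simp add: iso_def one_free_group)

text \<open>The inverse makes a move along the orbit appear as a left shift of the configuration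
  that is read (\<open>read_act\<close>).\<close>

definition read :: "('g \<Rightarrow> 'b) \<Rightarrow> 'g \<times> bool \<Rightarrow> 'h \<Rightarrow> 'a" where
  "read x t = (\<lambda>h\<in>carrier H. data x (act x (\<theta> (inv\<^bsub>H\<^esub> h)) t))"

lemma data_A:
  assumes "t \<in> sites x"
  shows "data x t \<in> A"
proof -
  have "state x (fst t) \<in> egg_states A k W"
    using assms by (intro St_memD state_pre(1) good_pre) (auto simp: sites_def)
  then show ?thesis by (auto simp: egg_states_def data_def PiE_def Pi_def)
qed

lemma read_full:
  assumes "t \<in> sites x"
  shows "read x t \<in> full_shift H A"
  unfolding full_shift_def read_def
  using data_A act_sites[OF assms] \<theta>_letters by auto

lemma read_one: "read x t \<one>\<^bsub>H\<^esub> = data x t"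
  by (simp add: read_def \<theta>_one)

lemma read_act:
  assumes t: "t \<in> sites x" and h: "h \<in> carrier H"
  shows "read x (act x (\<theta> (inv\<^bsub>H\<^esub> h)) t) = shift H (inv\<^bsub>H\<^esub> h) (read x t)"
proof
  fix v
  show "read x (act x (\<theta> (inv\<^bsub>H\<^esub> h)) t) v = shift H (inv\<^bsub>H\<^esub> h) (read x t) v"
  proof (cases "v \<in> carrier H")
    case v: True
    have "act x (\<theta> (inv\<^bsub>H\<^esub> v)) (act x (\<theta> (inv\<^bsub>H\<^esub> h)) t) = act x (\<theta> (inv\<^bsub>H\<^esub> v \<otimes>\<^bsub>H\<^esub> inv\<^bsub>H\<^esub> h)) t"
      using act_mult[OF t] \<theta>_letters v h by (simp add: \<theta>_mult)
    also have "inv\<^bsub>H\<^esub> v \<otimes>\<^bsub>H\<^esub> inv\<^bsub>H\<^esub> h = inv\<^bsub>H\<^esub> (h \<otimes>\<^bsub>H\<^esub> v)"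
      using v h by (simp add: H.inv_mult_group)
    finally show ?thesis using v h by (simp add: read_def shift_def)
  qed (simp add: read_def shift_def)
qed

lemma nbr_shift:
  assumes a: "a \<in> carrier G" and g: "g \<in> Good x" and l: "l \<in> letters k"
  shows "nbr (shift G a x) l (a \<otimes> g) = map_option (\<lambda>h. a \<otimes> h) (nbr x l g)"
proof -
  have gc: "g \<in> carrier G" using g by (rule good_carrier)
  show ?thesis
  proof (cases "snd (state x g) l")
    case None
    then show ?thesis by (simp add: nbr_def state_shift[OF a gc])
  next
    case (Some w)
    then have wc: "w \<in> carrier G" using ptr_mem[OF g l] by blast
    have eq: "a \<otimes> g \<otimes> w = a \<otimes> (g \<otimes> w)" using a gc wc by (simp add: m_assoc)
    have gw: "g \<otimes> w \<in> carrier G" using gc wc by simp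
    show ?thesis
      using Some by (simp add: nbr_def state_shift[OF a gc] state_shift[OF a gw] eq good_shift[OF a gw])
  qed
qed

lemma move_shift:
  assumes a: "a \<in> carrier G" and t: "t \<in> sites x" and l: "l \<in> letters k"
  shows "move (shift G a x) l (a \<otimes> fst t, snd t) = (a \<otimes> fst (move x l t), snd (move x l t))"
proof -
  have "nbr (shift G a x) m (a \<otimes> fst t) = map_option (\<lambda>h. a \<otimes> h) (nbr x m (fst t))"
    if "m \<in> letters k" for m
    using t by (intro nbr_shift a that) (auto simp: sites_def)
  from this[of "if snd t then l else letter_inv l"] l show ?thesis
    by (auto simp: move_def split: option.splits)
qed

lemma act_shift:
  assumes a: "a \<in> carrier G" and t: "t \<in> sites x" and w: "set w \<subseteq> letters k"
  shows "act (shift G a x) w (a \<otimes> fst t, snd t) = (a \<otimes> fst (act x w t), snd (act x w t))"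
  using w
proof (induction w)
  case (Cons l w)
  then have "act x w t \<in> sites x" using t by (intro act_sites) auto
  then show ?case using Cons move_shift[OF a, of "act x w t" x l] by simp
qed simp

lemma read_shift:
  assumes a: "a \<in> carrier G" and t: "t \<in> sites x"
  shows "read (shift G a x) (a \<otimes> fst t, snd t) = read x t"
proof -
  have "data (shift G a x) (a \<otimes> fst s, snd s) = data x s" if "s \<in> sites x" for s
    using state_shift[OF a, of "fst s" x] that good_carrier by (auto simp: data_def sites_def)
  then show ?thesis
    unfolding read_def using act_shift[OF a t] act_sites[OF t] \<theta>_letters by (intro restrict_ext) simp
qed

text \<open>Only the two symbols are rewritten. The links are kept, so the orbits are the same
  before and after the update (\<open>act_run\<close>).\<close>

definition next_state :: "(('h \<Rightarrow> 'a) \<Rightarrow> 'h \<Rightarrow> 'a) \<Rightarrow> ('g \<Rightarrow> 'b) \<Rightarrow> 'g \<Rightarrow> (bool \<Rightarrow> 'a) \<times> (letter \<Rightarrow> 'g option)" where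
  "next_state \<phi> x g = (\<lambda>b. \<phi> (read x (g, b)) \<one>\<^bsub>H\<^esub>, snd (state x g))"

lemma next_state_shift:
  assumes "a \<in> carrier G" "g \<in> Good x"
  shows "next_state \<phi> (shift G a x) (a \<otimes> g) = next_state \<phi> x g"
  using read_shift[OF assms(1), of "(g, _)" x] state_shift[OF assms(1) good_carrier[OF assms(2)], of x] assms(2)
  by (simp add: next_state_def sites_def)

lemma shift_kern:
  assumes "a \<in> kern" "x \<in> X"
  shows "shift G a x = x"
proof
  fix h
  show "shift G a x h = x h"
  proof (cases "h \<in> carrier G")
    case True
    then show ?thesis using kern_fix[OF kern_inv[OF assms(1)] assms(2) True] by (simp add: shift_def)
  next
    case False
    then show ?thesis using X_PiE[OF assms(2)] by (auto simp: shift_def)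
  qed
qed

lemma admissible_next:
  assumes x: "x \<in> X" and \<phi>: "\<And>c. c \<in> full_shift H A \<Longrightarrow> \<phi> c \<in> full_shift H A"
  shows "admissible x (next_state \<phi> x)"
  unfolding admissible_def
proof (intro ballI conjI)
  fix g assume g: "g \<in> Good x"
  have "\<phi> (read x (g, b)) \<one>\<^bsub>H\<^esub> \<in> A" for b
    using \<phi>[OF read_full[of "(g, b)" x]] g by (auto simp: sites_def full_shift_def)
  moreover have "state x g \<in> egg_states A k W"
    by (rule St_memD[OF state_pre(1)[OF good_pre[OF g]]])
  ultimately have "next_state \<phi> x g \<in> egg_states A k W"
    by (auto simp: egg_states_def next_state_def)
  then show "next_state \<phi> x g \<in> St" using St_eq by simp
  fix d assume d: "d \<in> kern"
  have gc: "g \<in> carrier G" and dc: "d \<in> carrier G" using g d by (auto simp: good_carrier kern_carrier)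
  \<comment> \<open>The right translate \<open>g \<otimes> d\<close> is turned into the left
    translate \<open>a \<otimes> g\<close> with \<open>a\<close> in \<open>kern\<close>, and the
    shift by \<open>a\<close> fixes \<open>x\<close>.\<close>
  define a where "a = g \<otimes> d \<otimes> inv g"
  have a: "a \<in> kern" "a \<in> carrier G" using kern_conj'[OF d gc] by (auto simp: a_def kern_carrier)
  have "a \<otimes> g = g \<otimes> d" using gc dc by (simp add: a_def m_assoc)
  then show "next_state \<phi> x (g \<otimes> d) = next_state \<phi> x g"
    using next_state_shift[OF a(2) g, of \<phi>] shift_kern[OF a(1) x] by simp
qed

definition run :: "(('h \<Rightarrow> 'a) \<Rightarrow> 'h \<Rightarrow> 'a) \<Rightarrow> ('g \<Rightarrow> 'b) \<Rightarrow> 'g \<Rightarrow> 'b" where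
  "run \<phi> x = upd (next_state \<phi> x) x"

abbreviation "Aut_H \<equiv> shift_automorphisms H A (full_shift H A)"

lemma Aut_H:
  assumes "\<phi> \<in> Aut_H"
  shows "\<And>c. c \<in> full_shift H A \<Longrightarrow> \<phi> c \<in> full_shift H A"
    "\<And>g c. g \<in> carrier H \<Longrightarrow> c \<in> full_shift H A \<Longrightarrow> \<phi> (shift H g c) = shift H g (\<phi> c)"
  using assms by (auto simp: shift_automorphisms_def Bij_def bij_betw_def)

lemma admissible_Aut:
  assumes "\<phi> \<in> Aut_H" "x \<in> X"
  shows "admissible x (next_state \<phi> x)"
  by (rule admissible_next[OF assms(2)]) (rule Aut_H(1)[OF assms(1)])

lemma run_X:
  assumes "\<phi> \<in> Aut_H" "x \<in> X"
  shows "run \<phi> x \<in> X" "Good (run \<phi> x) = Good x"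
    "\<And>g. g \<in> Good x \<Longrightarrow> state (run \<phi> x) g = next_state \<phi> x g"
  unfolding run_def
  by (rule upd_X good_upd state_upd, rule assms(2), rule admissible_Aut[OF assms], assumption?)+

lemma run_shift:
  assumes \<phi>: "\<phi> \<in> Aut_H" and x: "x \<in> X" and a: "a \<in> carrier G"
  shows "run \<phi> (shift G a x) = shift G a (run \<phi> x)"
  unfolding run_def
  by (rule upd_shift[OF a admissible_Aut[OF \<phi> x] _ admissible_Aut[OF \<phi> shift_X[OF a x]]])
    (rule next_state_shift[OF a])

lemma act_run:
  assumes \<phi>: "\<phi> \<in> Aut_H" and x: "x \<in> X" and t: "t \<in> sites x" and w: "set w \<subseteq> letters k"
  shows "act (run \<phi> x) w t = act x w t"
proof -
  have nbr: "nbr (run \<phi> x) l g = nbr x l g" if g: "g \<in> Good x" for l g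
  proof -
    have "snd (state (run \<phi> x) h) = snd (state x h)" if "h \<in> Good x" for h
      using run_X(3)[OF \<phi> x that] by (simp add: next_state_def)
    then show ?thesis
      using g run_X(2)[OF \<phi> x] by (cases "snd (state x g) l") (auto simp: nbr_def)
  qed
  have "move (run \<phi> x) l s = move x l s" if "s \<in> sites x" for l s
    using nbr[of "fst s" "if snd s then l else letter_inv l"] that
    unfolding move_def by (auto simp: sites_def simp del: split_paired_All)
  then show ?thesis using w act_sites[OF t] by (induction w) auto
qed

text \<open>Each egg writes only the value at the identity of \<open>\<phi>\<close> applied to what
  it reads. Since the eggs of an orbit read shifts of one configuration, equivariance of
  \<open>\<phi>\<close> makes these values fit together to the image of that configuration.\<close>

lemma read_run:
  assumes \<phi>: "\<phi> \<in> Aut_H" and x: "x \<in> X" and t: "t \<in> sites x"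
  shows "read (run \<phi> x) t = \<phi> (read x t)"
proof
  fix h
  show "read (run \<phi> x) t h = \<phi> (read x t) h"
  proof (cases "h \<in> carrier H")
    case h: True
    define s where "s = act x (\<theta> (inv\<^bsub>H\<^esub> h)) t"
    have s: "s \<in> sites x" unfolding s_def using \<theta>_letters h by (intro act_sites[OF t]) simp
    have "read (run \<phi> x) t h = data (run \<phi> x) s"
      using act_run[OF \<phi> x t] \<theta>_letters h by (simp add: read_def s_def)
    also have "\<dots> = \<phi> (read x s) \<one>\<^bsub>H\<^esub>"
      using run_X(3)[OF \<phi> x, of "fst s"] s by (auto simp: data_def next_state_def sites_def)
    also have "\<dots> = shift H (inv\<^bsub>H\<^esub> h) (\<phi> (read x t)) \<one>\<^bsub>H\<^esub>"
      unfolding s_def using read_act[OF t h] Aut_H(2)[OF \<phi> _ read_full[OF t]] h by simp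
    also have "\<dots> = \<phi> (read x t) h" using h by (simp add: shift_def)
    finally show ?thesis .
  next
    case False
    moreover have "\<phi> (read x t) \<in> full_shift H A" by (rule Aut_H(1)[OF \<phi> read_full[OF t]])
    ultimately show ?thesis by (auto simp: read_def full_shift_def)
  qed
qed

lemma run_run:
  assumes \<phi>: "\<phi> \<in> Aut_H" and \<psi>: "\<psi> \<in> Aut_H" and x: "x \<in> X" and \<chi>: "\<chi> \<in> Aut_H"
    and eq: "\<And>c. c \<in> full_shift H A \<Longrightarrow> \<chi> c = \<psi> (\<phi> c)"
  shows "run \<psi> (run \<phi> x) = run \<chi> x"
proof -
  define y where "y = run \<phi> x"
  have y: "y \<in> X" "Good y = Good x" "\<And>g. g \<in> Good x \<Longrightarrow> state y g = next_state \<phi> x g"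
    unfolding y_def by (rule run_X[OF \<phi> x], assumption?)+
  have adm: "admissible x (next_state \<phi> x)" "admissible y (next_state \<psi> y)" "admissible x (next_state \<chi> x)"
    by (rule admissible_Aut \<phi> \<psi> \<chi> x y(1))+
  have adm': "admissible x (next_state \<psi> y)" using adm(2) by (simp add: admissible_def y(2))
  have ns: "next_state \<psi> y g = next_state \<chi> x g" if g: "g \<in> Good x" for g
  proof -
    have "(g, b) \<in> sites x" for b using g by (simp add: sites_def)
    then have "\<psi> (read y (g, b)) = \<chi> (read x (g, b))" for b
      using read_run[OF \<phi> x] eq[OF read_full] by (simp add: y_def)
    then show ?thesis using y(3)[OF g] by (simp add: next_state_def)
  qed
  have "run \<psi> (run \<phi> x) = upd (next_state \<psi> y) (upd (next_state \<phi> x) x)"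
    by (simp add: run_def y_def)
  also have "\<dots> = upd (next_state \<psi> y) x" by (rule upd_upd[OF x adm(1) adm'])
  also have "\<dots> = upd (next_state \<chi> x) x" by (rule upd_cong[OF adm' adm(3) ns])
  finally show ?thesis by (simp add: run_def)
qed

lemma run_id:
  assumes x: "x \<in> X" and \<phi>: "\<phi> \<in> Aut_H" and id: "\<And>c. c \<in> full_shift H A \<Longrightarrow> \<phi> c = c"
  shows "run \<phi> x = x"
proof -
  have "next_state \<phi> x g = state x g" if g: "g \<in> Good x" for g
    using id[OF read_full[of "(g, _)" x]] g by (simp add: next_state_def sites_def read_one data_def)
  then have "run \<phi> x = upd (state x) x"
    unfolding run_def by (rule upd_cong[OF admissible_Aut[OF \<phi> x] admissible_state[OF x]])
  then show ?thesis by (simp add: upd_state[OF x])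
qed

end

section \<open>Local maps\<close>

lemma prodiscrete_topspace_subtopology:
  "X \<subseteq> full_shift G B \<Longrightarrow> topspace (subtopology (prodiscrete G B) X) = X"
  by (auto simp: topspace_prodiscrete)

text \<open>Continuity is tested coordinatewise, and a map into a discrete space is continuous as
  soon as it is locally constant.\<close>

lemma continuous_map_prodiscreteI:
  fixes G :: "('g, 'm) monoid_scheme"
  assumes X: "X \<subseteq> full_shift G B" and f: "\<And>x. x \<in> X \<Longrightarrow> f x \<in> X"
    and local: "\<And>x t. x \<in> X \<Longrightarrow> t \<in> carrier G \<Longrightarrow>
      \<exists>L. finite L \<and> L \<subseteq> carrier G \<and> (\<forall>y\<in>X. (\<forall>h\<in>L. y h = x h) \<longrightarrow> f y t = f x t)"
  shows "continuous_map (subtopology (prodiscrete G B) X) (subtopology (prodiscrete G B) X) f"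
proof -
  let ?T = "subtopology (prodiscrete G B) X"
  have top: "topspace ?T = X" by (rule prodiscrete_topspace_subtopology[OF X])
  have coord: "continuous_map ?T (discrete_topology B) (\<lambda>x. f x t)" if t: "t \<in> carrier G" for t
  proof -
    have "openin ?T {x \<in> X. f x t \<in> U}" for U
    proof (subst openin_subopen, intro ballI)
      fix x assume x: "x \<in> {x \<in> X. f x t \<in> U}"
      then obtain L where L: "finite L" "L \<subseteq> carrier G" "\<forall>y\<in>X. (\<forall>h\<in>L. y h = x h) \<longrightarrow> f y t = f x t"
        using local[of x t] t by blast
      define V where "V = Pi\<^sub>E (carrier G) (\<lambda>h. if h \<in> L then {x h} else B)"
      have xB: "x h \<in> B" if "h \<in> carrier G" for h using x X that by (auto simp: full_shift_def)
      have "openin (prodiscrete G B) V"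
        unfolding prodiscrete_def V_def
      proof (rule product_topology_basis)
        show "openin (discrete_topology B) (if h \<in> L then {x h} else B)" for h
          using xB L(2) by auto
        have "{h. (if h \<in> L then {x h} else B) \<noteq> topspace (discrete_topology B)} \<subseteq> L" by auto
        then show "finite {h. (if h \<in> L then {x h} else B) \<noteq> topspace (discrete_topology B)}"
          using L(1) by (rule finite_subset)
      qed
      then have "openin ?T (V \<inter> X)" by (rule openin_subtopology_Int)
      moreover have "x \<in> V \<inter> X" using x X xB by (auto simp: V_def full_shift_def PiE_iff)
      moreover have "V \<inter> X \<subseteq> {x \<in> X. f x t \<in> U}"
      proof
        fix y assume y: "y \<in> V \<inter> X"
        have "y h = x h" if "h \<in> L" for h
        proof -
          have "h \<in> carrier G" using that L(2) by blast
          from PiE_mem[OF IntD1[OF y, unfolded V_def] this] show ?thesis using that by simp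
        qed
        then have "f y t = f x t" using L(3) y by blast
        then show "y \<in> {x \<in> X. f x t \<in> U}" using x y by simp
      qed
      ultimately show "\<exists>V. openin ?T V \<and> x \<in> V \<and> V \<subseteq> {x \<in> X. f x t \<in> U}" by blast
    qed
    moreover have "f x t \<in> B" if "x \<in> X" for x using f[OF that] X t by (auto simp: full_shift_def)
    ultimately show ?thesis unfolding continuous_map_def top by auto
  qed
  have "f ` X \<subseteq> extensional (carrier G)"
    using f X by (auto simp: full_shift_def PiE_def)
  then have "continuous_map ?T (prodiscrete G B) f"
    unfolding prodiscrete_def continuous_map_componentwise using coord top by (simp add: prodiscrete_def)
  then show ?thesis using f top by (auto simp: continuous_map_in_subtopology)
qed

text \<open>The set where the value at \<open>t\<close> is \<open>f c t\<close> is open, so it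
  contains a basic neighbourhood of \<open>c\<close>. The cells \<open>L\<close> may depend on
  \<open>c\<close>, which suffices here.\<close>

lemma full_shift_map_local:
  fixes G :: "('g, 'm) monoid_scheme"
  assumes cont: "continuous_map (subtopology (prodiscrete G B) (full_shift G B))
      (subtopology (prodiscrete G B) (full_shift G B)) f"
    and c: "c \<in> full_shift G B" and t: "t \<in> carrier G"
  shows "\<exists>L. finite L \<and> L \<subseteq> carrier G \<and> (\<forall>y\<in>full_shift G B. (\<forall>h\<in>L. y h = c h) \<longrightarrow> f y t = f c t)"
proof -
  have T: "subtopology (prodiscrete G B) (full_shift G B) = prodiscrete G B"
    by (metis subtopology_topspace topspace_prodiscrete)
  have "continuous_map (prodiscrete G B) (discrete_topology B) (\<lambda>x. f x t)"
    using cont t unfolding T by (simp add: prodiscrete_def continuous_map_componentwise)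
  moreover have "f c t \<in> B"
    using calculation c by (auto simp: continuous_map_def topspace_prodiscrete)
  ultimately have "openin (prodiscrete G B) {x \<in> topspace (prodiscrete G B). f x t \<in> {f c t}}"
    by (intro openin_continuous_map_preimage[where Y = "discrete_topology B"]) simp_all
  then have "openin (prodiscrete G B) {x \<in> full_shift G B. f x t \<in> {f c t}}"
    by (simp only: topspace_prodiscrete)
  then have "\<exists>U. finite {i \<in> carrier G. U i \<noteq> topspace (discrete_topology B)} \<and>
      (\<forall>i\<in>carrier G. openin (discrete_topology B) (U i)) \<and>
      c \<in> Pi\<^sub>E (carrier G) U \<and> Pi\<^sub>E (carrier G) U \<subseteq> {x \<in> full_shift G B. f x t \<in> {f c t}}"
    unfolding prodiscrete_def openin_product_topology_alt by (rule bspec) (use c in simp)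
  then obtain U where U: "finite {i \<in> carrier G. U i \<noteq> B}" "c \<in> Pi\<^sub>E (carrier G) U"
      "Pi\<^sub>E (carrier G) U \<subseteq> {x \<in> full_shift G B. f x t \<in> {f c t}}"
    by (elim exE conjE) (simp only: topspace_discrete_topology)
  have "f y t = f c t" if y: "y \<in> full_shift G B" and eq: "\<forall>h\<in>{i \<in> carrier G. U i \<noteq> B}. y h = c h" for y
  proof -
    have "y \<in> Pi\<^sub>E (carrier G) U"
    proof (rule PiE_I)
      fix h assume h: "h \<in> carrier G"
      show "y h \<in> U h"
      proof (cases "U h = B")
        case True
        then show ?thesis using y h by (auto simp: full_shift_def)
      next
        case False
        then have "y h = c h" using eq h by blast
        then show ?thesis using PiE_mem[OF U(2) h] by simp
      qed
    next
      fix h assume "h \<notin> carrier G"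
      then show "y h = undefined" using y by (auto simp: full_shift_def)
    qed
    then show ?thesis using U(3) by blast
  qed
  then show ?thesis using U(1) by (intro exI[of _ "{i \<in> carrier G. U i \<noteq> B}"]) blast
qed

lemma subshift_full_shift:
  assumes "group G" "finite B"
  shows "subshift G B (full_shift G B)"
proof -
  interpret group G by fact
  have "closedin (prodiscrete G B) (full_shift G B)"
    by (metis closedin_topspace topspace_prodiscrete)
  then show ?thesis using assms(2)
    by (auto simp: subshift_def full_shift_def shift_def)
qed

lemma Aut_shift_simps:
  "carrier (Aut_shift G B X) = shift_automorphisms G B X"
  "\<phi> \<in> shift_automorphisms G B X \<Longrightarrow> \<psi> \<in> shift_automorphisms G B X \<Longrightarrow>
    \<phi> \<otimes>\<^bsub>Aut_shift G B X\<^esub> \<psi> = compose X \<phi> \<psi>"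
  "\<one>\<^bsub>Aut_shift G B X\<^esub> = (\<lambda>x\<in>X. x)"
  by (auto simp: Aut_shift_def BijGroup_def shift_automorphisms_def)

section \<open>Continuity of the updates, and the embedding\<close>

context machine begin

text \<open>For \<open>x\<close> in \<open>X\<close>: \<open>P\<close> holds on a neighbourhood of
  \<open>x\<close> in \<open>X\<close>, expressed by cylinders.\<close>

definition near :: "('g \<Rightarrow> 'b) \<Rightarrow> (('g \<Rightarrow> 'b) \<Rightarrow> bool) \<Rightarrow> bool" where
  "near x P \<longleftrightarrow> (\<exists>L. finite L \<and> L \<subseteq> carrier G \<and> (\<forall>y\<in>X. (\<forall>h\<in>L. y h = x h) \<longrightarrow> P y))"

lemma nearI: "finite L \<Longrightarrow> L \<subseteq> carrier G \<Longrightarrow> (\<And>y. y \<in> X \<Longrightarrow> \<forall>h\<in>L. y h = x h \<Longrightarrow> P y) \<Longrightarrow> near x P"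
  unfolding near_def by blast

lemma near_ball:
  assumes "finite S" "\<And>s. s \<in> S \<Longrightarrow> near x (P s)"
  shows "near x (\<lambda>y. \<forall>s\<in>S. P s y)"
proof -
  have "\<forall>s\<in>S. \<exists>L. finite L \<and> L \<subseteq> carrier G \<and> (\<forall>y\<in>X. (\<forall>h\<in>L. y h = x h) \<longrightarrow> P s y)"
    using assms(2) by (simp add: near_def)
  from bchoice[OF this] obtain L where L: "\<forall>s\<in>S. finite (L s) \<and> L s \<subseteq> carrier G \<and>
      (\<forall>y\<in>X. (\<forall>h\<in>L s. y h = x h) \<longrightarrow> P s y)" by (elim exE)
  show ?thesis
    by (rule nearI[of "\<Union>s\<in>S. L s"]) (use L assms(1) in blast)+
qed

lemma near_conj:
  assumes "near x P" "near x Q"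
  shows "near x (\<lambda>y. P y \<and> Q y)"
proof -
  obtain L where L: "finite L" "L \<subseteq> carrier G" "\<forall>y\<in>X. (\<forall>h\<in>L. y h = x h) \<longrightarrow> P y"
    using assms(1) unfolding near_def by (elim exE conjE)
  obtain L' where L': "finite L'" "L' \<subseteq> carrier G" "\<forall>y\<in>X. (\<forall>h\<in>L'. y h = x h) \<longrightarrow> Q y"
    using assms(2) unfolding near_def by (elim exE conjE)
  show ?thesis by (rule nearI[of "L \<union> L'"]) (use L L' in blast)+
qed

lemma near_mono: "near x P \<Longrightarrow> (\<And>y. y \<in> X \<Longrightarrow> P y \<Longrightarrow> Q y) \<Longrightarrow> near x Q"
  unfolding near_def by blast

lemma near_egg:
  assumes "g \<in> carrier G"
  shows "near x (\<lambda>y. (g \<in> Good y \<longleftrightarrow> g \<in> Good x) \<and> state y g = state x g)"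
  by (rule nearI[of "visible g"])
    (use visible[OF assms] good_local[OF assms] visible_state[OF assms] in blast)+

lemma near_nbr:
  assumes g: "g \<in> Good x" and l: "l \<in> letters k"
  shows "near x (\<lambda>y. nbr y l g = nbr x l g)"
proof (cases "snd (state x g) l")
  case None
  then show ?thesis
    by (intro near_mono[OF near_egg[OF good_carrier[OF g]]]) (simp add: nbr_def)
next
  case (Some w)
  have "g \<otimes> w \<in> carrier G" using ptr_mem(2)[OF g l Some] good_carrier[OF g] by simp
  then show ?thesis
    by (intro near_mono[OF near_conj[OF near_egg[OF good_carrier[OF g]] near_egg]]) (auto simp: nbr_def Some)
qed

lemma near_move:
  assumes t: "t \<in> sites x" and l: "l \<in> letters k"
  shows "near x (\<lambda>y. move y l t = move x l t)"
proof -
  have "near x (\<lambda>y. nbr y (if snd t then l else letter_inv l) (fst t) = nbr x (if snd t then l else letter_inv l) (fst t))"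
    by (rule near_nbr) (use t l in \<open>auto simp: sites_def\<close>)
  then show ?thesis by (rule near_mono) (simp only: move_def)
qed

lemma near_act:
  assumes t: "t \<in> sites x" and w: "set w \<subseteq> letters k"
  shows "near x (\<lambda>y. act y w t = act x w t)"
  using w
proof (induction w)
  case Nil
  then show ?case by (intro nearI[of "{}"]) simp_all
next
  case (Cons l w)
  have "near x (\<lambda>y. move y l (act x w t) = move x l (act x w t))"
    using Cons.prems by (intro near_move act_sites[OF t]) simp_all
  moreover have "near x (\<lambda>y. act y w t = act x w t)" using Cons by simp
  ultimately have "near x (\<lambda>y. move y l (act x w t) = move x l (act x w t) \<and> act y w t = act x w t)"
    by (rule near_conj)
  then show ?case by (rule near_mono) simp
qed

lemma near_read:
  assumes t: "t \<in> sites x" and L: "finite L" "L \<subseteq> carrier H"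
  shows "near x (\<lambda>y. \<forall>h\<in>L. read y t h = read x t h)"
proof (rule near_ball[OF L(1)])
  fix h assume "h \<in> L"
  then have h: "h \<in> carrier H" using L by blast
  define w where "w = \<theta> (inv\<^bsub>H\<^esub> h)"
  have w: "set w \<subseteq> letters k" unfolding w_def using h by (intro \<theta>_letters) simp
  have "fst (act x w t) \<in> carrier G"
    using act_sites[OF t w] good_carrier by (auto simp: sites_def)
  from near_conj[OF near_act[OF t w] near_egg[OF this, of x]]
  show "near x (\<lambda>y. read y t h = read x t h)"
    by (rule near_mono) (simp add: read_def h data_def flip: w_def)
qed

lemma near_next_state:
  assumes \<phi>: "\<phi> \<in> Aut_H" and g: "g \<in> Good x"
  shows "near x (\<lambda>y. next_state \<phi> y g = next_state \<phi> x g)"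
proof -
  have "near x (\<lambda>y. \<phi> (read y (g, b)) \<one>\<^bsub>H\<^esub> = \<phi> (read x (g, b)) \<one>\<^bsub>H\<^esub>)" for b
  proof -
    have t: "(g, b) \<in> sites x" using g by (simp add: sites_def)
    have "continuous_map (subtopology (prodiscrete H A) (full_shift H A))
        (subtopology (prodiscrete H A) (full_shift H A)) \<phi>"
      using \<phi> by (auto simp: shift_automorphisms_def homeomorphic_imp_continuous_map)
    from full_shift_map_local[OF this read_full[OF t] H.one_closed]
    obtain L where L: "finite L" "L \<subseteq> carrier H"
      "\<forall>c\<in>full_shift H A. (\<forall>h\<in>L. c h = read x (g, b) h) \<longrightarrow> \<phi> c \<one>\<^bsub>H\<^esub> = \<phi> (read x (g, b)) \<one>\<^bsub>H\<^esub>"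
      by (elim exE conjE)
    from near_conj[OF near_read[OF t L(1,2)] near_egg[OF good_carrier[OF g], of x]] show ?thesis
    proof (rule near_mono)
      fix y assume "(\<forall>h\<in>L. read y (g, b) h = read x (g, b) h) \<and> (g \<in> Good y \<longleftrightarrow> g \<in> Good x) \<and> state y g = state x g"
      then show "\<phi> (read y (g, b)) \<one>\<^bsub>H\<^esub> = \<phi> (read x (g, b)) \<one>\<^bsub>H\<^esub>"
        using L(3)[rule_format, OF read_full[of "(g, b)" y]] g by (simp add: sites_def)
    qed
  qed
  from near_conj[OF near_conj[OF this[of True] this[of False]] near_egg[OF good_carrier[OF g], of x]]
  show ?thesis
  proof (rule near_mono)
    fix y
    assume y: "(\<phi> (read y (g, True)) \<one>\<^bsub>H\<^esub> = \<phi> (read x (g, True)) \<one>\<^bsub>H\<^esub> \<and>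
      \<phi> (read y (g, False)) \<one>\<^bsub>H\<^esub> = \<phi> (read x (g, False)) \<one>\<^bsub>H\<^esub>) \<and>
      (g \<in> Good y \<longleftrightarrow> g \<in> Good x) \<and> state y g = state x g"
    then have "\<phi> (read y (g, b)) \<one>\<^bsub>H\<^esub> = \<phi> (read x (g, b)) \<one>\<^bsub>H\<^esub>" for b by (cases b) simp_all
    then show "next_state \<phi> y g = next_state \<phi> x g" using y by (simp add: next_state_def)
  qed
qed

lemma near_run:
  assumes \<phi>: "\<phi> \<in> Aut_H" and x: "x \<in> X" and t: "t \<in> carrier G"
  shows "near x (\<lambda>y. run \<phi> y t = run \<phi> x t)"
proof -
  \<comment> \<open>These are the positions whose yolk contains \<open>t\<close>; their goodness
    decides whether the cell \<open>t\<close> is rewritten at all.\<close>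
  define C where "C = {t} <#> iv G F"
  have C: "finite C" "C \<subseteq> carrier G"
    unfolding C_def using finite_F iv_closed[OF F_carrier] t
    by (simp_all add: finite_set_mult finite_iv set_mult_closed)
  have hit: "g \<in> C" if "g \<in> carrier G" "inv g \<otimes> t \<in> F" for g
  proof -
    have "t \<otimes> inv (inv g \<otimes> t) \<in> C" unfolding C_def using that by (intro mem_set_mult inv_mem_iv) simp
    then show ?thesis using that t by (simp add: inv_mult_group)
  qed
  have good: "near x (\<lambda>y. \<forall>g\<in>C. (g \<in> Good y \<longleftrightarrow> g \<in> Good x) \<and> state y g = state x g)"
    using C by (intro near_ball near_egg) auto
  show ?thesis
  proof (cases "\<exists>g\<in>Good x. inv g \<otimes> t \<in> F")
    case True
    then obtain g where g: "g \<in> Good x" "inv g \<otimes> t \<in> F" by blast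
    have gC: "g \<in> C" using hit g good_carrier by blast
    from near_conj[OF near_next_state[OF \<phi> g(1)] good] show ?thesis
    proof (rule near_mono)
      fix y assume y: "y \<in> X" and eq: "next_state \<phi> y g = next_state \<phi> x g \<and>
        (\<forall>g\<in>C. (g \<in> Good y \<longleftrightarrow> g \<in> Good x) \<and> state y g = state x g)"
      have gy: "g \<in> Good y" using eq gC g(1) by blast
      show "run \<phi> y t = run \<phi> x t"
        unfolding run_def
        using upd_hit[OF admissible_Aut[OF \<phi> x] g(1) t g(2)] upd_hit[OF admissible_Aut[OF \<phi> y] gy t g(2)] eq
        by simp
    qed
  next
    case False
    have "near x (\<lambda>y. y t = x t)" by (rule nearI[of "{t}"]) (use t in auto)
    from near_conj[OF this good] show ?thesis
    proof (rule near_mono)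
      fix y assume eq: "y t = x t \<and> (\<forall>g\<in>C. (g \<in> Good y \<longleftrightarrow> g \<in> Good x) \<and> state y g = state x g)"
      have "\<not> (\<exists>g\<in>Good y. inv g \<otimes> t \<in> F)" using eq hit good_carrier False by blast
      then show "run \<phi> y t = run \<phi> x t"
        unfolding run_def using upd_miss False eq by metis
    qed
  qed
qed

definition embed :: "(('h \<Rightarrow> 'a) \<Rightarrow> 'h \<Rightarrow> 'a) \<Rightarrow> ('g \<Rightarrow> 'b) \<Rightarrow> 'g \<Rightarrow> 'b" where
  "embed \<phi> = (\<lambda>x\<in>X. run \<phi> x)"

lemma X_full: "X \<subseteq> full_shift G B"
  using sub by (simp add: subshift_def)

lemma continuous_embed:
  assumes "\<phi> \<in> Aut_H"
  shows "continuous_map (subtopology (prodiscrete G B) X) (subtopology (prodiscrete G B) X) (embed \<phi>)"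
proof (rule continuous_map_prodiscreteI[OF X_full])
  show "embed \<phi> x \<in> X" if "x \<in> X" for x using run_X(1)[OF assms that] that by (simp add: embed_def)
  show "\<exists>L. finite L \<and> L \<subseteq> carrier G \<and> (\<forall>y\<in>X. (\<forall>h\<in>L. y h = x h) \<longrightarrow> embed \<phi> y t = embed \<phi> x t)"
    if "x \<in> X" "t \<in> carrier G" for x t
    using near_run[OF assms that] that(1) by (simp add: near_def embed_def)
qed

lemma embed_compose:
  assumes A: "finite A" and "\<psi> \<in> Aut_H" "\<phi> \<in> Aut_H"
  shows "embed (\<psi> \<otimes>\<^bsub>Aut_shift H A (full_shift H A)\<^esub> \<phi>) = compose X (embed \<psi>) (embed \<phi>)"
proof -
  interpret AH: group "Aut_shift H A (full_shift H A)"
    by (intro group_Aut_shift subshift_full_shift group_H A)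
  define \<chi> where "\<chi> = \<psi> \<otimes>\<^bsub>Aut_shift H A (full_shift H A)\<^esub> \<phi>"
  have \<chi>: "\<chi> \<in> Aut_H" unfolding \<chi>_def using AH.m_closed assms by (simp add: Aut_shift_simps)
  have "\<chi> = compose (full_shift H A) \<psi> \<phi>" unfolding \<chi>_def by (rule Aut_shift_simps(2)[OF assms(2,3)])
  then have "\<chi> c = \<psi> (\<phi> c)" if "c \<in> full_shift H A" for c using that by (simp add: compose_def)
  then have "run \<psi> (run \<phi> x) = run \<chi> x" if "x \<in> X" for x
    by (intro run_run[OF assms(3,2) that \<chi>])
  then show ?thesis unfolding \<chi>_def[symmetric]
    using run_X(1)[OF assms(3)] by (intro ext) (simp add: embed_def compose_def)
qed

lemma embed_one:
  assumes A: "finite A"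
  shows "embed \<one>\<^bsub>Aut_shift H A (full_shift H A)\<^esub> = (\<lambda>x\<in>X. x)"
proof -
  interpret AH: group "Aut_shift H A (full_shift H A)"
    by (intro group_Aut_shift subshift_full_shift group_H A)
  have "\<one>\<^bsub>Aut_shift H A (full_shift H A)\<^esub> \<in> Aut_H" using AH.one_closed by (simp add: Aut_shift_simps)
  from run_id[OF _ this] show ?thesis
    unfolding embed_def by (intro restrict_ext) (simp add: Aut_shift_simps)
qed

lemma embed_Aut:
  assumes A: "finite A" and \<phi>: "\<phi> \<in> Aut_H"
  shows "embed \<phi> \<in> shift_automorphisms G B X"
proof -
  interpret AH: group "Aut_shift H A (full_shift H A)"
    by (intro group_Aut_shift subshift_full_shift group_H A)
  let ?T = "subtopology (prodiscrete G B) X"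
  have top: "topspace ?T = X" by (rule prodiscrete_topspace_subtopology[OF X_full])
  define \<psi> where "\<psi> = inv\<^bsub>Aut_shift H A (full_shift H A)\<^esub> \<phi>"
  have \<phi>c: "\<phi> \<in> carrier (Aut_shift H A (full_shift H A))" using \<phi> by (simp add: Aut_shift_simps)
  have \<psi>: "\<psi> \<in> Aut_H" using AH.inv_closed[OF \<phi>c] by (simp add: \<psi>_def Aut_shift_simps)
  have "compose X (embed \<psi>) (embed \<phi>) = (\<lambda>x\<in>X. x)" "compose X (embed \<phi>) (embed \<psi>) = (\<lambda>x\<in>X. x)"
    using embed_compose[OF A \<psi> \<phi>] embed_compose[OF A \<phi> \<psi>] embed_one[OF A] AH.l_inv[OF \<phi>c] AH.r_inv[OF \<phi>c]
    by (simp_all add: \<psi>_def)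
  from fun_cong[OF this(1)] fun_cong[OF this(2)]
  have inv: "embed \<psi> (embed \<phi> x) = x" "embed \<phi> (embed \<psi> x) = x" if "x \<in> X" for x
    using that by (simp_all add: compose_def) (metis that)+
  have maps: "homeomorphic_maps ?T ?T (embed \<phi>) (embed \<psi>)"
    unfolding homeomorphic_maps_def top using continuous_embed \<phi> \<psi> inv by blast
  have closed: "embed \<chi> x \<in> X" if "\<chi> \<in> Aut_H" "x \<in> X" for \<chi> x
    using run_X(1)[OF that] that(2) by (simp add: embed_def)
  have "bij_betw (embed \<phi>) X X"
    by (rule bij_betw_byWitness[of _ "embed \<psi>"]) (use inv closed \<phi> \<psi> in auto)
  then have "embed \<phi> \<in> Bij X" by (simp add: Bij_def embed_def)
  moreover have "homeomorphic_map ?T ?T (embed \<phi>)" using maps homeomorphic_maps_map by blast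
  moreover have "embed \<phi> (shift G a x) = shift G a (embed \<phi> x)" if "a \<in> carrier G" "x \<in> X" for a x
    using run_shift[OF \<phi> that(2,1)] shift_X[OF that] that(2) by (simp add: embed_def)
  ultimately show ?thesis by (simp add: shift_automorphisms_def)
qed

text \<open>A disagreement of \<open>\<phi>\<close> and \<open>\<psi>\<close> is decided by finitely
  many symbols of some \<open>c\<close>. These are written into eggs placed along an embedded ball,
  and the egg at its centre then reacts differently to the two maps.\<close>

lemma embed_inj:
  assumes \<phi>: "\<phi> \<in> Aut_H" and \<psi>: "\<psi> \<in> Aut_H" and eq: "embed \<phi> = embed \<psi>"
  shows "\<phi> = \<psi>"
proof (rule ccontr)
  assume "\<phi> \<noteq> \<psi>"
  let ?A = "full_shift H A"
  have "\<phi> \<in> extensional ?A" "\<psi> \<in> extensional ?A"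
    using \<phi> \<psi> by (auto simp: shift_automorphisms_def Bij_def)
  then obtain c0 where c0: "c0 \<in> ?A" "\<phi> c0 \<noteq> \<psi> c0"
    using extensionalityI \<open>\<phi> \<noteq> \<psi>\<close> by blast
  have "\<phi> c0 \<in> carrier H \<rightarrow>\<^sub>E A" "\<psi> c0 \<in> carrier H \<rightarrow>\<^sub>E A"
    using Aut_H(1)[OF \<phi> c0(1)] Aut_H(1)[OF \<psi> c0(1)] by (simp_all add: full_shift_def)
  then obtain h0 where h0: "h0 \<in> carrier H" "\<phi> c0 h0 \<noteq> \<psi> c0 h0"
    using c0(2) by (meson PiE_ext)
  \<comment> \<open>A shift moves the disagreement to the identity, the only coordinate that an egg
    writes.\<close>
  define c where "c = shift H (inv\<^bsub>H\<^esub> h0) c0"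
  have c: "c \<in> ?A" using c0(1) h0(1) by (auto simp: c_def shift_def full_shift_def)
  have "\<chi> c \<one>\<^bsub>H\<^esub> = \<chi> c0 h0" if "\<chi> \<in> Aut_H" for \<chi>
  proof -
    have "\<chi> c = shift H (inv\<^bsub>H\<^esub> h0) (\<chi> c0)"
      unfolding c_def by (rule Aut_H(2)[OF that _ c0(1)]) (simp add: h0(1))
    then show ?thesis using h0(1) by (simp add: shift_def)
  qed
  then have ne: "\<phi> c \<one>\<^bsub>H\<^esub> \<noteq> \<psi> c \<one>\<^bsub>H\<^esub>" using h0(2) \<phi> \<psi> by metis
  have cont: "continuous_map (subtopology (prodiscrete H A) ?A) (subtopology (prodiscrete H A) ?A) \<chi>"
    if "\<chi> \<in> Aut_H" for \<chi>
    using that by (auto simp: shift_automorphisms_def homeomorphic_imp_continuous_map)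
  obtain L1 where L1: "finite L1" "L1 \<subseteq> carrier H"
    "\<forall>y\<in>?A. (\<forall>h\<in>L1. y h = c h) \<longrightarrow> \<phi> y \<one>\<^bsub>H\<^esub> = \<phi> c \<one>\<^bsub>H\<^esub>"
    using full_shift_map_local[OF cont[OF \<phi>] c H.one_closed] by (elim exE conjE)
  obtain L2 where L2: "finite L2" "L2 \<subseteq> carrier H"
    "\<forall>y\<in>?A. (\<forall>h\<in>L2. y h = c h) \<longrightarrow> \<psi> y \<one>\<^bsub>H\<^esub> = \<psi> c \<one>\<^bsub>H\<^esub>"
    using full_shift_map_local[OF cont[OF \<psi>] c H.one_closed] by (elim exE conjE)
  have "finite ((\<lambda>h. length (\<theta> (inv\<^bsub>H\<^esub> h))) ` (L1 \<union> L2))" using L1 L2 by simp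
  then obtain n where n: "length (\<theta> (inv\<^bsub>H\<^esub> h)) \<le> n" if "h \<in> L1 \<union> L2" for h
    unfolding finite_nat_set_iff_bounded_le by blast
  let ?b = "word_ball k n"
  obtain u where "tree_embedding G k (insert \<one> D) W n u" using embedding by blast
  then have uc: "\<forall>w\<in>?b. u w \<in> carrier G"
    and usep: "\<forall>v\<in>?b. \<forall>w\<in>?b. v \<noteq> w \<longrightarrow> inv (u v) \<otimes> u w \<notin> insert \<one> D"
    and uW: "\<forall>w\<in>?b. \<forall>l\<in>letters k. push l w \<in> ?b \<longrightarrow> inv (u w) \<otimes> u (push l w) \<in> W"
    unfolding tree_embedding_def by - (elim conjE, assumption)+
  have ball: "reduced w" "set w \<subseteq> letters k" if "w \<in> ?b" for w
    using that by (auto simp: word_ball_def carrier_free_group)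
  have nil: "[] \<in> ?b" by (simp add: word_ball_def carrier_free_group)
  have "?b \<subseteq> {w. set w \<subseteq> letters k \<and> length w \<le> n}" by (auto simp: word_ball_def carrier_free_group)
  then have fin: "finite ?b"
    by (rule finite_subset) (simp add: finite_lists_length_le letters_def)
  have inj: "inj_on u ?b"
  proof (rule inj_onI)
    fix v w assume vw: "v \<in> ?b" "w \<in> ?b" "u v = u w"
    then have "inv (u v) \<otimes> u w \<in> insert \<one> D" using uc by simp
    then show "v = w" using usep[rule_format, OF vw(1,2)] by metis
  qed
  \<comment> \<open>The word \<open>w\<close> leads to the symbol that \<open>read\<close> places at
    \<open>\<rho> w\<close>; the inverse matches the one in \<open>read\<close>.\<close>
  define \<rho> where "\<rho> w = inv\<^bsub>H\<^esub> (inv_into (carrier H) \<theta> w)" for w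
  have surj: "\<theta> ` carrier H = carrier (free_group k)" and inj\<theta>: "inj_on \<theta> (carrier H)"
    using iso_\<theta> by (auto simp: iso_def bij_betw_def)
  have \<rho>: "\<rho> w \<in> carrier H" if "w \<in> ?b" for w
    using inv_into_into[of w \<theta> "carrier H"] that surj by (auto simp: \<rho>_def word_ball_def)
  \<comment> \<open>Both sheets carry the symbol of \<open>c\<close>. Links leaving the ball are
    left empty, and those inside it are confirmed from both ends.\<close>
  define st where "st w = (\<lambda>b::bool. c (\<rho> w),
    \<lambda>l\<in>letters k. if push l w \<in> ?b then Some (inv (u w) \<otimes> u (push l w)) else None)" for w
  have st: "st w \<in> St" if w: "w \<in> ?b" for w
  proof -
    have "c (\<rho> w) \<in> A" using c \<rho>[OF w] by (auto simp: full_shift_def)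
    moreover have "(if push l w \<in> ?b then Some (inv (u w) \<otimes> u (push l w)) else None) \<in> insert None (Some ` W)"
      if "l \<in> letters k" for l
      using uW w that by auto
    ultimately have "st w \<in> egg_states A k W" unfolding st_def egg_states_def by (auto simp: PiE_iff)
    then show ?thesis using St_eq by simp
  qed
  define \<sigma> where "\<sigma> v = st (inv_into ?b u v)" for v
  have \<sigma>: "\<sigma> (u w) = st w" if "w \<in> ?b" for w using inv_into_f_f[OF inj that] by (simp add: \<sigma>_def)
  have "\<exists>x\<in>X. \<forall>v\<in>u ` ?b. occurs G Win (e (\<sigma> v)) v x \<and> v \<in> Good x"
  proof (rule place_eggs)
    show "finite (u ` ?b)" using fin by simp
    show "u ` ?b \<subseteq> carrier G" using uc by blast
    show "\<forall>v\<in>u ` ?b. \<forall>w\<in>u ` ?b. v \<noteq> w \<longrightarrow> inv v \<otimes> w \<notin> D"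
    proof (intro ballI impI)
      fix a b assume "a \<in> u ` ?b" "b \<in> u ` ?b" "a \<noteq> b"
      then obtain v w where "v \<in> ?b" "w \<in> ?b" "v \<noteq> w" and ab: "a = u v" "b = u w" by auto
      then have "inv (u v) \<otimes> u w \<notin> insert \<one> D" by (intro usep[rule_format])
      then show "inv a \<otimes> b \<notin> D" by (simp add: ab)
    qed
    show "\<forall>v\<in>u ` ?b. \<sigma> v \<in> St" using \<sigma> st by simp
  qed
  then obtain x where x: "x \<in> X" "\<forall>v\<in>u ` ?b. occurs G Win (e (\<sigma> v)) v x \<and> v \<in> Good x" by (elim bexE)
  have good: "u w \<in> Good x" if "w \<in> ?b" for w using x(2) that by blast
  have state: "state x (u w) = st w" if "w \<in> ?b" for w
  proof (rule state_eqI[OF st[OF that]])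
    show "occurs G Win (e (st w)) (u w) x" using x(2) that \<sigma>[OF that] by force
  qed
  have nbr: "nbr x l (u w) = Some (u (push l w))"
    if w: "w \<in> ?b" "l \<in> letters k" "push l w \<in> ?b" for w l
  proof -
    have "push (letter_inv l) (push l w) = w"
      using push_cancel[OF ball(1)[OF w(1)], of "letter_inv l"] by simp
    then have "snd (st (push l w)) (letter_inv l) = Some (inv (u (push l w)) \<otimes> u w)"
      using w by (simp add: st_def)
    moreover have "inv (inv (u w) \<otimes> u (push l w)) = inv (u (push l w)) \<otimes> u w"
      using uc w by (simp add: inv_mult_group)
    moreover have "snd (st w) l = Some (inv (u w) \<otimes> u (push l w))" using w by (simp add: st_def)
    moreover have "u w \<otimes> (inv (u w) \<otimes> u (push l w)) = u (push l w)" using uc w by simp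
    ultimately show ?thesis
      using good[OF w(3)] by (simp add: nbr_def state[OF w(1)] state[OF w(3)])
  qed
  define t where "t = (u [], True)"
  have t: "t \<in> sites x" using good[OF nil] by (simp add: t_def sites_def)
  have act: "act x w t = (u w, True)" if "w \<in> ?b" for w
    using that
  proof (induction w)
    case (Cons l w)
    have r: "reduced (l # w)" "l \<in> letters k" using ball[OF Cons.prems] by auto
    have w: "w \<in> ?b" using Cons.prems reduced_ConsD[OF r(1)] by (auto simp: word_ball_def carrier_free_group)
    then have "nbr x l (u w) = Some (u (l # w))"
      using nbr[OF w r(2)] push_reduced[OF r(1)] Cons.prems by simp
    then show ?case using Cons.IH[OF w] by (simp add: move_def)
  qed (simp add: t_def)
  have read: "read x t h = c h" if h: "h \<in> L1 \<union> L2" for h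
  proof -
    have hc: "h \<in> carrier H" using h L1 L2 by blast
    have w: "\<theta> (inv\<^bsub>H\<^esub> h) \<in> ?b" using n[OF h] \<theta>_carrier hc by (simp add: word_ball_def)
    have "\<rho> (\<theta> (inv\<^bsub>H\<^esub> h)) = h" using inv_into_f_f[OF inj\<theta>, of "inv\<^bsub>H\<^esub> h"] hc by (simp add: \<rho>_def)
    then show ?thesis using hc act[OF w] state[OF w] by (simp add: read_def data_def st_def)
  qed
  have "\<phi> (read x t) \<one>\<^bsub>H\<^esub> = \<phi> c \<one>\<^bsub>H\<^esub>" "\<psi> (read x t) \<one>\<^bsub>H\<^esub> = \<psi> c \<one>\<^bsub>H\<^esub>"
    using L1(3)[rule_format, OF read_full[OF t]] L2(3)[rule_format, OF read_full[OF t]] read by simp_all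
  moreover have "fst (state (run \<chi> x) (u [])) True = \<chi> (read x t) \<one>\<^bsub>H\<^esub>" if "\<chi> \<in> Aut_H" for \<chi>
    using run_X(3)[OF that x(1) good[OF nil]] by (simp add: next_state_def t_def)
  moreover have "run \<phi> x = run \<psi> x" using fun_cong[OF eq, of x] x(1) by (simp add: embed_def)
  ultimately show False using ne \<phi> \<psi> by metis
qed

lemma embeds:
  assumes "finite A"
  shows "embeds_into (Aut_shift H A (full_shift H A)) (Aut_shift G B X)"
proof -
  have "embed \<in> hom (Aut_shift H A (full_shift H A)) (Aut_shift G B X)"
    by (rule homI)
      (simp_all add: Aut_shift_simps(1) embed_Aut[OF assms] embed_compose[OF assms]
        Aut_shift_simps(2)[of _ G B X, OF embed_Aut[OF assms] embed_Aut[OF assms]])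
  moreover have "inj_on embed (carrier (Aut_shift H A (full_shift H A)))"
    by (rule inj_onI) (use embed_inj in \<open>simp add: Aut_shift_simps\<close>)
  ultimately show ?thesis unfolding embeds_into_def mon_def by blast
qed

end

section \<open>Separated trees\<close>

text \<open>Induction on the size of \<open>I\<close>. A nonempty proper \<open>J\<close> with
  equality is matched first, and its neighbours are withdrawn from the rest. Without such a
  \<open>J\<close> there is a surplus of one everywhere, so any \<open>i\<close> may take any
  element of \<open>A i\<close>.\<close>

lemma hall:
  fixes A :: "'i \<Rightarrow> 'c set"
  assumes "finite I" "\<forall>i\<in>I. finite (A i)" "\<forall>J\<subseteq>I. card J \<le> card (\<Union>i\<in>J. A i)"
  shows "\<exists>f. inj_on f I \<and> (\<forall>i\<in>I. f i \<in> A i)"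
  using assms
proof (induction "card I" arbitrary: I A rule: less_induct)
  case less
  note fin = less.prems(1) and finA = less.prems(2) and hall = less.prems(3)
  have finU: "finite (\<Union>i\<in>J. A i)" if "J \<subseteq> I" for J
    using finite_subset[OF that fin] finA that by auto
  show ?case
  proof (cases "\<exists>J. J \<noteq> {} \<and> J \<subset> I \<and> card (\<Union>i\<in>J. A i) = card J")
    case True
    then obtain J where J: "J \<noteq> {}" "J \<subset> I" "card (\<Union>i\<in>J. A i) = card J" by (elim exE conjE)
    have finJ: "finite J" using J fin finite_subset by blast
    have "\<exists>f. inj_on f J \<and> (\<forall>i\<in>J. f i \<in> A i)"
    proof (rule less.hyps)
      show "card J < card I" using J fin by (simp add: psubset_card_mono)
      show "\<forall>i\<in>J. finite (A i)" using finA J by auto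
      show "\<forall>L\<subseteq>J. card L \<le> card (\<Union>i\<in>L. A i)" using J by (intro allI impI hall[rule_format]) blast
    qed fact
    then obtain f where f: "inj_on f J" "\<forall>i\<in>J. f i \<in> A i" by (elim exE conjE)
    define U where "U = (\<Union>i\<in>J. A i)"
    have "\<exists>g. inj_on g (I - J) \<and> (\<forall>i\<in>I - J. g i \<in> A i - U)"
    proof (rule less.hyps)
      show "card (I - J) < card I" using J fin by (intro psubset_card_mono) auto
      show "finite (I - J)" "\<forall>i\<in>I - J. finite (A i - U)" using fin finA by auto
      show "\<forall>L\<subseteq>I - J. card L \<le> card (\<Union>i\<in>L. A i - U)"
      proof (intro allI impI)
        fix L assume L: "L \<subseteq> I - J"
        have finL: "finite L" using L fin finite_subset by blast
        have "card L + card J = card (L \<union> J)" using L finL finJ by (subst card_Un_disjoint) auto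
        also have "\<dots> \<le> card (\<Union>i\<in>L \<union> J. A i)" by (rule hall[rule_format]) (use L J in blast)
        also have "(\<Union>i\<in>L \<union> J. A i) = (\<Union>i\<in>L. A i - U) \<union> U" by (auto simp: U_def)
        also have "card \<dots> \<le> card (\<Union>i\<in>L. A i - U) + card U" by (rule card_Un_le)
        finally show "card L \<le> card (\<Union>i\<in>L. A i - U)" using J(3) by (simp add: U_def)
      qed
    qed
    then obtain g where g: "inj_on g (I - J)" "\<forall>i\<in>I - J. g i \<in> A i - U" by (elim exE conjE)
    let ?h = "\<lambda>i. if i \<in> J then f i else g i"
    have "inj_on ?h I"
    proof (rule inj_onI)
      fix i j assume ij: "i \<in> I" "j \<in> I" "?h i = ?h j"
      have fU: "f i \<in> U" if "i \<in> J" for i using f(2) that by (auto simp: U_def)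
      have gU: "g i \<notin> U" if "i \<in> I" "i \<notin> J" for i using g(2) that by auto
      show "i = j"
      proof (cases "i \<in> J"; cases "j \<in> J")
        assume "i \<in> J" "j \<in> J"
        then show ?thesis using f(1) ij(3) by (auto dest: inj_onD)
      next
        assume "i \<notin> J" "j \<notin> J"
        then show ?thesis using g(1) ij by (auto dest: inj_onD)
      next
        assume "i \<in> J" "j \<notin> J"
        then show ?thesis using fU[of i] gU[of j] ij by auto
      next
        assume "i \<notin> J" "j \<in> J"
        then show ?thesis using fU[of j] gU[of i] ij by auto
      qed
    qed
    moreover have "\<forall>i\<in>I. ?h i \<in> A i" using f(2) g(2) by auto
    ultimately show ?thesis by (intro exI[of _ ?h]) (rule conjI)
  next
    case False
    show ?thesis
    proof (cases "I = {}")
      case False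
      then obtain i where i: "i \<in> I" by blast
      have "card {i} \<le> card (\<Union>j\<in>{i}. A j)" by (rule hall[rule_format]) (use i in simp)
      then have "A i \<noteq> {}" by auto
      then obtain a where a: "a \<in> A i" by blast
      have "\<exists>g. inj_on g (I - {i}) \<and> (\<forall>j\<in>I - {i}. g j \<in> A j - {a})"
      proof (rule less.hyps)
        show "card (I - {i}) < card I" using i fin by (intro psubset_card_mono) auto
        show "finite (I - {i})" "\<forall>j\<in>I - {i}. finite (A j - {a})" using fin finA by auto
        show "\<forall>L\<subseteq>I - {i}. card L \<le> card (\<Union>j\<in>L. A j - {a})"
        proof (intro allI impI)
          fix L assume L: "L \<subseteq> I - {i}"
          show "card L \<le> card (\<Union>j\<in>L. A j - {a})"
          proof (cases "L = {}")
            case nonempty: False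
            have LI: "L \<subset> I" using L i by blast
            have "card (\<Union>j\<in>L. A j) \<noteq> card L" using \<open>\<not> (\<exists>J. _)\<close> nonempty LI by blast
            moreover have "card L \<le> card (\<Union>j\<in>L. A j)" by (rule hall[rule_format]) (use LI in blast)
            ultimately have "card L + 1 \<le> card (\<Union>j\<in>L. A j)" by simp
            also have "\<dots> \<le> card ((\<Union>j\<in>L. A j - {a}) \<union> {a})"
            proof (rule card_mono)
              have "(\<Union>j\<in>L. A j - {a}) \<subseteq> (\<Union>j\<in>L. A j)" by blast
              then show "finite ((\<Union>j\<in>L. A j - {a}) \<union> {a})" using finU[of L] LI finite_subset by auto
            qed blast
            also have "\<dots> \<le> card (\<Union>j\<in>L. A j - {a}) + card {a}" by (rule card_Un_le)
            finally show ?thesis by simp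
          qed simp
        qed
      qed
      then obtain g where g: "inj_on g (I - {i})" "\<forall>j\<in>I - {i}. g j \<in> A j - {a}" by (elim exE conjE)
      have ga: "g j \<noteq> a" if "j \<in> I" "j \<noteq> i" for j using g(2) that by blast
      have "inj_on (g(i := a)) I"
      proof (rule inj_onI)
        fix p q assume pq: "p \<in> I" "q \<in> I" "(g(i := a)) p = (g(i := a)) q"
        then show "p = q"
          using ga[of p] ga[of q] inj_onD[OF g(1), of p q] by (auto split: if_splits)
      qed
      moreover have "\<forall>j\<in>I. (g(i := a)) j \<in> A j" using g(2) a by simp
      ultimately show ?thesis by (intro exI[of _ "g(i := a)"]) (rule conjI)
    qed simp
  qed
qed

section \<open>Powers, symmetric sets and maximal separated sets\<close>

primrec setpow :: "('g, 'm) monoid_scheme \<Rightarrow> 'g set \<Rightarrow> nat \<Rightarrow> 'g set" where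
  "setpow G T 0 = {\<one>\<^bsub>G\<^esub>}"
| "setpow G T (Suc m) = setpow G T m <#>\<^bsub>G\<^esub> T"

context group begin

lemma setpow_closed: "T \<subseteq> carrier G \<Longrightarrow> setpow G T m \<subseteq> carrier G"
  by (induction m) (simp_all add: set_mult_closed)

lemma finite_setpow: "finite T \<Longrightarrow> finite (setpow G T m)"
  by (induction m) (simp_all add: finite_set_mult)

lemma card_setpow_le: "finite T \<Longrightarrow> card (setpow G T m) \<le> card T ^ m"
proof (induction m)
  case (Suc m)
  then have "card (setpow G T m <#> T) \<le> card T ^ m * card T"
    by (intro card_set_mult_bound finite_setpow) simp_all
  then show ?case by (simp add: mult.commute)
qed simp

lemma set_mult_one_right: "S \<subseteq> carrier G \<Longrightarrow> \<one> \<in> T \<Longrightarrow> S \<subseteq> S <#> T"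
  using mem_set_mult[of _ S \<one> T G] by (auto simp: subset_iff)

lemma setpow_mono:
  assumes "T \<subseteq> carrier G" "\<one> \<in> T" "i \<le> j"
  shows "setpow G T i \<subseteq> setpow G T j"
  using assms(3)
  by (induction rule: dec_induct) (use set_mult_one_right[OF setpow_closed[OF assms(1)] assms(2)] in auto)

definition sym_hull :: "'a set \<Rightarrow> 'a set" where
  "sym_hull D = insert \<one> (D \<union> iv G D)"

lemma sym_hull:
  assumes "finite D" "D \<subseteq> carrier G"
  shows "finite (sym_hull D)" "sym_hull D \<subseteq> carrier G" "\<one> \<in> sym_hull D" "D \<subseteq> sym_hull D"
    "\<And>k. k \<in> sym_hull D \<Longrightarrow> inv k \<in> sym_hull D" "card (sym_hull D) \<le> 2 * (card D + 1)"
proof -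
  show "finite (sym_hull D)" "sym_hull D \<subseteq> carrier G" "\<one> \<in> sym_hull D" "D \<subseteq> sym_hull D"
    using assms iv_closed[OF assms(2)] by (auto simp: sym_hull_def finite_iv)
  show "inv k \<in> sym_hull D" if "k \<in> sym_hull D" for k
    using that assms(2) by (auto simp: sym_hull_def iv_def subset_iff)
  have "card (sym_hull D) \<le> Suc (card (D \<union> iv G D))"
    unfolding sym_hull_def by (rule card_insert_le_m1) simp_all
  also have "\<dots> \<le> Suc (card D + card D)"
    using card_Un_le[of D "iv G D"] card_iv_le[OF assms(1), of G] by simp
  finally show "card (sym_hull D) \<le> 2 * (card D + 1)" by simp
qed

text \<open>A push that cancels a letter runs along an edge backwards, so for symmetric
  \<open>W\<close> only prepended letters need checking.\<close>

lemma tree_embeddingI: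
  assumes u: "\<And>w. w \<in> word_ball k n \<Longrightarrow> u w \<in> carrier G"
    and sep: "\<And>v w. v \<in> word_ball k n \<Longrightarrow> w \<in> word_ball k n \<Longrightarrow> v \<noteq> w \<Longrightarrow> inv (u v) \<otimes> u w \<notin> D"
    and W: "\<And>x. x \<in> W \<Longrightarrow> inv x \<in> W"
    and edge: "\<And>l w. l # w \<in> word_ball k n \<Longrightarrow> w \<in> word_ball k n \<Longrightarrow> inv (u w) \<otimes> u (l # w) \<in> W"
  shows "tree_embedding G k D W n u"
proof -
  have "inv (u w) \<otimes> u (push l w) \<in> W"
    if w: "w \<in> word_ball k n" and p: "push l w \<in> word_ball k n" for l w
  proof (cases "\<exists>v. w = letter_inv l # v")
    case True
    then obtain v where v: "w = letter_inv l # v" by blast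
    then have pv: "push l w = v" by simp
    have "inv (inv (u v) \<otimes> u w) \<in> W" using w p unfolding pv by (intro W) (auto simp: v intro: edge)
    then show ?thesis using u[OF w] u[OF p] unfolding pv by (simp add: inv_mult_group)
  next
    case False
    then have "push l w = l # w" by (cases w) auto
    then show ?thesis using edge w p by simp
  qed
  then show ?thesis using u sep unfolding tree_embedding_def by blast
qed

text \<open>A point of \<open>Y\<close> that is not within \<open>D\<close> of a maximal separated
  set could be added to it.\<close>

lemma maximal_separated:
  assumes Y: "finite Y" "Y \<subseteq> carrier G" "\<one> \<in> Y" and D: "\<one> \<in> D" "\<And>k. k \<in> D \<Longrightarrow> inv k \<in> D"
  shows "\<exists>V\<subseteq>Y. \<one> \<in> V \<and> (\<forall>v\<in>V. \<forall>w\<in>V. v \<noteq> w \<longrightarrow> inv v \<otimes> w \<notin> D) \<and> (\<forall>y\<in>Y. \<exists>v\<in>V. inv v \<otimes> y \<in> D)"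
proof -
  define \<V> where "\<V> = {V. V \<subseteq> Y \<and> \<one> \<in> V \<and> (\<forall>v\<in>V. \<forall>w\<in>V. v \<noteq> w \<longrightarrow> inv v \<otimes> w \<notin> D)}"
  have "\<V> \<subseteq> Pow Y" by (auto simp: \<V>_def)
  then have "finite \<V>" using Y(1) by (rule finite_subset[OF _ finite_Pow_iff[THEN iffD2]])
  moreover have "{\<one>} \<in> \<V>" using Y by (simp add: \<V>_def)
  ultimately obtain V where V: "V \<in> \<V>" "\<And>U. U \<in> \<V> \<Longrightarrow> V \<subseteq> U \<Longrightarrow> V = U"
    using finite_has_maximal[of \<V>] by blast
  have "\<exists>v\<in>V. inv v \<otimes> y \<in> D" if y: "y \<in> Y" for y
  proof (rule ccontr)
    assume no: "\<not> ?thesis"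
    have yc: "y \<in> carrier G" using y Y by blast
    have "y \<notin> V" using no D(1) yc by auto
    have sep: "inv v \<otimes> y \<notin> D \<and> inv y \<otimes> v \<notin> D" if v: "v \<in> V" for v
    proof -
      have vc: "v \<in> carrier G" using v V(1) Y(2) by (auto simp: \<V>_def)
      have "inv (inv y \<otimes> v) = inv v \<otimes> y" using vc yc by (simp add: inv_mult_group)
      then show ?thesis using no v D(2)[of "inv y \<otimes> v"] by auto
    qed
    have "insert y V \<in> \<V>" using V(1) y sep by (auto simp: \<V>_def)
    then have "V = insert y V" by (rule V(2)) blast
    then show False using \<open>y \<notin> V\<close> by blast
  qed
  then show ?thesis using V(1) unfolding \<V>_def by blast
qed

end

text \<open>The bound on \<open>W\<close> lets the links fit into the exponentially many states. One
  \<open>W\<close> must serve all radii, because the automorphisms to be told apart may depend on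
  arbitrarily distant symbols.\<close>

definition poly_trees :: "('g, 'm) monoid_scheme \<Rightarrow> nat \<Rightarrow> bool" where
  "poly_trees G k \<longleftrightarrow> (\<exists>a c. \<forall>D. finite D \<longrightarrow> D \<subseteq> carrier G \<longrightarrow>
     (\<exists>W. finite W \<and> W \<subseteq> carrier G \<and> card W \<le> a * (card D + 1) ^ c \<and>
       (\<forall>n. \<exists>u. tree_embedding G k (insert \<one>\<^bsub>G\<^esub> D) W n u)))"

lemma card_letters: "finite (letters k)" "card (letters k) = 2 * k"
  by (simp_all add: letters_def card_cartesian_product)

context group begin

text \<open>Hall's condition for disjoint sets of \<open>2 * k\<close> children in a maximal \<open>D\<close>-separated set is the expansion
  of \<open>P\<close> divided by the number \<open>card D\<close> of points that share a representative.\<close>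

lemma expanding_trees:
  assumes T: "finite T" "T \<subseteq> carrier G" "\<one> \<in> T"
    and D: "finite D" "D \<subseteq> carrier G" "\<one> \<in> D" "\<And>k. k \<in> D \<Longrightarrow> inv k \<in> D"
    and grow: "\<And>P. finite P \<Longrightarrow> P \<noteq> {} \<Longrightarrow> P \<subseteq> carrier G \<Longrightarrow> (2 * k + 1) * card D * card P \<le> card (P <#> T)"
  shows "\<exists>u. tree_embedding G k D (sym_hull (T <#> D)) n u"
proof -
  define W where "W = T <#> D"
  have W: "finite W" "W \<subseteq> carrier G" "\<one> \<in> W"
  proof -
    have "\<one> \<otimes> \<one> \<in> W" unfolding W_def by (intro mem_set_mult T D)
    then show "\<one> \<in> W" by simp
  qed (simp_all add: W_def finite_set_mult T D set_mult_closed)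
  \<comment> \<open>Parents are taken from the \<open>n\<close>-th power of \<open>W\<close>; the
    next power contains the points \<open>P <#> T\<close> for which representatives are
    needed.\<close>
  define Y where "Y = setpow G W (Suc n)"
  have Y: "finite Y" "Y \<subseteq> carrier G" "\<one> \<in> Y"
    unfolding Y_def using finite_setpow[OF W(1)] setpow_closed[OF W(2)] setpow_mono[OF W(2,3), of 0 "Suc n"]
    by - (blast, blast, simp)
  obtain V where V: "V \<subseteq> Y" "\<one> \<in> V" "\<forall>v\<in>V. \<forall>w\<in>V. v \<noteq> w \<longrightarrow> inv v \<otimes> w \<notin> D" "\<forall>y\<in>Y. \<exists>v\<in>V. inv v \<otimes> y \<in> D"
    using maximal_separated[OF Y D(3,4)] by blast
  have Vc: "v \<in> carrier G" if "v \<in> V" for v using that V(1) Y(2) by blast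
  have finV: "finite V" using V(1) Y(1) by (rule finite_subset)
  define Vn where "Vn = V \<inter> setpow G W n"
  \<comment> \<open>The root \<open>\<one>\<close> is not allowed as a child: otherwise the empty
    word could share its vertex with a longer one.\<close>
  define N where "N v = {w \<in> V - {\<one>}. inv v \<otimes> w \<in> W}" for v
  define I where "I = Vn \<times> letters k"
  have finI: "finite I" unfolding I_def Vn_def using finV card_letters(1) by simp
  have "\<exists>f. inj_on f I \<and> (\<forall>i\<in>I. f i \<in> N (fst i))"
  proof (rule hall[OF finI])
    show "\<forall>i\<in>I. finite (N (fst i))" unfolding N_def using finV by simp
    show "\<forall>J\<subseteq>I. card J \<le> card (\<Union>i\<in>J. N (fst i))"
    proof (intro allI impI)
      fix J assume J: "J \<subseteq> I"
      show "card J \<le> card (\<Union>i\<in>J. N (fst i))"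
      proof (cases "J = {}")
        case nonempty: False
        have finJ: "finite J" using J finI by (rule finite_subset)
        define P where "P = fst ` J"
        have P: "finite P" "P \<noteq> {}" "P \<subseteq> Vn" using finJ nonempty J by (auto simp: P_def I_def)
        have Pc: "P \<subseteq> carrier G" using P(3) Vc by (auto simp: Vn_def)
        define Q where "Q = {w \<in> V. \<exists>p\<in>P. inv p \<otimes> w \<in> W}"
        have finQ: "finite Q" using finV by (simp add: Q_def)
        \<comment> \<open>By maximality each point of \<open>P <#> T\<close> has a representative in
          \<open>V\<close> within \<open>D\<close>, and one representative serves at most
          \<open>card D\<close> points.\<close>
        have "P <#> T \<subseteq> Q <#> D"
        proof
          fix y assume "y \<in> P <#> T"
          then obtain p t where pt: "p \<in> P" "t \<in> T" "y = p \<otimes> t" by (auto simp: set_mult_def)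
          have c: "p \<in> carrier G" "t \<in> carrier G" using pt Pc T(2) by auto
          have "t \<otimes> \<one> \<in> W" unfolding W_def using pt D(3) by (intro mem_set_mult)
          then have "p \<otimes> t \<in> setpow G W n <#> W" using pt P(3) c by (intro mem_set_mult) (auto simp: Vn_def)
          then have "y \<in> Y" by (simp add: Y_def pt(3))
          then obtain v where v: "v \<in> V" "inv v \<otimes> y \<in> D" using V(4) by blast
          have "t \<otimes> inv (inv v \<otimes> y) \<in> W" unfolding W_def using pt(2) D(4)[OF v(2)] by (rule mem_set_mult)
          moreover have "t \<otimes> inv (inv v \<otimes> y) = inv p \<otimes> v"
            using c Vc[OF v(1)] by (simp add: pt(3) inv_mult_group m_assoc)
          ultimately have "v \<in> Q" using v(1) pt(1) by (auto simp: Q_def)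
          then have "v \<otimes> (inv v \<otimes> y) \<in> Q <#> D" using v(2) by (rule mem_set_mult)
          then show "y \<in> Q <#> D" using Vc[OF v(1)] c pt(3) by simp
        qed
        then have QD: "card (P <#> T) \<le> card (Q <#> D)"
          by (rule card_mono[rotated]) (rule finite_set_mult[OF finQ D(1)])
        have "(2 * k + 1) * card P * card D = (2 * k + 1) * card D * card P" by (simp only: mult_ac)
        also have "\<dots> \<le> card (P <#> T)" by (rule grow[OF P(1,2) Pc])
        also note QD
        also have "card (Q <#> D) \<le> card Q * card D" by (rule card_set_mult_le[OF finQ D(1)])
        finally have "(2 * k + 1) * card P * card D \<le> card Q * card D" .
        moreover have "0 < card D" using D by (auto simp: card_gt_0_iff)
        ultimately have Q: "(2 * k + 1) * card P \<le> card Q" by (simp only: mult_le_cancel2)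
        \<comment> \<open>In the factor \<open>2 * k + 1\<close> the summand \<open>2 * k\<close>
          pays for the children of each point of \<open>P\<close>, and the rest for the deleted
          root.\<close>
        have "(\<Union>i\<in>J. N (fst i)) = Q - {\<one>}" by (auto simp: N_def Q_def P_def)
        moreover have "card Q \<le> card (Q - {\<one>}) + 1"
          by (metis Suc_eq_plus1 card.insert_remove card_Diff1_le card_Suc_Diff1 card_Diff_singleton_if diff_le_self finQ le_Suc_eq order_refl)
        moreover have "0 < card P" using P by (simp add: card_gt_0_iff)
        ultimately have "card P * (2 * k) \<le> card (\<Union>i\<in>J. N (fst i))"
          using Q by (simp add: mult.commute[of "card P"])
        moreover have "card J \<le> card (P \<times> letters k)"
        proof (rule card_mono)
          show "finite (P \<times> letters k)" using P(1) card_letters(1) by simp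
          show "J \<subseteq> P \<times> letters k" using J by (force simp: P_def I_def)
        qed
        ultimately show ?thesis by (simp add: card_cartesian_product card_letters)
      qed simp
    qed
  qed
  then obtain f where f: "inj_on f I" "\<forall>i\<in>I. f i \<in> N (fst i)" by (elim exE conjE)
  \<comment> \<open>This is injective on all words of length at most \<open>n\<close> in the
    letters, reduced or not; the ball consists of the reduced ones.\<close>
  define u where "u w = foldr (\<lambda>l v. f (v, l)) w \<one>" for w
  have u: "u [] = \<one>" "u (l # w) = f (u w, l)" for l w by (simp_all add: u_def)
  have step: "(u w, l) \<in> I \<and> u (l # w) \<in> V - {\<one>} \<and> inv (u w) \<otimes> u (l # w) \<in> W"
    if w: "u w \<in> V \<inter> setpow G W (length w)" "length w \<le> n" and l: "l \<in> letters k" for l w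
  proof -
    have i: "(u w, l) \<in> I"
      using w l setpow_mono[OF W(2,3) w(2)] by (auto simp: I_def Vn_def)
    then show ?thesis using bspec[OF f(2) i] by (simp add: N_def u)
  qed
  have uV: "u w \<in> V \<inter> setpow G W (length w)" if "set w \<subseteq> letters k" "length w \<le> n" for w
    using that
  proof (induction w)
    case Nil
    then show ?case using V(2) by (simp add: u)
  next
    case (Cons l w)
    have IH: "u w \<in> V \<inter> setpow G W (length w)" using Cons by simp
    have st: "u (l # w) \<in> V" "inv (u w) \<otimes> u (l # w) \<in> W"
      using step[OF IH, of l] Cons.prems by simp_all
    have "u w \<otimes> (inv (u w) \<otimes> u (l # w)) \<in> setpow G W (length w) <#> W"
      using IH st(2) by (intro mem_set_mult) simp_all
    then show ?case using st(1) Vc[of "u w"] Vc[OF st(1)] IH by simp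
  qed
  have uI: "(u v, l) \<in> I \<and> u (l # v) \<in> V - {\<one>} \<and> inv (u v) \<otimes> u (l # v) \<in> W"
    if "set (l # v) \<subseteq> letters k" "length (l # v) \<le> n" for l v
    using that by (intro step uV) simp_all
  have inj: "v = w" if "set v \<subseteq> letters k" "length v \<le> n" "set w \<subseteq> letters k" "length w \<le> n" "u v = u w" for v w
    using that
  proof (induction v arbitrary: w)
    case Nil
    then show ?case using uI u(1) by (cases w) auto
  next
    case (Cons l v)
    have "u (l # v) \<noteq> \<one>" using uI[of l v] Cons.prems by blast
    then obtain l' w' where w: "w = l' # w'" using Cons.prems(5) u(1) by (cases w) auto
    have "(u v, l) \<in> I" "(u w', l') \<in> I" using uI Cons.prems(1-4) unfolding w by blast+
    then have "(u v, l) = (u w', l')" using inj_onD[OF f(1), of "(u v, l)" "(u w', l')"] Cons.prems(5) by (simp add: w u)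
    then show ?case using Cons.IH[of w'] Cons.prems w by simp
  qed
  have ball: "set w \<subseteq> letters k" "length w \<le> n" if "w \<in> word_ball k n" for w
    using that by (auto simp: word_ball_def carrier_free_group)
  have "tree_embedding G k D (sym_hull W) n u"
  proof (rule tree_embeddingI)
    show "u w \<in> carrier G" if "w \<in> word_ball k n" for w using uV[OF ball[OF that]] Vc by blast
    show "inv (u v) \<otimes> u w \<notin> D" if "v \<in> word_ball k n" "w \<in> word_ball k n" "v \<noteq> w" for v w
    proof -
      have "u v \<noteq> u w" using inj[OF ball[OF that(1)] ball[OF that(2)]] that(3) by blast
      then show ?thesis using V(3) uV[OF ball[OF that(1)]] uV[OF ball[OF that(2)]] by blast
    qed
    show "inv x \<in> sym_hull W" if "x \<in> sym_hull W" for x using sym_hull(5)[OF W(1,2) that] .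
    show "inv (u w) \<otimes> u (l # w) \<in> sym_hull W" if "l # w \<in> word_ball k n" for l w
      using uI[OF ball[OF that]] sym_hull(4)[OF W(1,2)] by blast
  qed
  then show ?thesis unfolding W_def by blast
qed

lemma tree_embedding_mono:
  "D \<subseteq> D' \<Longrightarrow> tree_embedding G k D' W n u \<Longrightarrow> tree_embedding G k D W n u"
  unfolding tree_embedding_def by blast

text \<open>Iterating the expansion \<open>m\<close> times multiplies sizes by at least
  \<open>(1 + \<delta>) ^ m\<close>. For the required factor, proportional to the size of the
  separation set, \<open>m\<close> may be logarithmic in it, so the power
  \<open>setpow G T m\<close> has polynomial size.\<close>

lemma nonamenable_trees:
  assumes "nonamenable G"
  shows "poly_trees G k"
proof -
  obtain T0 and \<delta> :: real where T0: "finite T0" "T0 \<subseteq> carrier G" and \<delta>: "\<delta> > 0"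
    and exp: "\<forall>F. finite F \<and> F \<noteq> {} \<and> F \<subseteq> carrier G \<longrightarrow> real (card ((F <#> T0) - F)) > \<delta> * real (card F)"
    using assms unfolding nonamenable_def by (elim exE conjE)
  define T where "T = insert \<one> T0"
  have T: "finite T" "T \<subseteq> carrier G" "\<one> \<in> T" using T0 by (auto simp: T_def)
  have grow1: "(1 + \<delta>) * card P \<le> card (P <#> T)" if P: "finite P" "P \<noteq> {}" "P \<subseteq> carrier G" for P
  proof -
    have "P \<union> ((P <#> T0) - P) \<subseteq> P <#> T"
      using set_mult_one_right[OF P(3) T(3)] by (auto simp: T_def set_mult_def)
    then have "card (P \<union> ((P <#> T0) - P)) \<le> card (P <#> T)"
      by (rule card_mono[OF finite_set_mult[OF P(1) T(1)]])
    moreover have "card (P \<union> ((P <#> T0) - P)) = card P + card ((P <#> T0) - P)"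
      using P(1) finite_set_mult[OF P(1) T0(1), of G] by (intro card_Un_disjoint) auto
    moreover have "real (card ((P <#> T0) - P)) > \<delta> * real (card P)" using exp P by blast
    ultimately show ?thesis by (simp add: algebra_simps)
  qed
  have grow: "(1 + \<delta>) ^ m * card P \<le> card (P <#> setpow G T m)"
    if P: "finite P" "P \<noteq> {}" "P \<subseteq> carrier G" for P m
  proof (induction m)
    case 0
    have "P <#> {\<one>} = P" using P(3) by (force simp: set_mult_def)
    then show ?case by simp
  next
    case (Suc m)
    let ?Q = "P <#> setpow G T m"
    have "?Q \<noteq> {}"
      using P(2) setpow_mono[OF T(2,3), of 0 m] by (auto simp: set_mult_def)
    moreover have "finite ?Q" "?Q \<subseteq> carrier G"
      using P finite_setpow[OF T(1)] setpow_closed[OF T(2)] by (simp_all add: finite_set_mult set_mult_closed)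
    ultimately have "(1 + \<delta>) * card ?Q \<le> card (?Q <#> T)" by (intro grow1)
    moreover have "(1 + \<delta>) * ((1 + \<delta>) ^ m * card P) \<le> (1 + \<delta>) * card ?Q"
      using Suc \<delta> by (intro mult_left_mono) simp_all
    moreover have "?Q <#> T = P <#> setpow G T (Suc m)"
      using P(3) setpow_closed[OF T(2)] T(2) by (simp add: set_mult_assoc)
    ultimately show ?case by (simp add: mult.assoc)
  qed
  \<comment> \<open>\<open>q\<close> bounds \<open>card T ^ m\<close> by the \<open>q\<close>-th
    power of \<open>(1 + \<delta>) ^ m\<close>; \<open>r\<close> bounds the overshoot in the last
    iteration.\<close>
  obtain q where q: "real (card T) < (1 + \<delta>) ^ q" using real_arch_pow[of "1 + \<delta>" "real (card T)"] \<delta> by auto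
  obtain r :: nat where r: "1 + \<delta> \<le> real r" using real_arch_simple by blast
  have r1: "1 \<le> r" using r \<delta> by (simp add: Suc_le_eq)
  define b where "b = ((2 * k + 1) * r * 2) ^ q"
  show ?thesis
    unfolding poly_trees_def
  proof (rule exI[of _ "2 * (2 * b + 1)"], rule exI[of _ "q + 1"], intro allI impI)
    fix D assume D: "finite D" "D \<subseteq> carrier G"
    let ?x = "card D + 1"
    define D' where "D' = sym_hull D"
    note D' = sym_hull[OF D, folded D'_def]
    have d: "1 \<le> card D'" using D'(1,3) by (auto simp: Suc_le_eq card_gt_0_iff)
    define z where "z = (2 * k + 1) * card D'"
    have "\<exists>m. real z \<le> (1 + \<delta>) ^ m" using real_arch_pow[of "1 + \<delta>" "real z"] \<delta> by (auto intro: less_imp_le)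
    \<comment> \<open>Minimality of \<open>m\<close> keeps \<open>(1 + \<delta>) ^ m\<close> within
      the factor \<open>r\<close> of \<open>z\<close>.\<close>
    define m where "m = (LEAST m. real z \<le> (1 + \<delta>) ^ m)"
    have m: "real z \<le> (1 + \<delta>) ^ m"
      unfolding m_def by (rule LeastI_ex) fact
    have mr: "(1 + \<delta>) ^ m \<le> real z * real r"
    proof (cases m)
      case 0
      have "1 * 1 \<le> z * r" using r1 d by (intro mult_mono) (simp_all add: z_def)
      then have "1 \<le> real z * real r" by (metis mult_1 of_nat_1 of_nat_le_iff of_nat_mult)
      then show ?thesis using 0 by simp
    next
      case (Suc m')
      then have "\<not> real z \<le> (1 + \<delta>) ^ m'" unfolding m_def by (intro not_less_Least) (simp flip: m_def)
      then have "(1 + \<delta>) ^ m' * (1 + \<delta>) \<le> real z * real r" using r \<delta> by (intro mult_mono) simp_all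
      then show ?thesis using Suc by (simp add: mult.commute)
    qed
    have "real (card (setpow G T m)) \<le> real (card T ^ m)" using card_setpow_le[OF T(1)] by (simp only: of_nat_le_iff)
    also have "\<dots> = real (card T) ^ m" by simp
    also have "\<dots> \<le> ((1 + \<delta>) ^ q) ^ m" using q by (intro power_mono) simp_all
    also have "\<dots> = ((1 + \<delta>) ^ m) ^ q" by (simp add: power_mult[symmetric] mult.commute)
    also have "\<dots> \<le> (real z * real r) ^ q" using mr \<delta> by (intro power_mono) simp_all
    also have "\<dots> = real ((z * r) ^ q)" by simp
    finally have cT: "card (setpow G T m) \<le> (z * r) ^ q" by (simp only: of_nat_le_iff)
    define S where "S = setpow G T m"
    have S: "finite S" "S \<subseteq> carrier G" "\<one> \<in> S"
      unfolding S_def using finite_setpow[OF T(1)] setpow_closed[OF T(2)] setpow_mono[OF T(2,3), of 0 m]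
      by - (blast, blast, simp)
    have WW: "finite (S <#> D')" "S <#> D' \<subseteq> carrier G"
      using S D' by (simp_all add: finite_set_mult set_mult_closed)
    have trees: "\<exists>u. tree_embedding G k D' (sym_hull (S <#> D')) n u" for n
    proof (rule expanding_trees[OF S D'(1-3) D'(5)])
      fix P assume P: "finite P" "P \<noteq> {}" "P \<subseteq> carrier G"
      have "real (z * card P) \<le> (1 + \<delta>) ^ m * card P" using m by (simp add: mult_right_mono)
      also have "\<dots> \<le> card (P <#> S)" using grow[OF P] by (simp add: S_def)
      finally show "(2 * k + 1) * card D' * card P \<le> card (P <#> S)"
        unfolding z_def by (simp only: of_nat_le_iff)
    qed
    have "z * r = (2 * k + 1) * r * card D'" by (simp only: z_def mult_ac)
    also have "\<dots> \<le> (2 * k + 1) * r * (2 * ?x)" by (rule mult_left_mono[OF D'(6)]) simp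
    also have "\<dots> = (2 * k + 1) * r * 2 * ?x" by (simp only: mult_ac)
    finally have "(z * r) ^ q \<le> ((2 * k + 1) * r * 2 * ?x) ^ q" by (rule power_mono) simp
    also have "\<dots> = b * ?x ^ q" by (simp only: power_mult_distrib b_def)
    finally have "card S \<le> b * ?x ^ q" using cT by (simp add: S_def)
    then have "card (S <#> D') \<le> b * ?x ^ q * (2 * ?x)" by (intro card_set_mult_bound S D')
    then have "2 * (card (S <#> D') + 1) \<le> 2 * (b * ?x ^ q * (2 * ?x) + ?x ^ (q + 1))"
      by (intro mult_left_mono add_mono one_le_power) simp_all
    also have "\<dots> = 2 * (2 * b + 1) * ?x ^ (q + 1)" by (simp add: algebra_simps)
    finally have "2 * (card (S <#> D') + 1) \<le> 2 * (2 * b + 1) * ?x ^ (q + 1)" .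
    with sym_hull(6)[OF WW] have "card (sym_hull (S <#> D')) \<le> 2 * (2 * b + 1) * ?x ^ (q + 1)"
      by (rule order_trans)
    moreover have "\<exists>u. tree_embedding G k (insert \<one> D) (sym_hull (S <#> D')) n u" for n
      using trees[of n] tree_embedding_mono[of "insert \<one> D" D'] D'(3,4) by blast
    ultimately show "\<exists>W. finite W \<and> W \<subseteq> carrier G \<and> card W \<le> 2 * (2 * b + 1) * ?x ^ (q + 1) \<and>
        (\<forall>n. \<exists>u. tree_embedding G k (insert \<one> D) W n u)"
      using sym_hull(1,2)[OF WW] by blast
  qed
qed

section \<open>Loop-erased paths\<close>

definition lprod :: "'a list \<Rightarrow> 'a" where
  "lprod xs = foldr (\<otimes>) xs \<one>"

lemma lprod_simps [simp]: "lprod [] = \<one>" "lprod (x # xs) = x \<otimes> lprod xs"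
  by (simp_all add: lprod_def)

lemma lprod_closed: "set xs \<subseteq> carrier G \<Longrightarrow> lprod xs \<in> carrier G"
  by (induction xs) simp_all

lemma lprod_append:
  "set xs \<subseteq> carrier G \<Longrightarrow> set ys \<subseteq> carrier G \<Longrightarrow> lprod (xs @ ys) = lprod xs \<otimes> lprod ys"
  by (induction xs) (simp_all add: lprod_closed m_assoc)

lemma generate_lprod:
  assumes "S \<subseteq> carrier G" "h \<in> generate G S"
  shows "\<exists>xs. set xs \<subseteq> S \<union> iv G S \<and> h = lprod xs"
  using assms(2)
proof (induction rule: generate.induct)
  case one
  then show ?case by (intro exI[of _ "[]"]) simp
next
  case (incl h)
  then show ?case using assms(1) by (intro exI[of _ "[h]"]) auto
next
  case (inv h)
  then show ?case using assms(1) by (intro exI[of _ "[inv h]"]) (auto simp: iv_def)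
next
  case (eng g h)
  then obtain xs ys where xy: "set xs \<subseteq> S \<union> iv G S" "g = lprod xs" "set ys \<subseteq> S \<union> iv G S" "h = lprod ys"
    by (elim exE conjE)
  have "S \<union> iv G S \<subseteq> carrier G" using assms(1) iv_closed by simp
  with xy have "set xs \<subseteq> carrier G" "set ys \<subseteq> carrier G" by blast+
  then show ?case using xy by (intro exI[of _ "xs @ ys"]) (simp add: lprod_append)
qed

text \<open>The endpoints for which loop erasure is not guaranteed to give \<open>n\<close> steps:
  those in \<open>D\<close>, and those reached from a vertex in \<open>D <#> S\<close> by a
  remainder that is not guaranteed \<open>n - 1\<close> steps. For finite \<open>D\<close> and
  \<open>S\<close> the set is finite.\<close>

primrec chain_set :: "'a set \<Rightarrow> 'a set \<Rightarrow> nat \<Rightarrow> 'a set" where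
  "chain_set D S 0 = {}"
| "chain_set D S (Suc n) = D \<union> (D <#> S <#> chain_set D S n)"

text \<open>Loop erasure: the next vertex of the chain follows the last visit of the path to the
  \<open>D\<close>-neighbourhood of the present one.\<close>

lemma separated_chain:
  assumes S: "S \<subseteq> carrier G" and D: "\<one> \<in> D" "D \<subseteq> carrier G"
  shows "set xs \<subseteq> S \<Longrightarrow> lprod xs \<notin> chain_set D S n \<Longrightarrow>
    \<exists>h. h 0 = \<one> \<and> (\<forall>i\<le>n. \<exists>m. h i = lprod (take m xs)) \<and>
      (\<forall>i j. i < j \<and> j \<le> n \<longrightarrow> inv (h i) \<otimes> h j \<notin> D) \<and> (\<forall>i<n. inv (h i) \<otimes> h (Suc i) \<in> D <#> S)"
proof (induction n arbitrary: xs)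
  case 0
  then show ?case by (intro exI[of _ "\<lambda>_. \<one>"]) (auto intro: exI[of _ 0])
next
  case (Suc n)
  have xs: "set xs \<subseteq> carrier G" using Suc.prems(1) S by blast
  have last: "lprod xs \<notin> D" using Suc.prems(2) by simp
  \<comment> \<open>The times at which the path is in \<open>D\<close>. After the last of them the
    path never returns, and its next vertex is the second vertex of the chain.\<close>
  define I where "I = {i. i \<le> length xs \<and> lprod (take i xs) \<in> D}"
  have finI: "finite I" by (simp add: I_def)
  have "0 \<in> I" using D by (simp add: I_def)
  then have "Max I \<in> I" using finI by (intro Max_in) auto
  define i where "i = Max I"
  have iI: "i \<le> length xs" "lprod (take i xs) \<in> D" using \<open>Max I \<in> I\<close> by (auto simp: I_def i_def)
  have "i \<noteq> length xs" using iI(2) last by auto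
  then have i: "i < length xs" using iI(1) by simp
  have later: "lprod (take m xs) \<notin> D" if "m > i" for m
  proof (cases "m \<le> length xs")
    case True
    have "m \<notin> I" using Max_ge[OF finI, of m] that by (auto simp: i_def)
    then show ?thesis using True by (simp add: I_def)
  qed (use last in simp)
  define ys where "ys = drop (Suc i) xs"
  define d where "d = lprod (take i xs) \<otimes> xs ! i"
  have c: "set (take i xs) \<subseteq> carrier G" "xs ! i \<in> carrier G" "set ys \<subseteq> carrier G"
    using xs i nth_mem[OF i] by (auto simp: ys_def dest: in_set_takeD in_set_dropD)
  have dc: "d \<in> carrier G" using c by (simp add: d_def lprod_closed)
  have dDS: "d \<in> D <#> S" unfolding d_def using iI(2) nth_mem[OF i] Suc.prems(1) by (intro mem_set_mult) auto
  have split: "lprod (take (Suc i + m) xs) = d \<otimes> lprod (take m ys)" for m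
  proof -
    have "take (Suc i + m) xs = take i xs @ [xs ! i] @ take m ys"
      using i by (simp add: take_add take_Suc_conv_app_nth ys_def del: add_Suc)
    moreover have "set (take m ys) \<subseteq> carrier G" using c(3) by (auto dest: in_set_takeD)
    ultimately show ?thesis using c by (simp add: lprod_append lprod_closed d_def m_assoc)
  qed
  have "lprod xs = d \<otimes> lprod ys" using split[of "length ys"] i by (simp add: ys_def)
  moreover have "d \<otimes> lprod ys \<in> D <#> S <#> chain_set D S n" if "lprod ys \<in> chain_set D S n"
    using dDS that by (rule mem_set_mult)
  ultimately have ys: "lprod ys \<notin> chain_set D S n" using Suc.prems(2) by auto
  have "set ys \<subseteq> S" using Suc.prems(1) by (auto simp: ys_def dest: in_set_dropD)
  from Suc.IH[OF this ys] obtain h where h: "h 0 = \<one>" "\<forall>i\<le>n. \<exists>m. h i = lprod (take m ys)"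
      "\<forall>i j. i < j \<and> j \<le> n \<longrightarrow> inv (h i) \<otimes> h j \<notin> D" "\<forall>i<n. inv (h i) \<otimes> h (Suc i) \<in> D <#> S"
    by (elim exE conjE)
  have hc: "h j \<in> carrier G" if j: "j \<le> n" for j
  proof -
    obtain m where "h j = lprod (take m ys)" using h(2) j by blast
    then show ?thesis using c(3) by (auto intro!: lprod_closed dest: in_set_takeD)
  qed
  define g where "g = case_nat \<one> (\<lambda>j. d \<otimes> h j)"
  have g: "g 0 = \<one>" "\<And>j. g (Suc j) = d \<otimes> h j" by (simp_all add: g_def)
  have quot: "inv (g (Suc a)) \<otimes> g (Suc b) = inv (h a) \<otimes> h b" if "a \<le> n" "b \<le> n" for a b
    using hc[OF that(1)] hc[OF that(2)] dc by (simp add: g inv_mult_group m_assoc)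
  have pref: "\<exists>m. g (Suc j) = lprod (take (Suc i + m) xs)" if j: "j \<le> n" for j
  proof -
    obtain m where "h j = lprod (take m ys)" using h(2) j by blast
    then show ?thesis using split[of m] by (intro exI[of _ m]) (simp add: g)
  qed
  show ?case
  proof (rule exI[of _ g], intro conjI allI impI)
    show "g 0 = \<one>" by (rule g)
    show "\<exists>m. g j = lprod (take m xs)" if "j \<le> Suc n" for j
      using that pref by (cases j) (auto simp: g intro: exI[of _ 0])
    show "inv (g a) \<otimes> g b \<notin> D" if ab: "a < b \<and> b \<le> Suc n" for a b
    proof -
      obtain b' where b: "b = Suc b'" "b' \<le> n" using ab by (cases b) auto
      show ?thesis
      proof (cases a)
        case 0
        obtain m where m: "g b = lprod (take (Suc i + m) xs)" using pref[OF b(2)] b(1) by blast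
        have "g b \<notin> D" unfolding m by (rule later) simp
        moreover have "g b \<in> carrier G" using hc[OF b(2)] dc by (simp add: b(1) g)
        ultimately show ?thesis using 0 by (simp add: g)
      next
        case (Suc a')
        then show ?thesis using quot[of a' b'] h(3) ab b by simp
      qed
    qed
    show "inv (g a) \<otimes> g (Suc a) \<in> D <#> S" if "a < Suc n" for a
    proof (cases a)
      case 0
      then show ?thesis using dDS h(1) dc by (simp add: g)
    next
      case (Suc a')
      then show ?thesis using quot[of a' "Suc a'"] h(4) that by simp
    qed
  qed
qed

end

lemma reduced_letters_1:
  assumes "reduced w" "set w \<subseteq> letters 1"
  shows "\<exists>b. w = replicate (length w) (0, b)"
  using assms
proof (induction w)
  case (Cons l w)
  obtain c where l: "l = (0, c)" using Cons.prems(2) by (auto simp: letters_def)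
  obtain b where b: "w = replicate (length w) (0, b)" using Cons reduced_ConsD by fastforce
  show ?case
  proof (cases w)
    case (Cons l' w')
    then have "l' = (0, b)" using b by (metis hd_replicate length_0_conv list.distinct(1) list.sel(1))
    moreover have "l' \<noteq> letter_inv l" using Cons.prems(1) Cons by (simp add: reduced_def)
    ultimately have "c = b" using l by (simp add: letter_inv_def)
    then show ?thesis using b l by (intro exI[of _ b]) simp
  qed (use l in \<open>auto intro: exI[of _ c]\<close>)
qed simp

text \<open>An infinite finitely generated subgroup is not contained in any of the finite sets
  \<open>chain_set\<close>, so separated chains of every length exist. A chain with
  \<open>2 * n\<close> steps, numbered from its middle, is a ball of radius \<open>n\<close> in rank
  one.\<close>

lemma (in group) not_locally_finite_trees:
  assumes "\<not> locally_finite_group G"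
  shows "poly_trees G 1"
proof -
  obtain S0 where S0: "finite S0" "S0 \<subseteq> carrier G" "infinite (generate G S0)"
    using assms by (auto simp: locally_finite_group_def)
  define S where "S = S0 \<union> iv G S0"
  have S: "finite S" "S \<subseteq> carrier G" using S0 iv_closed by (simp_all add: S_def finite_iv)
  show ?thesis
    unfolding poly_trees_def
  proof (rule exI[of _ "4 * card S + 2"], rule exI[of _ 1], intro allI impI)
    fix D assume D: "finite D" "D \<subseteq> carrier G"
    define D' where "D' = sym_hull D"
    note D' = sym_hull[OF D, folded D'_def]
    define W where "W = D' <#> S"
    have W: "finite W" "W \<subseteq> carrier G" using D' S by (simp_all add: W_def finite_set_mult set_mult_closed)
    have "\<exists>u. tree_embedding G 1 (insert \<one> D) (sym_hull W) n u" for n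
    proof -
      have "finite (chain_set D' S m)" for m by (induction m) (simp_all add: D' S finite_set_mult)
      then have "\<not> generate G S0 \<subseteq> chain_set D' S (2 * n)"
        using S0(3) by (metis finite_subset)
      then obtain g where g: "g \<in> generate G S0" "g \<notin> chain_set D' S (2 * n)" by blast
      obtain xs where "set xs \<subseteq> S" "g = lprod xs"
        using generate_lprod[OF S0(2) g(1)] unfolding S_def by (elim exE conjE)
      with g(2) have xs: "set xs \<subseteq> S" "lprod xs \<notin> chain_set D' S (2 * n)" by simp_all
      obtain h where h: "\<forall>i\<le>2 * n. \<exists>m. h i = lprod (take m xs)"
        "\<forall>i j. i < j \<and> j \<le> 2 * n \<longrightarrow> inv (h i) \<otimes> h j \<notin> D'" "\<forall>i<2 * n. inv (h i) \<otimes> h (Suc i) \<in> W"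
        using separated_chain[OF S(2) D'(3,2) xs] unfolding W_def by (elim exE conjE)
      have hc: "h i \<in> carrier G" if i: "i \<le> 2 * n" for i
      proof -
        obtain m where "h i = lprod (take m xs)" using h(1) i by blast
        then show ?thesis using xs(1) S(2) by (auto intro!: lprod_closed dest!: in_set_takeD)
      qed
      have sep: "inv (h i) \<otimes> h j \<notin> D'" if ij: "i \<le> 2 * n" "j \<le> 2 * n" "i \<noteq> j" for i j
      proof (cases "i < j")
        case True
        then show ?thesis using h(2) ij by blast
      next
        case False
        then have "inv (h j) \<otimes> h i \<notin> D'" using h(2) ij by auto
        moreover have "inv (inv (h i) \<otimes> h j) = inv (h j) \<otimes> h i" using hc ij by (simp add: inv_mult_group)
        ultimately show ?thesis using D'(5) by metis
      qed
      \<comment> \<open>Index \<open>n\<close> of the chain is the centre; powers of the generator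
        go up from it and powers of its inverse go down.\<close>
      define pos where "pos w = (if (0, False) \<in> set w then n - length w else n + length w)" for w :: "letter list"
      have pos: "pos (replicate j (0, b)) = (if b then n + j else n - j)" for j b
        by (cases j) (auto simp: pos_def)
      have rep: "length w \<le> n \<and> (\<exists>b. w = replicate (length w) (0, b))" if "w \<in> word_ball 1 n" for w
        using that reduced_letters_1 by (auto simp: word_ball_def carrier_free_group)
      have pos_le: "pos w \<le> 2 * n" if "w \<in> word_ball 1 n" for w
        using rep[OF that] by (auto simp: pos_def)
      have inj: "v = w" if vw: "v \<in> word_ball 1 n" "w \<in> word_ball 1 n" "pos v = pos w" for v w
      proof -
        obtain i b where v: "v = replicate i (0, b)" "i \<le> n" using rep[OF vw(1)] by metis
        obtain j c where w: "w = replicate j (0, c)" "j \<le> n" using rep[OF vw(2)] by metis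
        have "(if b then n + i else n - i) = (if c then n + j else n - j)"
          using vw(3) pos[of i b] pos[of j c] v w by simp
        then show ?thesis using v w by (cases b; cases c) auto
      qed
      note sW = sym_hull[OF W]
      have "tree_embedding G 1 (insert \<one> D) (sym_hull W) n (\<lambda>w. h (pos w))"
      proof (rule tree_embeddingI)
        show "h (pos w) \<in> carrier G" if "w \<in> word_ball 1 n" for w using hc pos_le[OF that] .
        show "inv (h (pos v)) \<otimes> h (pos w) \<notin> insert \<one> D"
          if "v \<in> word_ball 1 n" "w \<in> word_ball 1 n" "v \<noteq> w" for v w
        proof -
          have "pos v \<noteq> pos w" using inj[OF that(1,2)] that(3) by metis
          from sep[OF pos_le[OF that(1)] pos_le[OF that(2)] this] show ?thesis using D'(3,4) by auto
        qed
        show "inv x \<in> sym_hull W" if "x \<in> sym_hull W" for x using sW(5)[OF that] .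
        show "inv (h (pos w)) \<otimes> h (pos (l # w)) \<in> sym_hull W"
          if lw: "l # w \<in> word_ball 1 n" and w: "w \<in> word_ball 1 n" for l w
        proof -
          obtain j b where "l # w = replicate j (0, b)" "j \<le> n" using rep[OF lw] by metis
          then obtain i where i: "w = replicate i (0, b)" "l = (0, b)" "Suc i \<le> n" by (cases j) auto
          have lw': "l # w = replicate (Suc i) (0, b)" using i by simp
          have pw: "pos w = (if b then n + i else n - i)" unfolding i(1) by (rule pos)
          have plw: "pos (l # w) = (if b then n + Suc i else n - Suc i)" unfolding lw' by (rule pos)
          show ?thesis
          proof (cases b)
            case True
            then have "pos w = n + i" "pos (l # w) = Suc (n + i)" using pw plw by simp_all
            then show ?thesis using h(3) i(3) sW(4) by auto
          next
            case False
            define p where "p = n - Suc i"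
            have p: "pos (l # w) = p" "pos w = Suc p" "p < 2 * n"
              using pw plw False i(3) by (auto simp: p_def)
            have "inv (inv (h p) \<otimes> h (Suc p)) \<in> sym_hull W" using h(3) p(3) sW(4) by (intro sW(5)) auto
            then show ?thesis using hc[of p] hc[of "Suc p"] p by (simp add: inv_mult_group)
          qed
        qed
      qed
      then show ?thesis by blast
    qed
    moreover have "card (sym_hull W) \<le> (4 * card S + 2) * (card D + 1) ^ 1"
    proof -
      have "card W \<le> 2 * (card D + 1) * card S"
        unfolding W_def by (intro card_set_mult_bound D' S order_refl)
      then have "2 * (card W + 1) \<le> 2 * (2 * (card D + 1) * card S + (card D + 1))" by simp
      also have "\<dots> = (4 * card S + 2) * (card D + 1) ^ 1" by (simp add: algebra_simps)
      finally have "2 * (card W + 1) \<le> (4 * card S + 2) * (card D + 1) ^ 1" .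
      with sym_hull(6)[OF W] show ?thesis by (rule order_trans)
    qed
    ultimately show "\<exists>W. finite W \<and> W \<subseteq> carrier G \<and> card W \<le> (4 * card S + 2) * (card D + 1) ^ 1 \<and>
        (\<forall>n. \<exists>u. tree_embedding G 1 (insert \<one> D) W n u)"
      using sym_hull(1,2)[OF W] by blast
  qed
qed

section \<open>The embeddings\<close>

lemma card_egg_states:
  assumes "finite A" "finite W"
  shows "finite (egg_states A k W)" "card (egg_states A k W) \<le> card A ^ 2 * (card W + 1) ^ (2 * k)"
proof -
  have fin: "finite (insert None (Some ` W))" using assms by simp
  have "card (insert None (Some ` W)) \<le> card W + 1"
    using card_insert_le_m1[of "card W + 1" "Some ` W" None] card_image_le[OF assms(2), of Some] by simp
  then have "card (insert None (Some ` W)) ^ (2 * k) \<le> (card W + 1) ^ (2 * k)" by (rule power_mono) simp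
  then show "card (egg_states A k W) \<le> card A ^ 2 * (card W + 1) ^ (2 * k)"
    unfolding egg_states_def by (simp add: card_cartesian_product card_PiE card_letters)
  show "finite (egg_states A k W)"
    unfolding egg_states_def using assms(1) fin card_letters(1) by (intro finite_cartesian_product finite_PiE) simp_all
qed

text \<open>The exponents \<open>c\<close> and \<open>q\<close> are known before \<open>n\<close>.
  So \<open>n\<close> can be chosen such that the states, with links ranging over a \<open>W\<close>
  that depends on \<open>D\<close>, still number at most \<open>2 ^ n\<close>.\<close>

lemma (in si_space) embeds_if_poly_trees:
  fixes H :: "('h, 'n) monoid_scheme" and A :: "'a set"
  assumes trees: "poly_trees G k" and A: "finite A" and H: "group H" "\<theta> \<in> iso H (free_group k)"
  shows "embeds_into (Aut_shift H A (full_shift H A)) (Aut_shift G B X)"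
proof -
  obtain a c where tr: "\<forall>D. finite D \<longrightarrow> D \<subseteq> carrier G \<longrightarrow>
     (\<exists>W. finite W \<and> W \<subseteq> carrier G \<and> card W \<le> a * (card D + 1) ^ c \<and>
       (\<forall>n. \<exists>u. tree_embedding G k (insert \<one> D) W n u))"
    using trees unfolding poly_trees_def by (elim exE)
  obtain p q where eg: "\<forall>n::nat. \<exists>F Win D. finite D \<and> D \<subseteq> carrier G \<and> card D \<le> p * (n + 1) ^ q \<and>
    (\<forall>St::((bool \<Rightarrow> 'a) \<times> (letter \<Rightarrow> 'g option)) set. finite St \<longrightarrow> card St \<le> 2 ^ n \<longrightarrow> (\<exists>e. eggs G B X K M St e F Win D))"
    using eggs_exist by (elim exE)
  \<comment> \<open>Then \<open>card W + 1\<close> is at most \<open>b * (n + 1) ^ (q * c)\<close>;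
    the further exponent \<open>2 * k\<close> is the number of links in a state.\<close>
  define b where "b = a * (p + 1) ^ c + 1"
  obtain n where n: "card A ^ 2 * b ^ (2 * k) * (n + 1) ^ (q * c * (2 * k)) < 2 ^ n"
    using poly_less_exp by blast
  obtain F Win D where D: "finite D" "D \<subseteq> carrier G" "card D \<le> p * (n + 1) ^ q"
    and St: "\<forall>St::((bool \<Rightarrow> 'a) \<times> (letter \<Rightarrow> 'g option)) set. finite St \<longrightarrow> card St \<le> 2 ^ n \<longrightarrow> (\<exists>e. eggs G B X K M St e F Win D)"
    using eg by (elim allE[of _ n] exE conjE)
  obtain W where W: "finite W" "W \<subseteq> carrier G" "card W \<le> a * (card D + 1) ^ c"
    and u: "\<forall>n. \<exists>u. tree_embedding G k (insert \<one> D) W n u"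
    using tr[rule_format, OF D(1,2)] by (elim exE conjE)
  have "card D + 1 \<le> p * (n + 1) ^ q + 1 * (n + 1) ^ q" using D(3) by (intro add_mono) simp_all
  also have "\<dots> = (p + 1) * (n + 1) ^ q" by (simp add: algebra_simps)
  finally have "(card D + 1) ^ c \<le> ((p + 1) * (n + 1) ^ q) ^ c" by (rule power_mono) simp
  also have "\<dots> = (p + 1) ^ c * (n + 1) ^ (q * c)" by (simp only: power_mult_distrib power_mult)
  finally have "a * (card D + 1) ^ c \<le> a * ((p + 1) ^ c * (n + 1) ^ (q * c))" by (rule mult_left_mono) simp
  with W(3) have "card W \<le> a * ((p + 1) ^ c * (n + 1) ^ (q * c))" by (rule order_trans)
  then have "card W + 1 \<le> a * ((p + 1) ^ c * (n + 1) ^ (q * c)) + 1 * (n + 1) ^ (q * c)"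
    by (rule add_mono) simp
  also have "\<dots> = b * (n + 1) ^ (q * c)" by (simp add: b_def algebra_simps)
  finally have "(card W + 1) ^ (2 * k) \<le> (b * (n + 1) ^ (q * c)) ^ (2 * k)" by (rule power_mono) simp
  also have "\<dots> = b ^ (2 * k) * (n + 1) ^ (q * c * (2 * k))" by (simp only: power_mult_distrib power_mult)
  finally have "card A ^ 2 * (card W + 1) ^ (2 * k) \<le> card A ^ 2 * (b ^ (2 * k) * (n + 1) ^ (q * c * (2 * k)))"
    by (rule mult_left_mono) simp
  also have "\<dots> < 2 ^ n" using n by (simp only: mult.assoc)
  finally have "card (egg_states A k W) \<le> 2 ^ n"
    using card_egg_states(2)[OF A W(1), of k] by simp
  then obtain e where e: "eggs G B X K M (egg_states A k W) e F Win D"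
    using St[rule_format, OF card_egg_states(1)[OF A W(1)]] by blast
  have "machine G B X K M (egg_states A k W) e F Win D A k W H \<theta>"
    by (rule machine.intro[OF e machine_axioms.intro[OF W(2) refl H(1) H(2)]]) (use u in blast)
  then show ?thesis by (rule machine.embeds[OF _ A])
qed

section \<open>The integers as the free group of rank one\<close>

definition int_word :: "int \<Rightarrow> letter list" where
  "int_word i = replicate (nat \<bar>i\<bar>) (0, 0 \<le> i)"

lemma push_int_word: "push (0, b) (int_word i) = int_word (i + (if b then 1 else - 1))"
proof (cases "nat \<bar>i\<bar>")
  case 0
  then show ?thesis by (simp add: int_word_def)
next
  case (Suc m)
  then have "i = (if 0 \<le> i then int (Suc m) else - int (Suc m))" by auto
  then obtain s where s: "i = (if s then int (Suc m) else - int (Suc m))" by metis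
  show ?thesis
    by (cases s; cases b) (auto simp: s int_word_def letter_inv_def nat_add_distrib split: nat.split)
qed

lemma push_replicate_int_word:
  "foldr push (replicate m (0, b)) (int_word i) = int_word (i + (if b then int m else - int m))"
  by (induction m) (simp_all add: push_int_word algebra_simps)

lemma reduced_replicate: "reduced (replicate m (0, b))"
proof (induction m)
  case (Suc m)
  then show ?case by (cases m) (auto simp: reduced_def letter_inv_def)
qed simp

lemma int_word_iso: "int_word \<in> iso integer_group (free_group 1)"
  unfolding iso_def
proof (intro CollectI conjI)
  show "int_word \<in> hom integer_group (free_group 1)"
  proof (rule homI)
    show "int_word i \<in> carrier (free_group 1)" for i
      by (auto simp: carrier_free_group int_word_def reduced_replicate letters_def)
    show "int_word (i \<otimes>\<^bsub>integer_group\<^esub> j) = int_word i \<otimes>\<^bsub>free_group 1\<^esub> int_word j" for i j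
      unfolding mult_free_group int_word_def[of i] push_replicate_int_word
      by (simp add: integer_group_def add.commute)
  qed
  show "bij_betw int_word (carrier integer_group) (carrier (free_group 1))"
  proof (rule bij_betwI')
    show "int_word i = int_word j \<longleftrightarrow> i = j" for i j
    proof
      assume eq: "int_word i = int_word j"
      then have "length (int_word i) = length (int_word j)" by simp
      then have abs: "\<bar>i\<bar> = \<bar>j\<bar>" by (simp add: int_word_def)
      show "i = j"
      proof (cases "i = 0")
        case False
        then have "hd (int_word i) = (0, 0 \<le> i)" "hd (int_word j) = (0, 0 \<le> j)"
          using abs by (simp_all add: int_word_def)
        then show ?thesis using eq abs by auto
      qed (use abs in simp)
    qed simp
    show "int_word i \<in> carrier (free_group 1)" for i
      by (auto simp: carrier_free_group int_word_def reduced_replicate letters_def)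
    fix w assume "w \<in> carrier (free_group 1)"
    then obtain b where b: "w = replicate (length w) (0, b)"
      using reduced_letters_1 by (auto simp: carrier_free_group)
    have "int_word (if b then int (length w) else - int (length w)) = replicate (length w) (0, b)"
      by (cases "length w = 0"; cases b) (simp_all add: int_word_def)
    then have "w = int_word (if b then int (length w) else - int (length w))" using b by simp
    then show "\<exists>i\<in>carrier integer_group. w = int_word i" by (auto simp: integer_group_def)
  qed
qed

lemma not_locally_finite_infinite:
  assumes "group G" "\<not> locally_finite_group G"
  shows "infinite (carrier G)"
proof
  assume "finite (carrier G)"
  then have "finite (generate G S)" if "S \<subseteq> carrier G" for S
    using group.generate_incl[OF assms(1) that] finite_subset by blast
  then show False using assms(2) by (auto simp: locally_finite_group_def)
qed

lemma nonamenable_infinite: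
  assumes "group G" "nonamenable G"
  shows "infinite (carrier G)"
proof
  interpret group G by fact
  assume fin: "finite (carrier G)"
  obtain T and \<delta> :: real where T: "T \<subseteq> carrier G" "\<delta> > 0"
    "\<forall>F. finite F \<and> F \<noteq> {} \<and> F \<subseteq> carrier G \<longrightarrow> real (card ((F <#>\<^bsub>G\<^esub> T) - F)) > \<delta> * real (card F)"
    using assms(2) unfolding nonamenable_def by (elim exE conjE)
  have "real (card ((carrier G <#>\<^bsub>G\<^esub> T) - carrier G)) > \<delta> * real (card (carrier G))"
    using T(3)[rule_format, of "carrier G"] fin one_closed by blast
  moreover have "(carrier G <#>\<^bsub>G\<^esub> T) - carrier G = {}" using set_mult_closed[of "carrier G" T] T(1) by auto
  ultimately have "\<delta> * real (card (carrier G)) < 0" by simp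
  then show False using T(2) by (simp add: mult_less_0_iff)
qed

theorem theorem4:
  fixes G :: "('g, 'm) monoid_scheme"
    and B :: "'b set" and X :: "('g \<Rightarrow> 'b) set"
    and A :: "'a set"
  assumes "group G"
    and "subshift G B X"
    and "nontrivial X"
    and "strongly_irreducible G X"
    and "strong_TMP G X"
    and "finite A"
  shows "(\<not> locally_finite_group G \<longrightarrow>
            embeds_into (Aut_shift integer_group A (full_shift integer_group A)) (Aut_shift G B X))
       \<and> (nonamenable G \<longrightarrow>
            (\<forall>k\<ge>1. embeds_into (Aut_shift (free_group k) A (full_shift (free_group k) A))
                               (Aut_shift G B X)))"
proof (intro conjI impI allI)
  assume nlf: "\<not> locally_finite_group G"
  obtain K M where "si_space G B X K M"
    using si_spaceI[OF assms(1-5) not_locally_finite_infinite[OF assms(1) nlf]] by blast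
  then show "embeds_into (Aut_shift integer_group A (full_shift integer_group A)) (Aut_shift G B X)"
    by (rule si_space.embeds_if_poly_trees[OF _ group.not_locally_finite_trees[OF assms(1) nlf] assms(6)
          group_integer_group int_word_iso])
next
  fix k assume na: "nonamenable G"
  obtain K M where "si_space G B X K M"
    using si_spaceI[OF assms(1-5) nonamenable_infinite[OF assms(1) na]] by blast
  moreover have "(\<lambda>w. w) \<in> iso (free_group k) (free_group k)" by (rule iso_set_refl)
  ultimately show "embeds_into (Aut_shift (free_group k) A (full_shift (free_group k) A)) (Aut_shift G B X)"
    by (intro si_space.embeds_if_poly_trees[OF _ group.nonamenable_trees[OF assms(1) na] assms(6)
          group_free_group])
qed

end
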